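(* Let $m,n\ge1$ and $k\ge2$ be integers, let $1<p_i<\infty$ for $i=1,\dots,m$, and let $p$ be defined by $\frac1p=\sum_{i=1}^m\frac1{p_i}$. Suppose that $p<q<\infty$, $0<\alpha<mn$ and $\frac1q=\frac1p-\frac{\alpha}{n}$. Suppose that $w_1,\dots,w_m$ are a.e. positive functions such that $w_i^{p_i}$ are weights on $\mathbb{R}^{kn}$ and $w_i(x^{(1)},\dots,x^{(k)})=w_i^{(1)}(x^{(1)})\cdots w_i^{(k)}(x^{(k)})$, $i=1,\dots,m$, where the $w_i^{(j)}$ are defined on $\mathbb{R}^n$. Let $\mathcal{S}_\alpha$ be either $\mathcal{M}^{(S)}_{\alpha,\dots,\alpha}$ or $\mathcal{I}_{\alpha,\dots,\alpha}$ (with $k$ indices equal to $\alpha$). Then there is a constant $C>0$ such that the one-weight inequality $$\bigg(\int_{ \mathbb{R}^{kn} }\Big[ \big| \mathcal{S}_{\alpha}(\overrightarrow{f})(x) \big| \Big( \prod_{i=1}^m w_i(x)\Big) \Big]^q dx \bigg)^{1/q} \leq C \prod_{i=1}^m \bigg( \int_{\mathbb{R}^{kn}} \big[ | f_i(x) |\, w_i(x)\big]^{p_i} dx \bigg)^{1/p_i}$$ holds for all $\overrightarrow{f}=(f_1,\dots,f_m)\in L^{p_1}_{w_1^{p_1}}(\mathbb{R}^{kn})\times\cdots\times L^{p_m}_{w_m^{p_m}}(\mathbb{R}^{kn})$ if and only if $$\sup_{Q_1,\dots, Q_k\in \mathcal{Q} } \bigg( \frac{1}{\prod_{j=1}^k|Q_j|}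 \int_{Q_1 \times\cdots \times Q_k} \Big( \prod_{i=1}^m w_i\Big)^{q}\,dx\bigg)^{1/q} \prod_{i=1}^m \bigg( \frac{1}{\prod_{j=1}^k|Q_j|} \int_{Q_1\times \cdots \times Q_k} w_i^{-p_i'}\,dx\bigg)^{1/p_i'}< \infty.$$
   Context: $p_i'=p_i/(p_i-1)$. $\mathcal{Q}$ is the family of all cubes in $\mathbb{R}^n$ with sides parallel to the coordinate axes, and $|Q|$ is the volume of $Q$. A weight is an a.e. positive, locally integrable function. For a weight $\rho$ and $0<r<\infty$, $L^r_\rho$ is the class of measurable $f$ with $\|f\|_{L^r_\rho}=\big(\int|f|^r\rho\,dx\big)^{1/r}<\infty$. Points of $\mathbb{R}^{kn}$ are written $x=(x^{(1)},\dots,x^{(k)})$ with $x^{(j)}\in\mathbb{R}^n$. The multi(sub)linear strong fractional maximal operator is $$\mathcal{M}^{(S)}_{\alpha_1,\dots, \alpha_k}(\overrightarrow{f})(x) = \sup_{ Q^{(1)} \times \cdots \times Q^{(k)} \ni x}\ \frac{1}{ |Q^{(1)}|^{m-\alpha_1/n} \cdots |Q^{(k)}|^{m-\alpha_k/n} } \prod_{i=1}^m \int_{Q^{(1)}\times\cdots \times Q^{(k)}} |f_i(y_i)|\,dy_i,$$ where the supremum is taken over all products of cubes $Q^{(1)},\dots,Q^{(k)}\in\mathcal{Q}$ containing $x^{(1)},\dots,x^{(k)}$ respectively. The multilinear Riesz potential operator with product kernels is $$\mathcal{I}_{\alpha_1, \dots, \alpha_k} (\overrightarrow{f})(x^{(1)},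 \dots, x^{(k)})= \int_{ (\mathbb{R}^{kn})^m }\frac{ \prod_{i=1}^m f_i (y^{(1)}_i,\dots, y^{(k)}_i)}{ \prod_{s=1}^k \big(\sum_{i=1}^m |x^{(s)}-y_i^{(s)}|\big)^{mn-\alpha_s} }\, dy_1\cdots dy_m,$$ where $y_i=(y_i^{(1)},\dots,y_i^{(k)})\in\mathbb{R}^{kn}$. *)

theory Defs
  imports "HOL-Analysis.Analysis"
begin

(* Points of R^(kn) are x :: real^'n^'k with n = CARD('n), k = CARD('k) and
   x^(j) = x $ j; the index i = 1..m ranges over a finite type 'm. *)

definition cubes :: "(real ^ 'n) set set" where
  "cubes = {Q. \<exists>a b l. l > 0 \<and> (\<forall>i. b $ i - a $ i = l) \<and> Q = cbox a b}"

definition cube_prod :: "('k \<Rightarrow> (real ^ 'n) set) \<Rightarrow> (real ^ 'n ^ 'k) set" where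
  "cube_prod Q = {x. \<forall>j. x $ j \<in> Q j}"

definition weight :: "('a::euclidean_space \<Rightarrow> real) \<Rightarrow> bool" where
  "weight \<rho> \<longleftrightarrow> (AE x in lebesgue. 0 < \<rho> x) \<and>
     (\<forall>K. compact K \<longrightarrow> set_integrable lebesgue K \<rho>)"

(* Only meant for exponents a > 0; all integrals and suprema below are taken in [0,\<infinity>]. *)
definition enn_powr :: "ennreal \<Rightarrow> real \<Rightarrow> ennreal" (infixr "epowr" 80) where
  "x epowr a = (if x = \<infinity> then \<infinity> else ennreal (enn2real x powr a))"

definition weighted_Lp :: "real \<Rightarrow> ('a::euclidean_space \<Rightarrow> real) \<Rightarrow> ('a \<Rightarrow> complex) set" where
  "weighted_Lp r \<rho> = {f. f \<in> borel_measurable lebesgue \<and>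
     (\<integral>\<^sup>+ x. ennreal (norm (f x) powr r * \<rho> x) \<partial>lebesgue) < \<infinity>}"

definition conj_exponent :: "real \<Rightarrow> real" where
  "conj_exponent p = p / (p - 1)"

definition strong_frac_maximal ::
  "('k::finite \<Rightarrow> real) \<Rightarrow> ('m::finite \<Rightarrow> real ^ 'n ^ 'k \<Rightarrow> complex) \<Rightarrow> real ^ 'n ^ 'k \<Rightarrow> ennreal" where
  "strong_frac_maximal \<alpha> f x =
     (SUP Q \<in> {Q. (\<forall>j. Q j \<in> cubes) \<and> x \<in> cube_prod Q}.
        ennreal (1 / (\<Prod>j\<in>UNIV. measure lebesgue (Q j) powr (real CARD('m) - \<alpha> j / real CARD('n)))) *
        (\<Prod>i\<in>UNIV. \<integral>\<^sup>+ y. ennreal (norm (f i y)) * indicator (cube_prod Q) y \<partial>lebesgue))"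

definition riesz_integrand ::
  "('k::finite \<Rightarrow> real) \<Rightarrow> ('m::finite \<Rightarrow> real ^ 'n ^ 'k \<Rightarrow> complex) \<Rightarrow> real ^ 'n ^ 'k
     \<Rightarrow> real ^ 'n ^ 'k ^ 'm \<Rightarrow> complex" where
  "riesz_integrand \<alpha> f x y =
     (\<Prod>i\<in>UNIV. f i (y $ i)) /
     of_real (\<Prod>s\<in>UNIV. (\<Sum>i\<in>UNIV. norm (x $ s - y $ i $ s))
                          powr (real CARD('m) * real CARD('n) - \<alpha> s))"

definition riesz_prod ::
  "('k::finite \<Rightarrow> real) \<Rightarrow> ('m::finite \<Rightarrow> real ^ 'n ^ 'k \<Rightarrow> complex) \<Rightarrow> real ^ 'n ^ 'k \<Rightarrow> complex" where
  "riesz_prod \<alpha> f x = (LINT y|lebesgue. riesz_integrand \<alpha> f x y)"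

(* The Bochner integral is 0 for non-integrable functions.  To keep an inequality for
   |riesz_prod| from holding vacuously, its value is taken to be \<infinity> wherever the integral does
   not converge absolutely; for f \<ge> 0 this is the actual value of the integral. *)
definition riesz_prod_abs ::
  "('k::finite \<Rightarrow> real) \<Rightarrow> ('m::finite \<Rightarrow> real ^ 'n ^ 'k \<Rightarrow> complex) \<Rightarrow> real ^ 'n ^ 'k \<Rightarrow> ennreal" where
  "riesz_prod_abs \<alpha> f x =
     (if integrable lebesgue (riesz_integrand \<alpha> f x) then ennreal (norm (riesz_prod \<alpha> f x)) else \<infinity>)"

end

(*
  With \<sigma>_i = w_i^(-p_i'), u = (prod w_i)^q and f_i = g_i \<sigma>_i, the weight condition bounds the
  normalisation |Q|^(\<alpha>/n - m) by u(Q)^(-1/q) prod \<sigma>_i(Q)^(1/p_i - 1), because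
  m - \<alpha>/n = 1/q + sum 1/p_i'.  Both operators are dominated by a sum over products Q of cubes of a
  fixed grid (overlapping, so that every cube lies in a grid cube of comparable size).  For q > 1
  duality, and for q <= 1 the inequality (sum a)^q <= sum a^q, reduces the claim to multilinear
  sums of the quantities \<sigma>(Q)^(1/r - 1) times the integral of g d\<sigma> over Q.  Since
  sum 1/p_i > 1/q, Hoelder's inequality leaves room to reduce these to the linear embedding of
  L^r(\<sigma>) into l^t over the grid with t > r > 1.  In one parameter this embedding follows by splitting
  g at height \<sigma>(Q)^(-1/r) and summing geometric series along the cubes containing a point: the
  pointwise identity u^(1/q) prod \<sigma>_i^(1/p_i') = 1 turns the weight condition into an A_infinity
  property of each factor, hence doubling and reverse doubling.  Minkowski's inequality tensorises
  the embedding over the k factors, which is where the product form of the weights is used.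
  Conversely, both operators exceed a multiple of |Q|^(\<alpha>/n - m) prod (integral of f_i over Q) on Q
  for f >= 0, and truncations of \<sigma>_i 1_Q are the test functions.
*)
theory Submission
  imports Defs
begin

section \<open>Extended nonnegative powers and integral inequalities\<close>

text \<open>The gap t > r is not a convenience. For t = r the embedding fails already when g is the
  indicator of a cube Q: every generation of sub-cubes contributes at least a fixed multiple of
  \<sigma>(Q), and there are infinitely many generations. The strict inequality sum 1/p_i > 1/q,
  that is \<alpha> > 0, therefore pays for summing over all cubes of the grid. No stopping-time or
  sparse selection is made; such selections rest on the nesting of dyadic cubes, which rectangles of
  several parameters lack. A sum over a full Cartesian product of grids is, for split weights, a
  tensor product of one-parameter sums. The weight condition, however, speaks of products of cubes
  only; unit cubes in the other coordinates extract from it a condition on a single coordinate. The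
  weights u and \<sigma>_i are indexed together by \<open>'m option\<close>, \<open>None\<close>
  standing for u, with exponents 1/q and 1/p_i'; this symmetry lets the dual function enter as one
  more slot. The pointwise identity is needed everywhere, while the given factors of w_i may be
  neither measurable nor positive; hence they are first exchanged for Borel functions that are
  positive everywhere.\<close>

abbreviation nn_sum :: "('a \<Rightarrow> ennreal) \<Rightarrow> ennreal" (binder "\<Sum>\<^sup>+" [61] 61) where
  "nn_sum f \<equiv> integral\<^sup>N (count_space UNIV) f"

lemma epowr_ennreal: "0 \<le> x \<Longrightarrow> ennreal x epowr a = ennreal (x powr a)"
  by (simp add: enn_powr_def)

lemma epowr_top [simp]: "top epowr a = top" "\<infinity> epowr a = top"
  by (simp_all add: enn_powr_def)

lemma epowr_zero [simp]: "0 epowr a = 0"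
  by (simp add: enn_powr_def)

lemma epowr_one_left [simp]: "1 epowr a = 1"
  by (simp add: enn_powr_def)

lemma epowr_one [simp]: "x epowr 1 = x"
  by (cases x) (simp_all add: enn_powr_def)

lemma epowr_eq_0_iff [simp]: "x epowr a = 0 \<longleftrightarrow> x = 0"
  by (cases x) (simp_all add: enn_powr_def)

lemma epowr_eq_top_iff [simp]: "x epowr a = top \<longleftrightarrow> x = top"
  by (cases x) (simp_all add: enn_powr_def)

lemma epowr_mono: "x \<le> y \<Longrightarrow> 0 \<le> a \<Longrightarrow> x epowr a \<le> y epowr a"
  by (cases x; cases y) (auto simp: epowr_ennreal powr_mono2 top_unique)

lemma epowr_mult: "(x * y) epowr a = x epowr a * y epowr a"
proof (cases "x = top \<or> y = top")
  case True
  then show ?thesis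
    by (cases "x = 0 \<or> y = 0") (auto simp: ennreal_top_mult ennreal_mult_top)
next
  case False
  then show ?thesis
    by (cases x; cases y) (auto simp: epowr_ennreal powr_mult simp flip: ennreal_mult)
qed

lemma epowr_prod: "(\<Prod>i\<in>A. f i) epowr a = (\<Prod>i\<in>A. f i epowr a)"
  by (induction A rule: infinite_finite_induct) (simp_all add: epowr_mult)

lemma epowr_epowr: "(x epowr a) epowr b = x epowr (a * b)"
  by (cases x) (simp_all add: epowr_ennreal powr_powr)

lemma epowr_add: "x epowr (a + b) = x epowr a * x epowr b"
  by (cases x) (auto simp: epowr_ennreal powr_add ennreal_mult ennreal_top_mult)

lemma epowr_le_iff: "0 < a \<Longrightarrow> x epowr a \<le> y \<longleftrightarrow> x \<le> y epowr (1 / a)"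
proof
  assume a: "0 < a"
  show "x \<le> y epowr (1 / a)" if "x epowr a \<le> y"
    using epowr_mono[OF that, of "1 / a"] a by (simp add: epowr_epowr)
  show "x epowr a \<le> y" if "x \<le> y epowr (1 / a)"
    using epowr_mono[OF that, of a] a by (simp add: epowr_epowr)
qed

text \<open>For \<open>0 < a\<close> the power is an order isomorphism of [0,\<infinity>] with
  inverse power \<open>1 / a\<close>, hence commutes with suprema.\<close>

lemma epowr_SUP:
  assumes "0 < a"
  shows "(SUP i\<in>I. f i) epowr a = (SUP i\<in>I. f i epowr a)"
proof (rule antisym)
  show "(SUP i\<in>I. f i) epowr a \<le> (SUP i\<in>I. f i epowr a)"
    using assms by (auto simp: epowr_le_iff intro!: SUP_least)
       (auto simp flip: epowr_le_iff intro: SUP_upper)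
  show "(SUP i\<in>I. f i epowr a) \<le> (SUP i\<in>I. f i) epowr a"
    using assms by (auto intro!: SUP_least epowr_mono SUP_upper)
qed

lemma borel_measurable_epowr [measurable (raw)]:
  assumes [measurable]: "f \<in> borel_measurable M"
  shows "(\<lambda>x. f x epowr a) \<in> borel_measurable M"
  unfolding enn_powr_def by measurable

lemma epowr_add_le:
  assumes "0 < a"
  shows "(x + y) epowr a \<le> ennreal (2 powr a) * (x epowr a + y epowr a)"
proof -
  have "(x + y) epowr a \<le> (2 * max x y) epowr a"
    using assms by (intro epowr_mono) (auto simp: mult_2 intro!: add_mono)
  also have "... = ennreal (2 powr a) * (max x y) epowr a"
    using epowr_ennreal[of 2 a] by (simp add: epowr_mult)
  also have "... \<le> ennreal (2 powr a) * (x epowr a + y epowr a)"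
    by (intro mult_left_mono) (auto simp: max_def)
  finally show ?thesis .
qed

text \<open>Convexity of exp at the points \<open>t i * ln (x i)\<close> with weights
  \<open>1 / t i\<close>; this is Young's inequality for many factors. A zero factor is split off
  because it has no logarithm.\<close>

lemma weighted_AM_GM:
  fixes x t :: "'i \<Rightarrow> real"
  assumes "finite I" "\<And>i. i \<in> I \<Longrightarrow> 0 \<le> x i" "\<And>i. i \<in> I \<Longrightarrow> 0 < t i" "(\<Sum>i\<in>I. 1 / t i) = 1"
  shows "(\<Prod>i\<in>I. x i) \<le> (\<Sum>i\<in>I. x i powr t i / t i)"
proof (cases "\<exists>i\<in>I. x i = 0")
  case True
  then have "(\<Prod>i\<in>I. x i) = 0" using assms by simp
  also have "0 \<le> (\<Sum>i\<in>I. x i powr t i / t i)"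
    using assms by (intro sum_nonneg) (auto intro!: divide_nonneg_pos)
  finally show ?thesis .
next
  case False
  then have pos: "0 < x i" if "i \<in> I" for i using assms(2) that by force
  have ne: "I \<noteq> {}" using assms(4) by auto
  have "exp (\<Sum>i\<in>I. (1 / t i) *\<^sub>R (t i * ln (x i))) \<le> (\<Sum>i\<in>I. (1 / t i) * exp (t i * ln (x i)))"
    by (rule convex_on_sum[OF assms(1) ne exp_convex assms(4)]) (use assms in \<open>auto simp: less_imp_le\<close>)
  moreover have "exp (\<Sum>i\<in>I. (1 / t i) *\<^sub>R (t i * ln (x i))) = (\<Prod>i\<in>I. x i)"
  proof -
    have "(\<Sum>i\<in>I. (1 / t i) *\<^sub>R (t i * ln (x i))) = (\<Sum>i\<in>I. ln (x i))"
      by (rule sum.cong) (use assms(3) in \<open>auto simp: less_imp_neq[symmetric]\<close>)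
    then show ?thesis using pos assms(1) by (simp add: exp_sum)
  qed
  moreover have "(\<Sum>i\<in>I. (1 / t i) * exp (t i * ln (x i))) = (\<Sum>i\<in>I. x i powr t i / t i)"
    by (rule sum.cong) (use pos in \<open>auto simp: powr_def less_imp_neq[symmetric]\<close>)
  ultimately show ?thesis by simp
qed

text \<open>Dividing each factor by its norm \<open>r i\<close> reduces the claim to the pointwise
  inequality \<open>weighted_AM_GM\<close>. This needs norms in (0,\<infinity>). A vanishing norm is
  treated before an infinite one: it makes the right side 0 even next to an infinite factor, as
  \<open>0 * top = 0\<close>, and the integrand then vanishes almost everywhere.\<close>

lemma nn_integral_Hoelder:
  fixes f :: "'i \<Rightarrow> 'a \<Rightarrow> ennreal"
  assumes I: "finite I" and f [measurable]: "\<And>i. i \<in> I \<Longrightarrow> f i \<in> borel_measurable M"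
    and t: "\<And>i. i \<in> I \<Longrightarrow> 0 < t i" "(\<Sum>i\<in>I. 1 / t i) = 1"
  shows "(\<integral>\<^sup>+x. (\<Prod>i\<in>I. f i x) \<partial>M) \<le> (\<Prod>i\<in>I. (\<integral>\<^sup>+x. f i x epowr t i \<partial>M) epowr (1 / t i))"
proof -
  define F where "F i = (\<integral>\<^sup>+x. f i x epowr t i \<partial>M)" for i
  consider (zero) i where "i \<in> I" "F i = 0" | (top) "\<And>i. i \<in> I \<Longrightarrow> F i \<noteq> 0" "\<exists>i\<in>I. F i = top"
    | (fin) "\<And>i. i \<in> I \<Longrightarrow> F i \<noteq> 0 \<and> F i \<noteq> top" by blast
  then show ?thesis
  proof cases
    case zero
    then have "AE x in M. f i x epowr t i = 0"
      unfolding F_def by (subst (asm) nn_integral_0_iff_AE) auto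
    then have "AE x in M. (\<Prod>i\<in>I. f i x) = 0"
      using zero I by (auto simp: prod_zero_iff)
    then have "(\<integral>\<^sup>+x. (\<Prod>i\<in>I. f i x) \<partial>M) = (\<integral>\<^sup>+x. 0 \<partial>M)"
      by (intro nn_integral_cong_AE) auto
    then show ?thesis by simp
  next
    case top
    then have "(\<Prod>i\<in>I. F i epowr (1 / t i)) = top"
      using I by (auto simp: ennreal_prod_eq_top)
    then show ?thesis by (simp add: F_def)
  next
    case fin
    define r where "r i = enn2real (F i) powr (1 / t i)" for i
    have r: "0 < r i" "F i epowr (1 / t i) = ennreal (r i)" "F i = ennreal (r i powr t i)" if "i \<in> I" for i
    proof -
      have "F i \<noteq> 0" "F i \<noteq> top" using fin that by auto
      then obtain s where s: "F i = ennreal s" "0 < s"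
        by (cases "F i") (auto simp: order.order_iff_strict)
      show "0 < r i" "F i epowr (1 / t i) = ennreal (r i)" "F i = ennreal (r i powr t i)"
        using s t(1)[OF that] by (auto simp: r_def epowr_ennreal powr_powr)
    qed
    define R where "R = (\<Prod>i\<in>I. r i)"
    have R: "0 < R" unfolding R_def using r by (auto intro!: prod_pos)
    have pw: "(\<Prod>i\<in>I. f i x) \<le> ennreal R * (\<Sum>i\<in>I. ennreal (1 / (t i * r i powr t i)) * f i x epowr t i)" for x
    proof (cases "\<exists>i\<in>I. f i x = top")
      case True
      then obtain i where i: "i \<in> I" "f i x = top" by auto
      then have "ennreal (1 / (t i * r i powr t i)) * f i x epowr t i = top"
        using r[OF i(1)] t(1)[OF i(1)] by (simp add: ennreal_mult_eq_top_iff)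
      then have "(\<Sum>i\<in>I. ennreal (1 / (t i * r i powr t i)) * f i x epowr t i) = top"
        using I i by (auto intro!: bexI[of _ i])
      then show ?thesis using R by (simp add: ennreal_mult_top)
    next
      case False
      define y where "y i = enn2real (f i x)" for i
      have y: "f i x = ennreal (y i)" "0 \<le> y i" if "i \<in> I" for i
        using False that by (auto simp: y_def less_top)
      have "(\<Prod>i\<in>I. y i / r i) \<le> (\<Sum>i\<in>I. (y i / r i) powr t i / t i)"
        by (rule weighted_AM_GM[OF I _ t]) (use y r in \<open>auto simp: less_imp_le\<close>)
      then have "(\<Prod>i\<in>I. y i) \<le> R * (\<Sum>i\<in>I. (y i / r i) powr t i / t i)"
        using R by (simp add: R_def prod_dividef field_simps)
      also have "(\<Sum>i\<in>I. (y i / r i) powr t i / t i) = (\<Sum>i\<in>I. 1 / (t i * r i powr t i) * y i powr t i)"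
        by (rule sum.cong) (use y r in \<open>auto simp: powr_divide less_imp_le\<close>)
      finally have "ennreal (\<Prod>i\<in>I. y i) \<le> ennreal (R * (\<Sum>i\<in>I. 1 / (t i * r i powr t i) * y i powr t i))"
        by (rule ennreal_leI)
      also have "... = ennreal R * (\<Sum>i\<in>I. ennreal (1 / (t i * r i powr t i) * y i powr t i))"
        using R t(1) by (subst ennreal_mult) (auto intro!: sum_nonneg simp: less_imp_le)
      also have "(\<Sum>i\<in>I. ennreal (1 / (t i * r i powr t i) * y i powr t i)) =
          (\<Sum>i\<in>I. ennreal (1 / (t i * r i powr t i)) * f i x epowr t i)"
      proof (rule sum.cong[OF refl])
        fix i assume i: "i \<in> I"
        have "ennreal (1 / (t i * r i powr t i) * y i powr t i) =
            ennreal (1 / (t i * r i powr t i)) * ennreal (y i powr t i)"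
          using t(1)[OF i] by (intro ennreal_mult) auto
        then show "ennreal (1 / (t i * r i powr t i) * y i powr t i) =
            ennreal (1 / (t i * r i powr t i)) * f i x epowr t i"
          using y[OF i] by (simp add: epowr_ennreal)
      qed
      also have "ennreal (\<Prod>i\<in>I. y i) = (\<Prod>i\<in>I. f i x)"
        using y by (simp add: prod_ennreal)
      finally show ?thesis .
    qed
    have "(\<integral>\<^sup>+x. (\<Prod>i\<in>I. f i x) \<partial>M) \<le>
        (\<integral>\<^sup>+x. ennreal R * (\<Sum>i\<in>I. ennreal (1 / (t i * r i powr t i)) * f i x epowr t i) \<partial>M)"
      by (rule nn_integral_mono) (rule pw)
    also have "... = ennreal R * (\<Sum>i\<in>I. ennreal (1 / (t i * r i powr t i)) * F i)"
      by (simp add: nn_integral_cmult nn_integral_sum F_def)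
    also have "(\<Sum>i\<in>I. ennreal (1 / (t i * r i powr t i)) * F i) = (\<Sum>i\<in>I. ennreal (1 / t i))"
    proof (rule sum.cong[OF refl])
      fix i assume i: "i \<in> I"
      show "ennreal (1 / (t i * r i powr t i)) * F i = ennreal (1 / t i)"
        using r(1)[OF i] t(1)[OF i] by (subst r(3)[OF i]) (simp flip: ennreal_mult)
    qed
    also have "... = 1" using t by (subst sum_ennreal) (auto simp: less_imp_le)
    also have "ennreal R = (\<Prod>i\<in>I. F i epowr (1 / t i))"
      using r by (simp add: R_def prod_ennreal less_imp_le)
    finally show ?thesis by (simp add: F_def)
  qed
qed

lemma nn_integral_Hoelder2:
  assumes [measurable]: "f \<in> borel_measurable M" "g \<in> borel_measurable M" and p: "1 < p"
  shows "(\<integral>\<^sup>+x. f x * g x \<partial>M) \<le>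
    (\<integral>\<^sup>+x. f x epowr p \<partial>M) epowr (1 / p) * (\<integral>\<^sup>+x. g x epowr (p / (p - 1)) \<partial>M) epowr (1 - 1 / p)"
proof -
  have "(\<integral>\<^sup>+x. (\<Prod>i\<in>UNIV. (if i then f else g) x) \<partial>M) \<le>
    (\<Prod>i\<in>UNIV. (\<integral>\<^sup>+x. (if i then f else g) x epowr (if i then p else p / (p - 1)) \<partial>M)
      epowr (1 / (if i then p else p / (p - 1))))"
    using p by (intro nn_integral_Hoelder) (auto simp: UNIV_bool diff_divide_distrib)
  then show ?thesis
    using p by (simp add: UNIV_bool mult.commute diff_divide_distrib)
qed

text \<open>Division of the second hypothesis by a power of \<open>X\<close>. Finiteness is
  essential: for \<open>X = top\<close> the inequality holds with every positive
  \<open>N\<close>.\<close>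

lemma ennreal_le_mult_epowr_cancel:
  assumes "X < top" "X \<le> N * X epowr (1 - 1 / p)" "1 < p"
  shows "X epowr (1 / p) \<le> N"
proof (cases "X = 0")
  case False
  obtain x where x: "X = ennreal x" "0 < x"
    using assms(1) False by (cases X) (auto simp: order.order_iff_strict)
  have "X epowr (1 / p) = X * ennreal (x powr (1 / p - 1))"
    using x by (simp add: epowr_ennreal powr_diff flip: ennreal_mult)
  also have "... \<le> N * X epowr (1 - 1 / p) * ennreal (x powr (1 / p - 1))"
    by (intro mult_right_mono assms) auto
  also have "... = N * ennreal (x powr (1 - 1 / p) * x powr (1 / p - 1))"
    using x by (simp add: epowr_ennreal ennreal_mult mult.assoc)
  also have "x powr (1 - 1 / p) * x powr (1 / p - 1) = 1"
    using x by (simp flip: powr_add)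
  finally show ?thesis by simp
qed simp

text \<open>The converse of Hoelder's inequality. The extremal function
  \<open>F epowr (p - 1)\<close> may have infinite norm, which could not be cancelled; it is built
  instead from the truncations \<open>G n\<close>, bounded by \<open>n\<close> and supported on sets
  of finite measure, and monotone convergence returns to \<open>F\<close>.\<close>

lemma (in sigma_finite_measure) Lp_norm_le_by_duality:
  assumes F [measurable]: "F \<in> borel_measurable M" and p: "1 < p"
    and dual: "\<And>h. h \<in> borel_measurable M \<Longrightarrow>
      (\<integral>\<^sup>+x. F x * h x \<partial>M) \<le> N * (\<integral>\<^sup>+x. h x epowr (p / (p - 1)) \<partial>M) epowr (1 - 1 / p)"
  shows "(\<integral>\<^sup>+x. F x epowr p \<partial>M) epowr (1 / p) \<le> N"
proof -
  obtain A :: "nat \<Rightarrow> 'a set" where A: "range A \<subseteq> sets M" "(\<Union>i. A i) = space M"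
      "\<And>i. emeasure M (A i) \<noteq> \<infinity>" "incseq A"
    using sigma_finite_incseq by blast
  have [measurable]: "A i \<in> sets M" for i using A by auto
  define G where "G n x = min (F x) (of_nat n) * indicator (A n) x" for n x
  have [measurable]: "G n \<in> borel_measurable M" for n unfolding G_def by measurable
  have G_le: "G n x \<le> F x" for n x by (auto simp: G_def indicator_def)
  have bound: "(\<integral>\<^sup>+x. G n x epowr p \<partial>M) epowr (1 / p) \<le> N" for n
  proof (rule ennreal_le_mult_epowr_cancel)
    have "(\<integral>\<^sup>+x. G n x epowr p \<partial>M) \<le> (\<integral>\<^sup>+x. ennreal (real n powr p) * indicator (A n) x \<partial>M)"
    proof (rule nn_integral_mono)
      fix x
      have "G n x epowr p \<le> (ennreal (real n) * indicator (A n) x) epowr p"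
        using p by (intro epowr_mono) (auto simp: G_def indicator_def ennreal_of_nat_eq_real_of_nat)
      then show "G n x epowr p \<le> ennreal (real n powr p) * indicator (A n) x"
        by (auto simp: indicator_def epowr_ennreal)
    qed
    also have "... = ennreal (real n powr p) * emeasure M (A n)"
      by (simp add: nn_integral_cmult)
    also have "... < top" using A(3)[of n] by (simp add: ennreal_mult_less_top less_top)
    finally show "(\<integral>\<^sup>+x. G n x epowr p \<partial>M) < top" .
    \<comment> \<open>The conjugate power \<open>p / (p - 1)\<close> of the test function
      \<open>G n epowr (p - 1)\<close> is again \<open>G n epowr p\<close>, so the same finite
      integral appears on both sides.\<close>
    have "(\<integral>\<^sup>+x. G n x epowr p \<partial>M) \<le> (\<integral>\<^sup>+x. F x * G n x epowr (p - 1) \<partial>M)"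
    proof (rule nn_integral_mono)
      fix x
      have "G n x epowr p = G n x * G n x epowr (p - 1)"
        using epowr_add[of "G n x" 1 "p - 1"] by simp
      also have "... \<le> F x * G n x epowr (p - 1)" by (intro mult_right_mono G_le) auto
      finally show "G n x epowr p \<le> F x * G n x epowr (p - 1)" .
    qed
    also have "... \<le> N * (\<integral>\<^sup>+x. (G n x epowr (p - 1)) epowr (p / (p - 1)) \<partial>M) epowr (1 - 1 / p)"
      by (rule dual) measurable
    also have "... = N * (\<integral>\<^sup>+x. G n x epowr p \<partial>M) epowr (1 - 1 / p)"
      using p by (simp add: epowr_epowr)
    finally show "(\<integral>\<^sup>+x. G n x epowr p \<partial>M) \<le> N * (\<integral>\<^sup>+x. G n x epowr p \<partial>M) epowr (1 - 1 / p)" .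
  qed fact
  have inc: "incseq G"
  proof (rule incseq_SucI, rule le_funI)
    fix n x
    have "A n \<subseteq> A (Suc n)" using A(4) by (auto simp: incseq_def)
    then have ind: "indicator (A n) x \<le> (indicator (A (Suc n)) x :: ennreal)"
      by (auto simp: indicator_def)
    have "(of_nat n :: ennreal) \<le> of_nat (Suc n)" by (intro of_nat_mono) simp
    then have "min (F x) (of_nat n) \<le> min (F x) (of_nat (Suc n))" by (rule min.mono[OF order_refl])
    then show "G n x \<le> G (Suc n) x"
      unfolding G_def by (rule mult_mono[OF _ ind]) (rule zero_le)+
  qed
  have sup: "(SUP n. G n x) = F x" if x: "x \<in> space M" for x
  proof -
    obtain k where k: "x \<in> A k" using A(2) x by blast
    have "F x \<le> (SUP n. G n x)"
    proof -
      have "F x = (SUP n. min (F x) (of_nat n))"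
        using inf_SUP[of "F x" "\<lambda>n. of_nat n" "UNIV :: nat set"]
        by (simp only: ennreal_SUP_of_nat_eq_top inf_top_right) (simp only: inf_min)
      also have "... \<le> (SUP n. G n x)"
      proof (rule SUP_mono)
        fix n
        have "x \<in> A (max n k)" using k incseqD[OF A(4) max.cobounded2] by blast
        then have G: "G (max n k) x = min (F x) (of_nat (max n k))"
          unfolding G_def by (simp only: indicator_simps mult_1_right)
        have "min (F x) (of_nat n) \<le> min (F x) (of_nat (max n k))"
          by (rule min.mono[OF order_refl of_nat_mono[OF max.cobounded1]])
        then have "min (F x) (of_nat n) \<le> G (max n k) x" unfolding G .
        then show "\<exists>m\<in>UNIV. min (F x) (of_nat n) \<le> G m x" by (rule bexI) simp
      qed
      finally show ?thesis .
    qed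
    moreover have "(SUP n. G n x) \<le> F x" by (rule SUP_least) (rule G_le)
    ultimately show ?thesis by (rule antisym[rotated])
  qed
  have "(\<integral>\<^sup>+x. F x epowr p \<partial>M) = (\<integral>\<^sup>+x. (SUP n. G n x epowr p) \<partial>M)"
    using p by (intro nn_integral_cong) (simp add: sup flip: epowr_SUP)
  also have "... = (SUP n. \<integral>\<^sup>+x. G n x epowr p \<partial>M)"
    using inc p by (intro nn_integral_monotone_convergence_SUP)
      (auto simp: incseq_def le_fun_def intro!: epowr_mono)
  also have "... \<le> N epowr p"
    using bound p by (intro SUP_least) (simp add: epowr_le_iff)
  finally show ?thesis using p by (simp add: epowr_le_iff)
qed

text \<open>Duality turns the left side into a double integral against \<open>h\<close>, to which
  Fubini and then, for each fixed \<open>x\<close>, Hoelder in \<open>y\<close> apply.\<close>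

lemma (in pair_sigma_finite) nn_integral_Minkowski:
  assumes f [measurable]: "case_prod f \<in> borel_measurable (M1 \<Otimes>\<^sub>M M2)" and p: "1 \<le> p"
  shows "(\<integral>\<^sup>+y. (\<integral>\<^sup>+x. f x y \<partial>M1) epowr p \<partial>M2) epowr (1 / p)
    \<le> (\<integral>\<^sup>+x. (\<integral>\<^sup>+y. f x y epowr p \<partial>M2) epowr (1 / p) \<partial>M1)"
proof (cases "p = 1")
  case True
  then show ?thesis by (simp add: Fubini')
next
  case False
  then have p: "1 < p" using p by simp
  show ?thesis
  proof (rule M2.Lp_norm_le_by_duality[OF _ p])
    show "(\<lambda>y. \<integral>\<^sup>+x. f x y \<partial>M1) \<in> borel_measurable M2" by measurable
    fix h :: "'b \<Rightarrow> ennreal" assume h [measurable]: "h \<in> borel_measurable M2"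
    let ?H = "(\<integral>\<^sup>+y. h y epowr (p / (p - 1)) \<partial>M2) epowr (1 - 1 / p)"
    have "(\<integral>\<^sup>+y. (\<integral>\<^sup>+x. f x y \<partial>M1) * h y \<partial>M2) = (\<integral>\<^sup>+y. (\<integral>\<^sup>+x. f x y * h y \<partial>M1) \<partial>M2)"
      by (intro nn_integral_cong) (simp add: nn_integral_multc)
    also have "... = (\<integral>\<^sup>+x. (\<integral>\<^sup>+y. f x y * h y \<partial>M2) \<partial>M1)"
      by (rule Fubini') measurable
    also have "... \<le> (\<integral>\<^sup>+x. (\<integral>\<^sup>+y. f x y epowr p \<partial>M2) epowr (1 / p) * ?H \<partial>M1)"
      by (intro nn_integral_mono nn_integral_Hoelder2 p) measurable
    also have "... = (\<integral>\<^sup>+x. (\<integral>\<^sup>+y. f x y epowr p \<partial>M2) epowr (1 / p) \<partial>M1) * ?H"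
      by (rule nn_integral_multc) measurable
    finally show "(\<integral>\<^sup>+y. (\<integral>\<^sup>+x. f x y \<partial>M1) * h y \<partial>M2)
      \<le> (\<integral>\<^sup>+x. (\<integral>\<^sup>+y. f x y epowr p \<partial>M2) epowr (1 / p) \<partial>M1) * ?H" .
  qed
qed

section \<open>Finite powers of Euclidean spaces and tensor products of positive kernels\<close>

lemma borel_measurable_vec_nth [measurable]:
  "(\<lambda>x::'a::euclidean_space^'k::finite. x $ i) \<in> borel_measurable borel"
  by (intro borel_measurable_continuous_onI continuous_intros)

lemma measurable_vec_lambda [measurable]:
  "vec_lambda \<in> PiM (UNIV :: 'k::finite set) (\<lambda>_. borel :: 'a::euclidean_space measure) \<rightarrow>\<^sub>M borel"
  by (subst borel_measurable_euclidean_space) (auto simp: Basis_vec_def inner_axis)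

text \<open>Lebesgue measure is determined by boxes, and a box of \<open>'a^'k\<close> is a product
  of boxes since the basis consists of the \<open>axis i b\<close>. As \<open>'a\<close> is any
  Euclidean space, this serves both to split R^(kn) into k variables and to separate the m variables
  of the potential.\<close>

lemma lborel_vec_eq:
  "(lborel :: ('a::euclidean_space^'k::finite) measure) =
    distr (PiM UNIV (\<lambda>_. lborel)) borel vec_lambda"
proof (rule lborel_eqI)
  have meas [measurable]: "vec_lambda \<in> PiM (UNIV :: 'k set) (\<lambda>_. lborel :: 'a measure) \<rightarrow>\<^sub>M borel"
    using measurable_vec_lambda by (simp cong: measurable_cong_sets sets_PiM_cong)
  interpret product_sigma_finite "\<lambda>_::'k. lborel :: 'a measure" ..
  interpret finite_product_sigma_finite "\<lambda>_::'k. lborel :: 'a measure" UNIV by standard simp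
  fix l u :: "'a^'k" assume le: "\<And>b. b \<in> Basis \<Longrightarrow> l \<bullet> b \<le> u \<bullet> b"
  have le': "l $ i \<bullet> b \<le> u $ i \<bullet> b" if "b \<in> Basis" for i b
    using le[of "axis i b"] that by (simp add: inner_axis axis_in_Basis_iff)
  have vim: "vec_lambda -` box l u \<inter> space (PiM (UNIV :: 'k set) (\<lambda>_. lborel :: 'a measure)) =
      (\<Pi>\<^sub>E i\<in>UNIV. box (l $ i) (u $ i))"
  proof -
    have "x \<in> box l u \<longleftrightarrow> (\<forall>i. x $ i \<in> box (l $ i) (u $ i))" for x
      unfolding mem_box by (fastforce simp: Basis_vec_def inner_axis)
    then show ?thesis by (auto simp: space_PiM PiE_UNIV_domain Pi_iff)
  qed
  have "(\<Prod>b\<in>Basis. (u - l) \<bullet> b) = (\<Prod>i\<in>UNIV. \<Prod>b\<in>Basis. (u $ i - l $ i) \<bullet> b)"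
  proof -
    have B: "(Basis :: ('a^'k) set) = (\<lambda>(i, b). axis i b) ` (UNIV \<times> Basis)"
      by (auto simp: Basis_vec_def)
    have "inj_on (\<lambda>(i, b). axis i b :: 'a^'k) (UNIV \<times> Basis)"
      by (auto simp: inj_on_def axis_eq_axis)
    then show ?thesis
      unfolding B by (simp add: prod.reindex case_prod_beta' inner_axis prod.cartesian_product)
  qed
  moreover have "emeasure (distr (PiM UNIV (\<lambda>_. lborel)) borel vec_lambda) (box l u) =
      (\<Prod>i\<in>UNIV. ennreal (\<Prod>b\<in>Basis. (u $ i - l $ i) \<bullet> b))"
    by (subst emeasure_distr) (auto simp: vim measure_times emeasure_lborel_box_eq le' inner_diff_left)
  ultimately show "emeasure (distr (PiM UNIV (\<lambda>_. lborel)) borel vec_lambda) (box l u) =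
      (\<Prod>b\<in>Basis. (u - l) \<bullet> b)"
    using le' by (simp add: prod_ennreal prod_nonneg inner_diff_left)
qed simp

lemma measurable_vec_lambda_lborel [measurable]:
  "vec_lambda \<in> PiM (UNIV :: 'k::finite set) (\<lambda>_. lborel :: 'a::euclidean_space measure) \<rightarrow>\<^sub>M borel"
  using measurable_vec_lambda by (simp cong: measurable_cong_sets sets_PiM_cong)

lemma nn_integral_lborel_vec:
  fixes f :: "'a::euclidean_space^'k::finite \<Rightarrow> ennreal"
  assumes [measurable]: "f \<in> borel_measurable borel"
  shows "(\<integral>\<^sup>+x. f x \<partial>lborel) = (\<integral>\<^sup>+x. f (vec_lambda x) \<partial>PiM UNIV (\<lambda>_. lborel))"
  by (subst lborel_vec_eq) (simp add: nn_integral_distr)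

lemma nn_integral_lborel_vec_prod:
  fixes f :: "'k::finite \<Rightarrow> 'a::euclidean_space \<Rightarrow> ennreal"
  assumes [measurable]: "\<And>i. f i \<in> borel_measurable borel"
  shows "(\<integral>\<^sup>+x. (\<Prod>i\<in>UNIV. f i (x $ i)) \<partial>lborel) = (\<Prod>i\<in>UNIV. \<integral>\<^sup>+x. f i x \<partial>lborel)"
proof -
  interpret product_sigma_finite "\<lambda>_::'k. lborel :: 'a measure" ..
  show ?thesis
    by (subst nn_integral_lborel_vec, measurable) (simp add: product_nn_integral_prod)
qed

lemma AE_lborel_vec_nth:
  fixes i :: "'k::finite"
  assumes "AE z in (lborel :: 'a::euclidean_space measure). P z"
  shows "AE y in (lborel :: ('a^'k) measure). P (y $ i)"
proof -
  obtain N where N: "N \<in> null_sets lborel" "{z. \<not> P z} \<subseteq> N"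
    by (rule AE_E3[OF assms]) (auto simp: subset_eq)
  then have [measurable]: "N \<in> sets borel" by auto
  have [measurable]: "{y::'a^'k. y $ i \<in> N} \<in> sets borel"
    using measurable_sets_borel[OF borel_measurable_vec_nth[of i] \<open>N \<in> sets borel\<close>]
    by (simp add: vimage_def)
  have ind: "indicator {y::'a^'k. y $ i \<in> N} y =
      (\<Prod>j\<in>UNIV. (if j = i then indicator N else (\<lambda>_. 1)) (y $ j) :: ennreal)" for y
  proof -
    have "(\<Prod>j\<in>UNIV. (if j = i then indicator N else (\<lambda>_. 1)) (y $ j) :: ennreal) =
        (\<Prod>j\<in>UNIV. if j = i then indicator N (y $ j) else 1)"
      by (rule prod.cong) auto
    then show ?thesis by (simp add: indicator_def)
  qed
  have "emeasure lborel {y::'a^'k. y $ i \<in> N} = (\<integral>\<^sup>+y. indicator {y::'a^'k. y $ i \<in> N} y \<partial>lborel)"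
    by simp
  also have "... = (\<Prod>j\<in>UNIV. \<integral>\<^sup>+y. (if j = i then indicator N else (\<lambda>_. 1)) y \<partial>(lborel :: 'a measure))"
    unfolding ind by (rule nn_integral_lborel_vec_prod) auto
  \<comment> \<open>The other factors are the infinite measures of whole spaces; the product
    vanishes because \<open>0 * top = 0\<close>.\<close>
  also have "... = 0"
    using N by (intro prod_zero) (auto intro!: bexI[of _ i] simp: null_setsD1)
  finally have "{y::'a^'k. y $ i \<in> N} \<in> null_sets lborel" by auto
  then show ?thesis
    by (rule AE_I') (use N in auto)
qed

section \<open>Tensor products of one-parameter inequalities\<close>

lemma product_sigma_finite_count_space:
  "product_sigma_finite (\<lambda>_. count_space (UNIV :: 'a::countable set))"
  by (rule product_sigma_finite.intro) (rule sigma_finite_measure_count_space)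

text \<open>Induction on the coordinates. For a fixed index \<open>b\<close> of the new coordinate,
  the old ones see the partially integrated function \<open>G b\<close>, to which the induction
  hypothesis applies. In the remaining sum over \<open>b\<close> of powers of the norms of
  \<open>G b\<close>, Minkowski's inequality with exponent \<open>q / p\<close> moves the sum inside
  the norm, where the one-coordinate bound acts on each section of \<open>g\<close>. This is where
  \<open>p <= q\<close> enters.\<close>

lemma nn_integral_tensor_le:
  fixes N :: "'k \<Rightarrow> 'x measure" and k :: "'k \<Rightarrow> 'a::countable \<Rightarrow> 'x \<Rightarrow> ennreal"
  assumes J: "finite J" and N: "product_sigma_finite N"
    and k [measurable]: "\<And>j a. k j a \<in> borel_measurable (N j)"
    and pq: "0 < p" "p \<le> q"
    and bound: "\<And>j g. j \<in> J \<Longrightarrow> g \<in> borel_measurable (N j) \<Longrightarrow>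
      (\<Sum>\<^sup>+a. (\<integral>\<^sup>+x. k j a x * g x \<partial>N j) epowr q)
        \<le> C j * (\<integral>\<^sup>+x. g x epowr p \<partial>N j) epowr (q / p)"
    and g: "g \<in> borel_measurable (PiM J N)"
  shows "(\<integral>\<^sup>+a. (\<integral>\<^sup>+x. (\<Prod>j\<in>J. k j (a j) (x j)) * g x \<partial>PiM J N) epowr q
        \<partial>PiM J (\<lambda>_. count_space UNIV))
      \<le> (\<Prod>j\<in>J. C j) * (\<integral>\<^sup>+x. g x epowr p \<partial>PiM J N) epowr (q / p)"
  using J bound g
proof (induction J arbitrary: g)
  case empty
  then show ?case using pq by (simp add: PiM_empty nn_integral_count_space_finite epowr_epowr)
next
  case (insert j J)
  note [measurable] = insert.prems(2)
  interpret product_sigma_finite N by fact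
  interpret A: product_sigma_finite "\<lambda>_::'k. count_space (UNIV :: 'a set)"
    by (rule product_sigma_finite_count_space)
  interpret IA: finite_product_sigma_finite "\<lambda>_::'k. count_space (UNIV :: 'a set)" "insert j J"
    by standard (use insert in auto)
  interpret IN: finite_product_sigma_finite N "insert j J" by standard (use insert in auto)
  interpret JN: finite_product_sigma_finite N J by standard (use insert in auto)
  interpret P: pair_sigma_finite "PiM J N" "count_space (UNIV :: 'a set)"
    by (intro pair_sigma_finite.intro JN.sigma_finite_measure_axioms sigma_finite_measure_count_space)
  interpret NJ: sigma_finite_measure "N j" by (rule sigma_finite_measures)
  define cnt where "cnt = (\<lambda>_::'k. count_space (UNIV :: 'a set))"
  have [measurable]: "case_prod (k i) \<in> borel_measurable (count_space UNIV \<Otimes>\<^sub>M N i)" for i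
    by (rule measurable_pair_measure_countable1) auto
  have kk [measurable]: "(\<lambda>(a, x). k i (a i) (x i)) \<in> borel_measurable (PiM I cnt \<Otimes>\<^sub>M PiM I N)"
    if [simp]: "i \<in> I" for i I
  proof -
    have "(\<lambda>z. case_prod (k i) (fst z i, snd z i)) \<in> borel_measurable (PiM I cnt \<Otimes>\<^sub>M PiM I N)"
      unfolding cnt_def by measurable
    then show ?thesis by (simp add: case_prod_beta')
  qed
  define inn where "inn a = (\<integral>\<^sup>+x. (\<Prod>i\<in>insert j J. k i (a i) (x i)) * g x \<partial>PiM (insert j J) N)" for a
  have prod_kk [measurable]: "(\<lambda>(a, x). \<Prod>i\<in>insert j J. k i (a i) (x i)) \<in> borel_measurable
      (PiM (insert j J) cnt \<Otimes>\<^sub>M PiM (insert j J) N)"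
    unfolding case_prod_beta'
    by (intro borel_measurable_prod_ennreal kk[unfolded case_prod_beta'])
  have inn [measurable]: "inn \<in> borel_measurable (PiM (insert j J) cnt)"
    unfolding inn_def by (intro IN.borel_measurable_nn_integral) (use prod_kk in \<open>simp add: case_prod_beta'\<close>)
  define G where "G b x = (\<integral>\<^sup>+y. k j b y * g (x(j := y)) \<partial>N j)" for b x
  have Gb [measurable]: "G b \<in> borel_measurable (PiM J N)" for b
    unfolding G_def by measurable
  have G2 [measurable]: "(\<lambda>(x, b). G b x) \<in> borel_measurable (PiM J N \<Otimes>\<^sub>M count_space UNIV)"
  proof -
    have "case_prod G \<in> borel_measurable (count_space UNIV \<Otimes>\<^sub>M PiM J N)"
      by (rule measurable_pair_measure_countable1) auto
    then show ?thesis
      by (subst measurable_pair_swap_iff) (simp add: case_prod_beta')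
  qed
  have inn_eq: "inn (a(j := b)) = (\<integral>\<^sup>+x. (\<Prod>i\<in>J. k i (a i) (x i)) * G b x \<partial>PiM J N)" for a b
  proof -
    have "inn (a(j := b)) = (\<integral>\<^sup>+x. \<integral>\<^sup>+y. (\<Prod>i\<in>insert j J. k i ((a(j := b)) i) ((x(j := y)) i)) * g (x(j := y))
        \<partial>N j \<partial>PiM J N)"
      unfolding inn_def by (subst product_nn_integral_insert) (use insert in auto)
    also have "... = (\<integral>\<^sup>+x. \<integral>\<^sup>+y. (\<Prod>i\<in>J. k i (a i) (x i)) * (k j b y * g (x(j := y))) \<partial>N j \<partial>PiM J N)"
    proof (intro nn_integral_cong)
      fix x y
      have "(\<Prod>i\<in>J. k i ((a(j := b)) i) ((x(j := y)) i)) = (\<Prod>i\<in>J. k i (a i) (x i))"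
        using insert by (intro prod.cong) auto
      then show "(\<Prod>i\<in>insert j J. k i ((a(j := b)) i) ((x(j := y)) i)) * g (x(j := y)) =
          (\<Prod>i\<in>J. k i (a i) (x i)) * (k j b y * g (x(j := y)))"
        using insert by (simp add: mult_ac)
    qed
    also have "... = (\<integral>\<^sup>+x. (\<Prod>i\<in>J. k i (a i) (x i)) * G b x \<partial>PiM J N)"
      unfolding G_def by (intro nn_integral_cong nn_integral_cmult) measurable
    finally show ?thesis .
  qed
  have "(\<integral>\<^sup>+a. inn a epowr q \<partial>PiM (insert j J) cnt) =
      (\<Sum>\<^sup>+b. \<integral>\<^sup>+a. inn (a(j := b)) epowr q \<partial>PiM J cnt)"
    using insert inn unfolding cnt_def by (subst A.product_nn_integral_insert_rev) auto
  also have "... \<le> (\<Sum>\<^sup>+b. (\<Prod>i\<in>J. C i) * (\<integral>\<^sup>+x. G b x epowr p \<partial>PiM J N) epowr (q / p))"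
    unfolding inn_eq cnt_def by (intro nn_integral_mono insert.IH insert.prems) auto
  also have "... = (\<Prod>i\<in>J. C i) * (\<Sum>\<^sup>+b. (\<integral>\<^sup>+x. G b x epowr p \<partial>PiM J N) epowr (q / p))"
    by (rule nn_integral_cmult) simp
  finally have outer: "(\<integral>\<^sup>+a. inn a epowr q \<partial>PiM (insert j J) cnt) \<le> (\<Prod>i\<in>J. C i) *
    (\<Sum>\<^sup>+b. (\<integral>\<^sup>+x. G b x epowr p \<partial>PiM J N) epowr (q / p))" .
  have inner: "(\<Sum>\<^sup>+b. (\<integral>\<^sup>+x. G b x epowr p \<partial>PiM J N) epowr (q / p))
      \<le> C j * (\<integral>\<^sup>+x. g x epowr p \<partial>PiM (insert j J) N) epowr (q / p)"
  proof -
    have "(\<Sum>\<^sup>+b. (\<integral>\<^sup>+x. G b x epowr p \<partial>PiM J N) epowr (q / p)) epowr (1 / (q / p))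
      \<le> (\<integral>\<^sup>+x. (\<Sum>\<^sup>+b. (G b x epowr p) epowr (q / p)) epowr (1 / (q / p)) \<partial>PiM J N)"
      using pq by (intro P.nn_integral_Minkowski) (auto simp: case_prod_beta')
    also have "... = (\<integral>\<^sup>+x. (\<Sum>\<^sup>+b. G b x epowr q) epowr (p / q) \<partial>PiM J N)"
      using pq by (simp add: epowr_epowr)
    also have "... \<le> (\<integral>\<^sup>+x. C j epowr (p / q) * (\<integral>\<^sup>+y. g (x(j := y)) epowr p \<partial>N j) \<partial>PiM J N)"
    proof (rule nn_integral_mono)
      fix x assume [measurable]: "x \<in> space (PiM J N)"
      have "(\<Sum>\<^sup>+b. G b x epowr q)
          \<le> C j * (\<integral>\<^sup>+y. g (x(j := y)) epowr p \<partial>N j) epowr (q / p)"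
        unfolding G_def by (rule insert.prems(1)) (simp, measurable)
      then have "(\<Sum>\<^sup>+b. G b x epowr q) epowr (p / q)
          \<le> (C j * (\<integral>\<^sup>+y. g (x(j := y)) epowr p \<partial>N j) epowr (q / p)) epowr (p / q)"
        using pq by (intro epowr_mono) auto
      then show "(\<Sum>\<^sup>+b. G b x epowr q) epowr (p / q)
          \<le> C j epowr (p / q) * (\<integral>\<^sup>+y. g (x(j := y)) epowr p \<partial>N j)"
        using pq by (simp add: epowr_mult epowr_epowr)
    qed
    also have "... = C j epowr (p / q) * (\<integral>\<^sup>+x. (\<integral>\<^sup>+y. g (x(j := y)) epowr p \<partial>N j) \<partial>PiM J N)"
      by (rule nn_integral_cmult) measurable
    also have "(\<integral>\<^sup>+x. (\<integral>\<^sup>+y. g (x(j := y)) epowr p \<partial>N j) \<partial>PiM J N) =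
        (\<integral>\<^sup>+x. g x epowr p \<partial>PiM (insert j J) N)"
      using insert by (subst product_nn_integral_insert) auto
    finally show ?thesis
      using pq by (subst (asm) epowr_le_iff) (auto simp: epowr_mult epowr_epowr)
  qed
  show ?case
    using order_trans[OF outer mult_left_mono[OF inner]] insert(1,2)
    unfolding inn_def cnt_def by (simp add: mult_ac)
qed

section \<open>Doubling measures and an overlapping grid of cubes\<close>

lemma nn_integral_count_space_int_le:
  fixes f :: "int \<Rightarrow> ennreal"
  assumes "\<And>F. finite F \<Longrightarrow> sum f F \<le> B"
  shows "(\<Sum>\<^sup>+x. f x) \<le> B"
proof -
  have "(\<Sum>\<^sup>+x. f x) = (\<Sum>n. f (int_decode n))"
    using nn_integral_bij_count_space[OF bij_int_decode, of f]
    by (simp add: nn_integral_count_space_nat)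
  also have "... \<le> B"
  proof (rule suminf_le_const)
    fix n
    have "(\<Sum>i<n. f (int_decode i)) = sum f (int_decode ` {..<n})"
      by (subst sum.reindex) (auto intro: inj_on_subset[OF inj_int_decode])
    then show "(\<Sum>i<n. f (int_decode i)) \<le> B" using assms by simp
  qed auto
  finally show ?thesis .
qed

text \<open>The values \<open>V l\<close> grow at least geometrically with \<open>l\<close>, so the
  sum is governed by its largest admissible term, which is at most \<open>t powr a\<close>. Finite
  index sets provide a largest index from which to count downwards.\<close>

lemma geometric_chain_sum_le:
  fixes V :: "int \<Rightarrow> real"
  assumes V: "\<And>l. 0 < V l" "\<And>l. V l \<le> \<delta> * V (l + 1)" and \<delta>: "0 < \<delta>" "\<delta> < 1" and a: "0 < a" and t: "0 < t"
  shows "(\<Sum>\<^sup>+l. (if V l \<le> t then ennreal (V l powr a) else 0))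
    \<le> ennreal (t powr a / (1 - \<delta> powr a))"
proof (rule nn_integral_count_space_int_le)
  fix F :: "int set" assume F: "finite F"
  define F' where "F' = {l \<in> F. V l \<le> t}"
  have \<rho>: "0 < \<delta> powr a" "\<delta> powr a < 1"
    using \<delta> a powr_less_mono2[of a \<delta> 1] by auto
  have step: "V (L - int k) \<le> \<delta> ^ k * V L" for L k
  proof (induction k)
    case (Suc k)
    have "V (L - int (Suc k)) \<le> \<delta> * V (L - int k)"
      using V(2)[of "L - int (Suc k)"] by (simp add: algebra_simps)
    also have "... \<le> \<delta> * (\<delta> ^ k * V L)" using Suc \<delta> by simp
    finally show ?case by (simp add: mult.assoc)
  qed simp
  have "(\<Sum>l\<in>F'. V l powr a) \<le> t powr a / (1 - \<delta> powr a)"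
  proof (cases "F' = {}")
    case True
    then show ?thesis using \<rho> by simp
  next
    case False
    have fin: "finite F'" using F by (simp add: F'_def)
    define L where "L = Max F'"
    have L: "L \<in> F'" "\<And>l. l \<in> F' \<Longrightarrow> l \<le> L" using fin False by (auto simp: L_def)
    \<comment> \<open>Distinct indices have distinct distances to \<open>L\<close>, so the terms are
      compared with distinct members of one geometric series.\<close>
    define m where "m l = nat (L - l)" for l
    have "V l powr a \<le> t powr a * (\<delta> powr a) ^ m l" if l: "l \<in> F'" for l
    proof -
      have "V l \<le> \<delta> ^ m l * V L"
        using step[of L "m l"] L(2)[OF l] by (simp add: m_def)
      also have "... \<le> \<delta> ^ m l * t" using L(1) \<delta> by (simp add: F'_def)
      finally have "V l powr a \<le> (\<delta> ^ m l * t) powr a"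
        using V(1)[of l] a by (intro powr_mono2) auto
      also have "... = t powr a * (\<delta> powr a) ^ m l"
        using \<delta> t by (simp add: powr_mult powr_powr powr_realpow[symmetric] mult.commute)
      finally show ?thesis .
    qed
    then have "(\<Sum>l\<in>F'. V l powr a) \<le> (\<Sum>l\<in>F'. t powr a * (\<delta> powr a) ^ m l)"
      by (rule sum_mono)
    also have "... = t powr a * (\<Sum>k\<in>m ` F'. (\<delta> powr a) ^ k)"
    proof -
      have "inj_on m F'" 
      proof (rule inj_onI)
        fix k l assume "k \<in> F'" "l \<in> F'" "m k = m l"
        then show "k = l" using L(2)[of k] L(2)[of l] by (simp add: m_def)
      qed
      then show ?thesis by (simp add: sum.reindex sum_distrib_left)
    qed
    also have "(\<Sum>k\<in>m ` F'. (\<delta> powr a) ^ k) \<le> (\<Sum>k. (\<delta> powr a) ^ k)"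
      using \<rho> fin by (intro sum_le_suminf summable_geometric) auto
    also have "(\<Sum>k. (\<delta> powr a) ^ k) = 1 / (1 - \<delta> powr a)"
      using \<rho> by (intro suminf_geometric) auto
    finally show ?thesis using t by (simp add: mult_left_mono)
  qed
  then have "ennreal (\<Sum>l\<in>F'. V l powr a) \<le> ennreal (t powr a / (1 - \<delta> powr a))"
    by (rule ennreal_leI)
  also have "ennreal (\<Sum>l\<in>F'. V l powr a) = (\<Sum>l\<in>F'. ennreal (V l powr a))"
    by (simp add: sum_ennreal)
  also have "... = (\<Sum>l\<in>F. if V l \<le> t then ennreal (V l powr a) else 0)"
    unfolding F'_def by (rule sum.inter_filter[OF F])
  finally show "(\<Sum>l\<in>F. if V l \<le> t then ennreal (V l powr a) else 0)
      \<le> ennreal (t powr a / (1 - \<delta> powr a))" .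
qed

text \<open>The reflection of \<open>l\<close> to \<open>- l\<close> together with the passage from
  \<open>V\<close> to \<open>1 / V\<close> exchanges large and small values and preserves the growth
  condition.\<close>

lemma geometric_chain_sum_ge:
  fixes V :: "int \<Rightarrow> real"
  assumes V: "\<And>l. 0 < V l" "\<And>l. V l \<le> \<delta> * V (l + 1)" and \<delta>: "0 < \<delta>" "\<delta> < 1" and a: "0 < a" and t: "0 < t"
  shows "(\<Sum>\<^sup>+l. (if t \<le> V l then ennreal (V l powr (- a)) else 0))
    \<le> ennreal (t powr (- a) / (1 - \<delta> powr a))"
proof -
  have bij: "bij_betw uminus (UNIV :: int set) UNIV"
    by (rule bij_betwI[where g = uminus]) auto
  have "(\<Sum>\<^sup>+l. (if t \<le> V l then ennreal (V l powr (- a)) else 0)) =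
      (\<Sum>\<^sup>+l. (if t \<le> V (- l) then ennreal (V (- l) powr (- a)) else 0))"
    by (rule nn_integral_bij_count_space[OF bij, symmetric])
  also have "... = (\<Sum>\<^sup>+l. (if 1 / V (- l) \<le> 1 / t then ennreal ((1 / V (- l)) powr a) else 0))"
    using t V(1) by (intro nn_integral_cong) (auto simp: field_simps powr_minus powr_divide less_imp_le)
  also have "... \<le> ennreal ((1 / t) powr a / (1 - \<delta> powr a))"
  proof (rule geometric_chain_sum_le)
    fix l
    show "1 / V (- l) \<le> \<delta> * (1 / V (- (l + 1)))"
      using V(2)[of "- 1 - l"] V(1)[of "- l"] V(1)[of "- 1 - l"] by (simp add: field_simps)
  qed (use V \<delta> a t in auto)
  also have "(1 / t) powr a = t powr (- a)" using t by (simp add: powr_minus powr_divide field_simps)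
  finally show ?thesis .
qed

section \<open>Cubes as balls of the maximum norm, and the grid\<close>

definition qball :: "real^'n \<Rightarrow> real \<Rightarrow> (real^'n) set" where
  "qball z r = {x. \<forall>c. \<bar>x $ c - z $ c\<bar> \<le> r}"

lemma qball_eq_cbox: "qball z r = cbox (\<chi> c. z $ c - r) (\<chi> c. z $ c + r)"
  by (auto simp: qball_def mem_box_cart abs_le_iff algebra_simps)

lemma qball_borel [measurable]: "qball z r \<in> sets borel"
  by (simp add: qball_eq_cbox)

lemma qball_in_cubes: "0 < r \<Longrightarrow> qball z r \<in> cubes"
  unfolding cubes_def qball_eq_cbox
  by (intro CollectI exI[of _ "2 * r"] exI conjI refl) auto

lemma measure_qball: "0 \<le> r \<Longrightarrow> measure lborel (qball (z::real^'n) r) = (2 * r) ^ CARD('n)"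
proof -
  assume r: "0 \<le> r"
  have "cbox (\<chi> c. z $ c - r) (\<chi> c. z $ c + r) \<noteq> {}"
    using r by (auto simp: interval_ne_empty_cart)
  then show ?thesis unfolding qball_eq_cbox by (simp add: content_cbox_cart)
qed

lemma emeasure_qball: "0 \<le> r \<Longrightarrow> emeasure lborel (qball (z::real^'n) r) = ennreal ((2 * r) ^ CARD('n))"
  using emeasure_eq_ennreal_measure[of lborel "qball z r"] measure_qball[of r z]
  by (simp add: qball_eq_cbox emeasure_lborel_cbox_eq)

lemma qball_mono:
  assumes "\<And>c. \<bar>z $ c - z' $ c\<bar> + r \<le> r'"
  shows "qball z r \<subseteq> qball z' r'"
proof (unfold qball_def, safe)
  fix x c assume "\<forall>c. \<bar>x $ c - z $ c\<bar> \<le> r"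
  then have "\<bar>x $ c - z $ c\<bar> \<le> r" by blast
  then show "\<bar>x $ c - z' $ c\<bar> \<le> r'" using assms[of c] by linarith
qed

text \<open>The cubes of generation \<open>l\<close> have side \<open>4 * 2^l\<close> and centres in the lattice of mesh \<open>2^l\<close>:
  this overlap replaces shifted dyadic grids, as points at distance at most \<open>2^l\<close> share such a cube.\<close>

definition grid :: "int \<times> ('n \<Rightarrow> int) \<Rightarrow> (real^'n) set" where
  "grid a = qball (\<chi> c. 2 powr fst a * snd a c) (2 * 2 powr fst a)"

lemma grid_borel [measurable]: "grid a \<in> sets borel"
  by (simp add: grid_def)

lemma grid_in_cubes: "grid a \<in> cubes"
  by (simp add: grid_def qball_in_cubes)

text \<open>In each coordinate the centre lies within two mesh widths of \<open>y\<close>, which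
  leaves at most 5 integers.\<close>

lemma grid_count: "(\<Sum>\<^sup>+v. indicator (grid (l, v)) (y::real^'n)) \<le> ennreal (5 ^ CARD('n))"
proof -
  define s where "s = 2 powr real_of_int l"
  have s: "0 < s" by (simp add: s_def)
  let ?A = "{v. y \<in> grid (l, v)}"
  let ?B = "PiE UNIV (\<lambda>c. {\<lceil>y $ c / s\<rceil> - 2..\<lfloor>y $ c / s\<rfloor> + 2})"
  have sub: "?A \<subseteq> ?B"
  proof
    fix v assume "v \<in> ?A"
    then have *: "\<bar>y $ c - s * v c\<bar> \<le> 2 * s" for c by (auto simp: grid_def qball_def s_def)
    have "v c \<in> {\<lceil>y $ c / s\<rceil> - 2..\<lfloor>y $ c / s\<rfloor> + 2}" for c
    proof -
      have "y $ c / s - v c \<le> 2" "v c - y $ c / s \<le> 2"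
        using *[of c] s by (auto simp: field_simps abs_le_iff)
      then have "y $ c / s \<le> real_of_int (v c + 2)" "real_of_int (v c - 2) \<le> y $ c / s" by auto
      then have "\<lceil>y $ c / s\<rceil> \<le> v c + 2" "v c - 2 \<le> \<lfloor>y $ c / s\<rfloor>"
        by (simp_all only: ceiling_le_iff le_floor_iff)
      then show ?thesis by simp
    qed
    then show "v \<in> ?B" by (auto simp: PiE_UNIV_domain)
  qed
  have finB: "finite ?B" by (intro finite_PiE) auto
  have "card ?A \<le> card ?B" by (rule card_mono[OF finB sub])
  also have "card ?B = (\<Prod>c\<in>UNIV. card {\<lceil>y $ c / s\<rceil> - 2..\<lfloor>y $ c / s\<rfloor> + 2})"
    by (rule card_PiE) simp
  also have "... \<le> (\<Prod>c\<in>(UNIV::'n set). 5)"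
  proof (intro prod_mono conjI)
    fix c :: 'n
    have "\<lfloor>y $ c / s\<rfloor> \<le> \<lceil>y $ c / s\<rceil>" by linarith
    then show "card {\<lceil>y $ c / s\<rceil> - 2..\<lfloor>y $ c / s\<rfloor> + 2} \<le> 5"
      by (subst card_atLeastAtMost_int) linarith
  qed simp
  finally have card: "card ?A \<le> 5 ^ CARD('n)" by simp
  have "(\<Sum>\<^sup>+v. indicator (grid (l, v)) y) = (\<Sum>\<^sup>+v. indicator ?A v)"
    by (intro nn_integral_cong) (auto simp: indicator_def)
  also have "... = of_nat (card ?A)"
    using finite_subset[OF sub finB] by (simp add: emeasure_count_space)
  also have "... \<le> of_nat (5 ^ CARD('n))" using card by (rule of_nat_mono)
  finally show ?thesis by (simp add: ennreal_of_nat_eq_real_of_nat)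
qed

text \<open>The portion \<open>2^-n\<close> is that of the concentric cube of half the size, whose complement is at least
  as large; so the condition yields both doubling and reverse doubling.\<close>

definition A_infty_measure :: "(real^'n) measure \<Rightarrow> bool" where
  "A_infty_measure N \<longleftrightarrow> sets N = sets borel \<and>
     (\<forall>z r. 0 < r \<longrightarrow> 0 < emeasure N (qball z r) \<and> emeasure N (qball z r) < top) \<and>
     (\<exists>K. \<forall>z r E. 0 < r \<longrightarrow> E \<in> sets borel \<longrightarrow> E \<subseteq> qball z r \<longrightarrow>
        emeasure lborel (qball z r) \<le> 2 ^ CARD('n) * emeasure lborel E \<longrightarrow>
        emeasure N (qball z r) \<le> ennreal K * emeasure N E)"

lemma A_infty_measure_sigma_finite:
  assumes "A_infty_measure (N :: (real^'n) measure)"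
  shows "sigma_finite_measure N"
proof
  have sets: "sets N = sets borel" using assms by (simp add: A_infty_measure_def)
  have space: "space N = UNIV" using sets_eq_imp_space_eq[OF sets] by simp
  have "x \<in> (\<Union>n. qball 0 (real (Suc n)))" for x :: "real^'n"
  proof -
    obtain n where "norm x \<le> real n" using real_arch_simple by blast
    then have "x \<in> qball 0 (real (Suc n))"
      by (auto simp: qball_def intro: order_trans[OF component_le_norm_cart])
    then show ?thesis by blast
  qed
  then have "(\<Union>n. qball (0::real^'n) (real (Suc n))) = space N" by (auto simp: space)
  moreover have "emeasure N (qball 0 (real (Suc n))) \<noteq> \<infinity>" for n
    using assms unfolding A_infty_measure_def by (metis infinity_ennreal_def less_irrefl of_nat_0_less_iff zero_less_Suc)
  ultimately show "\<exists>A. countable A \<and> A \<subseteq> sets N \<and> \<Union> A = space N \<and> (\<forall>a\<in>A. emeasure N a \<noteq> \<infinity>)"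
    using sets by (intro exI[of _ "range (\<lambda>n. qball 0 (real (Suc n)))"]) auto
qed

lemma A_infty_measure_doubling:
  assumes "A_infty_measure (N :: (real^'n) measure)"
  obtains K where "1 < K"
    "\<And>z r. 0 < r \<Longrightarrow> measure N (qball z (2 * r)) \<le> K * measure N (qball z r)"
    "\<And>z r. 0 < r \<Longrightarrow> measure N (qball z r) \<le> (1 - 1 / K) * measure N (qball z (2 * r))"
proof -
  have sets: "sets N = sets borel" using assms by (simp add: A_infty_measure_def)
  have pos: "0 < r \<Longrightarrow> 0 < emeasure N (qball z r) \<and> emeasure N (qball z r) < top" for z r
    using assms by (simp add: A_infty_measure_def)
  obtain K0 where K0: "\<And>z r E. 0 < r \<Longrightarrow> E \<in> sets borel \<Longrightarrow> E \<subseteq> qball z r \<Longrightarrow>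
        emeasure lborel (qball z r) \<le> 2 ^ CARD('n) * emeasure lborel E \<Longrightarrow>
        emeasure N (qball z r) \<le> ennreal K0 * emeasure N E"
    using assms unfolding A_infty_measure_def by blast
  \<comment> \<open>At least 2, so that \<open>1 - 1 / K\<close> lies in (0,1) and can serve as the
    ratio of a geometric series.\<close>
  define K where "K = max K0 2"
  have K: "1 < K" by (simp add: K_def)
  have emN: "emeasure N E = ennreal (measure N E)" if "E \<subseteq> qball z r" "0 < r" "E \<in> sets borel" for E z r
  proof (rule emeasure_eq_ennreal_measure)
    have "emeasure N E \<le> emeasure N (qball z r)" using that sets by (intro emeasure_mono) auto
    then show "emeasure N E \<noteq> top" using pos[OF that(2), of z] by auto
  qed
  have H: "measure N (qball z r) \<le> K * measure N E"
    if E: "0 < r" "E \<in> sets borel" "E \<subseteq> qball z r" "measure lborel (qball z r) \<le> 2 ^ CARD('n) * measure lborel E" for z r E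
  proof -
    have fin: "emeasure lborel E \<noteq> top"
      using emeasure_mono[OF E(3), of lborel] E(1) emeasure_qball[of r z] by (auto simp: top_unique)
    have "emeasure lborel (qball z r) = ennreal (measure lborel (qball z r))"
      using E(1) by (simp add: emeasure_qball measure_qball)
    also have "... \<le> ennreal (2 ^ CARD('n) * measure lborel E)" using E(4) by (rule ennreal_leI)
    also have "... = 2 ^ CARD('n) * emeasure lborel E"
      using fin by (simp add: ennreal_mult emeasure_eq_ennreal_measure ennreal_power[symmetric])
    finally have "emeasure N (qball z r) \<le> ennreal K0 * emeasure N E" using K0 E by blast
    also have "... \<le> ennreal K * emeasure N E" by (intro mult_right_mono ennreal_leI) (auto simp: K_def)
    finally have "ennreal (measure N (qball z r)) \<le> ennreal (K * measure N E)"
      using emN[OF E(3,1,2)] emN[OF order_refl E(1) qball_borel] K by (simp add: ennreal_mult)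
    then show ?thesis using K by (simp add: ennreal_le_iff)
  qed
  have sub: "qball z r \<subseteq> qball z (2 * r)" if "0 < r" for z :: "real^'n" and r
    using that by (intro qball_mono) auto
  show thesis
  proof
    fix z :: "real^'n" and r :: real assume r: "0 < r"
    show "measure N (qball z (2 * r)) \<le> K * measure N (qball z r)"
      using r sub[OF r] power_mult_distrib[of 2 "2 * r" "CARD('n)"] by (intro H) (auto simp: measure_qball)
    have "measure N (qball z (2 * r)) \<le> K * measure N (qball z (2 * r) - qball z r)"
    proof (rule H)
      have "measure lborel (qball z (2 * r) - qball z r) =
          measure lborel (qball z (2 * r)) - measure lborel (qball z r)"
        using r sub[OF r, of z] by (intro measure_Diff) (simp_all add: emeasure_qball)
      then have D: "measure lborel (qball z (2 * r) - qball z r) = (4 * r) ^ CARD('n) - (2 * r) ^ CARD('n)"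
        using r by (simp add: measure_qball)
      define X T :: real where "X = (2 * r) ^ CARD('n)" and "T = 2 ^ CARD('n)"
      have XT: "(4 * r) ^ CARD('n) = X * T"
        using power_mult_distrib[of "2 * r" 2 "CARD('n)"] by (simp add: X_def T_def mult.commute)
      \<comment> \<open>\<open>T >= 2\<close> because the dimension is at least one; hence the
        complement \<open>X * T - X\<close> of the inner cube fills at least the portion
        \<open>1 / T\<close> of the outer one.\<close>
      have "X * T * 1 \<le> X * T * (T - 1)"
        using power_increasing[of 1 "CARD('n)" "2::real"] r
        by (intro mult_left_mono) (auto simp: X_def T_def)
      then have "X * T \<le> T * (X * T - X)" by (simp add: algebra_simps)
      moreover have "measure lborel (qball z (2 * r)) = X * T"
        using r XT by (simp add: measure_qball)
      ultimately show "measure lborel (qball z (2 * r)) \<le>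
          2 ^ CARD('n) * measure lborel (qball z (2 * r) - qball z r)"
        using D by (simp only: XT X_def[symmetric] T_def[symmetric])
    qed (use r in auto)
    also have "measure N (qball z (2 * r) - qball z r) = measure N (qball z (2 * r)) - measure N (qball z r)"
      using pos[of "2 * r" z] r sub[OF r] sets by (intro measure_Diff) auto
    finally show "measure N (qball z r) \<le> (1 - 1 / K) * measure N (qball z (2 * r))"
      using K by (simp add: field_simps)
  qed (rule K)
qed

section \<open>The one-parameter embedding\<close>

text \<open>Replaces the grid cubes through \<open>y\<close> by the single chain of cubes centred at
  \<open>y\<close>. A grid cube of half side \<open>2 * s\<close> containing \<open>y\<close> lies
  in \<open>qball y (4 * s)\<close>, which lies in the concentric enlargement of half side
  \<open>8 * s\<close>, two doublings up. So the two measures differ at most by the factor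
  \<open>K\<^sup>2\<close>, which \<open>h\<close> has to absorb, and each generation counts at most
  5^n times.\<close>

lemma nn_integral_grid_le:
  fixes N :: "(real^'n) measure" and f h :: "real \<Rightarrow> ennreal"
  assumes N: "A_infty_measure N"
    and K: "0 < K" "\<And>z r. 0 < r \<Longrightarrow> measure N (qball z (2 * r)) \<le> K * measure N (qball z r)"
    and fh: "\<And>u v. 0 < u \<Longrightarrow> u \<le> v \<Longrightarrow> v \<le> K\<^sup>2 * u \<Longrightarrow> f u \<le> h v"
  shows "(\<Sum>\<^sup>+a. indicator (grid a) y * f (measure N (grid a)))
    \<le> ennreal (5 ^ CARD('n)) * (\<Sum>\<^sup>+l. h (measure N (qball y (4 * 2 powr real_of_int l))))"
proof -
  have sets: "sets N = sets borel" using N by (simp add: A_infty_measure_def)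
  have pos: "0 < r \<Longrightarrow> 0 < emeasure N (qball z r) \<and> emeasure N (qball z r) < top" for z r
    using N by (simp add: A_infty_measure_def)
  have mono: "measure N (qball z r) \<le> measure N (qball z' r')" if "0 < r'" "qball z r \<subseteq> qball z' r'" for z z' r r'
    unfolding measure_def using that pos[of r' z'] sets
    by (intro enn2real_mono emeasure_mono) auto
  have "(\<Sum>\<^sup>+a. indicator (grid a) y * f (measure N (grid a))) =
      (\<Sum>\<^sup>+l. \<Sum>\<^sup>+v. indicator (grid (l, v)) y * f (measure N (grid (l, v))))"
    by (rule nn_integral_fst_count_space[symmetric])
  also have "... \<le> (\<Sum>\<^sup>+l. \<Sum>\<^sup>+v. indicator (grid (l, v)) y * h (measure N (qball y (4 * 2 powr real_of_int l))))"
  proof (intro nn_integral_mono)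
    fix l :: int and v :: "'n \<Rightarrow> int"
    define s where "s = 2 powr real_of_int l"
    define z :: "real^'n" where "z = (\<chi> c. s * v c)"
    have s: "0 < s" by (simp add: s_def)
    have g: "grid (l, v) = qball z (2 * s)" by (simp add: grid_def s_def z_def)
    show "indicator (grid (l, v)) y * f (measure N (grid (l, v)))
        \<le> indicator (grid (l, v)) y * h (measure N (qball y (4 * 2 powr real_of_int l)))"
    proof (cases "y \<in> grid (l, v)")
      case True
      then have yz: "\<bar>y $ c - z $ c\<bar> \<le> 2 * s" for c by (simp add: g qball_def)
      have "measure N (grid (l, v)) \<le> measure N (qball y (4 * s))"
        unfolding g using s
      proof (intro mono qball_mono)
        fix c show "\<bar>z $ c - y $ c\<bar> + 2 * s \<le> 4 * s" using yz[of c] by linarith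
      qed simp
      moreover have "measure N (qball y (4 * s)) \<le> K\<^sup>2 * measure N (grid (l, v))"
      proof -
        have "measure N (qball y (4 * s)) \<le> measure N (qball z (2 * (2 * (2 * s))))"
          using s
        proof (intro mono qball_mono)
          fix c show "\<bar>y $ c - z $ c\<bar> + 4 * s \<le> 2 * (2 * (2 * s))" using yz[of c] s by linarith
        qed simp
        also have "... \<le> K * measure N (qball z (2 * (2 * s)))" using s by (intro K) auto
        also have "... \<le> K * (K * measure N (qball z (2 * s)))" using s K(1) by (intro mult_left_mono K) auto
        finally show ?thesis by (simp add: g power2_eq_square mult.assoc)
      qed
      moreover have "0 < measure N (grid (l, v))"
        unfolding g measure_def using pos[of "2 * s" z] s by (simp add: enn2real_positive_iff)
      ultimately show ?thesis using fh True by (simp add: s_def)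
    qed simp
  qed
  also have "... = (\<Sum>\<^sup>+l. h (measure N (qball y (4 * 2 powr real_of_int l))) *
      (\<Sum>\<^sup>+v. indicator (grid (l, v)) y))"
    by (simp add: nn_integral_multc mult.commute)
  also have "... \<le> (\<Sum>\<^sup>+l. h (measure N (qball y (4 * 2 powr real_of_int l))) * ennreal (5 ^ CARD('n)))"
    by (intro nn_integral_mono mult_left_mono grid_count) auto
  finally show ?thesis by (simp add: nn_integral_multc mult.commute[of _ "ennreal (5 ^ CARD('n))"] nn_integral_cmult)
qed

lemma A_infty_measure_grid_pos:
  "A_infty_measure N \<Longrightarrow> 0 < measure N (grid a)"
  "A_infty_measure N \<Longrightarrow> emeasure N (grid a) = ennreal (measure N (grid a))"
  unfolding A_infty_measure_def grid_def measure_def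
  by (auto simp: enn2real_positive_iff less_top)

lemma A_infty_chain:
  fixes N :: "(real^'n) measure"
  assumes N: "A_infty_measure N"
  obtains K \<delta> where "0 < K" "0 < \<delta>" "\<delta> < 1"
    "\<And>z r. 0 < r \<Longrightarrow> measure N (qball z (2 * r)) \<le> K * measure N (qball z r)"
    "\<And>y l. 0 < measure N (qball y (4 * 2 powr real_of_int l))"
    "\<And>y l. measure N (qball y (4 * 2 powr real_of_int l)) \<le>
       \<delta> * measure N (qball y (4 * 2 powr real_of_int (l + 1)))"
proof -
  obtain K where K: "1 < K"
    "\<And>z r. 0 < r \<Longrightarrow> measure N (qball z (2 * r)) \<le> K * measure N (qball z r)"
    "\<And>z r. 0 < r \<Longrightarrow> measure N (qball z r) \<le> (1 - 1 / K) * measure N (qball z (2 * r))"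
    using A_infty_measure_doubling[OF N] by blast
  show thesis
  proof (rule that[of K "1 - 1 / K"])
    fix y :: "real^'n" and l :: int
    show "0 < measure N (qball y (4 * 2 powr real_of_int l))"
      using N unfolding A_infty_measure_def measure_def by (auto simp: enn2real_positive_iff)
    have "4 * 2 powr real_of_int (l + 1) = 2 * (4 * 2 powr real_of_int l)" by (simp add: powr_add)
    then show "measure N (qball y (4 * 2 powr real_of_int l)) \<le>
       (1 - 1 / K) * measure N (qball y (4 * 2 powr real_of_int (l + 1)))"
      using K(3)[of "4 * 2 powr real_of_int l" y] by simp
  qed (use K in auto)
qed

text \<open>Along the chain centred at \<open>y\<close> the measures grow geometrically, so the
  largest admissible term controls the sum. The chain cubes are larger than the grid cubes, which
  raises the threshold to \<open>K\<^sup>2 * t\<close>.\<close>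

lemma grid_sum_small:
  fixes N :: "(real^'n) measure"
  assumes N: "A_infty_measure N" and c: "0 < c"
  obtains C where "0 < C" "\<And>y t. 0 < t \<Longrightarrow>
    (\<Sum>\<^sup>+a. indicator (grid a) y * (if measure N (grid a) \<le> t then ennreal (measure N (grid a) powr c) else 0)) \<le> ennreal (C * t powr c)"
proof -
  obtain K \<delta> where K: "0 < K" "0 < \<delta>" "\<delta> < 1"
    "\<And>z r. 0 < r \<Longrightarrow> measure N (qball z (2 * r)) \<le> K * measure N (qball z r)"
    "\<And>y l. 0 < measure N (qball y (4 * 2 powr real_of_int l))"
    "\<And>y l. measure N (qball y (4 * 2 powr real_of_int l)) \<le>
       \<delta> * measure N (qball y (4 * 2 powr real_of_int (l + 1)))"
    using A_infty_chain[OF N] by blast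
  have \<delta>: "\<delta> powr c < 1" using K c powr_less_mono2[of c \<delta> 1] by simp
  show thesis
  proof (rule that[of "5 ^ CARD('n) * ((K\<^sup>2) powr c / (1 - \<delta> powr c))"])
    fix y :: "real^'n" and t :: real assume t: "0 < t"
    have "(\<Sum>\<^sup>+a. indicator (grid a) y * (if measure N (grid a) \<le> t then ennreal (measure N (grid a) powr c) else 0)) \<le> ennreal (5 ^ CARD('n)) *
        (\<Sum>\<^sup>+l. (if measure N (qball y (4 * 2 powr real_of_int l)) \<le> K\<^sup>2 * t
          then ennreal (measure N (qball y (4 * 2 powr real_of_int l)) powr c) else 0))"
    proof (rule nn_integral_grid_le[OF N K(1,4)])
      fix u v :: real assume uv: "0 < u" "u \<le> v" "v \<le> K\<^sup>2 * u"
      have "v \<le> K\<^sup>2 * t" if "u \<le> t"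
        using uv(3) mult_left_mono[OF that, of "K\<^sup>2"] by simp
      moreover have "u powr c \<le> v powr c" using uv c by (intro powr_mono2) auto
      ultimately show "(if u \<le> t then ennreal (u powr c) else 0) \<le>
          (if v \<le> K\<^sup>2 * t then ennreal (v powr c) else 0)"
        by (auto intro: ennreal_leI)
    qed simp
    also have "... \<le> ennreal (5 ^ CARD('n)) * ennreal ((K\<^sup>2 * t) powr c / (1 - \<delta> powr c))"
      using K t c by (intro mult_left_mono geometric_chain_sum_le) auto
    also have "... = ennreal (5 ^ CARD('n) * ((K\<^sup>2) powr c / (1 - \<delta> powr c)) * t powr c)"
      using K t \<delta> by (simp add: powr_mult field_simps flip: ennreal_mult)
    finally show "(\<Sum>\<^sup>+a. indicator (grid a) y * (if measure N (grid a) \<le> t then ennreal (measure N (grid a) powr c) else 0)) \<le> ennreal (5 ^ CARD('n) * ((K\<^sup>2) powr c / (1 - \<delta> powr c)) * t powr c)" .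
  qed (use K \<delta> in auto)
qed

text \<open>Here the threshold carries over unchanged, since the larger chain cube still has measure
  at least \<open>t\<close>; the decreasing power costs the factor \<open>(K\<^sup>2) powr c\<close>
  instead.\<close>

lemma grid_sum_large:
  fixes N :: "(real^'n) measure"
  assumes N: "A_infty_measure N" and c: "0 < c"
  obtains C where "0 < C" "\<And>y t. 0 < t \<Longrightarrow>
    (\<Sum>\<^sup>+a. indicator (grid a) y * (if t \<le> measure N (grid a) then ennreal (measure N (grid a) powr (- c)) else 0)) \<le> ennreal (C * t powr (- c))"
proof -
  obtain K \<delta> where K: "0 < K" "0 < \<delta>" "\<delta> < 1"
    "\<And>z r. 0 < r \<Longrightarrow> measure N (qball z (2 * r)) \<le> K * measure N (qball z r)"
    "\<And>y l. 0 < measure N (qball y (4 * 2 powr real_of_int l))"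
    "\<And>y l. measure N (qball y (4 * 2 powr real_of_int l)) \<le>
       \<delta> * measure N (qball y (4 * 2 powr real_of_int (l + 1)))"
    using A_infty_chain[OF N] by blast
  have \<delta>: "\<delta> powr c < 1" using K c powr_less_mono2[of c \<delta> 1] by simp
  show thesis
  proof (rule that[of "5 ^ CARD('n) * ((K\<^sup>2) powr c / (1 - \<delta> powr c))"])
    fix y :: "real^'n" and t :: real assume t: "0 < t"
    let ?V = "\<lambda>l. measure N (qball y (4 * 2 powr real_of_int l))"
    have "(\<Sum>\<^sup>+a. indicator (grid a) y * (if t \<le> measure N (grid a) then ennreal (measure N (grid a) powr (- c)) else 0)) \<le> ennreal (5 ^ CARD('n)) *
        (\<Sum>\<^sup>+l. (ennreal ((K\<^sup>2) powr c) * (if t \<le> ?V l then ennreal (?V l powr (- c)) else 0)))"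
    proof (rule nn_integral_grid_le[OF N K(1,4)])
      fix u v :: real assume uv: "0 < u" "u \<le> v" "v \<le> K\<^sup>2 * u"
      have "(K\<^sup>2 * u) powr (- c) \<le> v powr (- c)" using uv c by (intro powr_mono2') auto
      then have "u powr (- c) \<le> (K\<^sup>2) powr c * v powr (- c)"
        using uv K by (simp add: powr_mult powr_minus field_simps)
      then show "(if t \<le> u then ennreal (u powr (- c)) else 0) \<le>
          ennreal ((K\<^sup>2) powr c) * (if t \<le> v then ennreal (v powr (- c)) else 0)"
        using uv by (auto intro: ennreal_leI simp flip: ennreal_mult)
    qed simp
    also have "... = ennreal (5 ^ CARD('n)) * (ennreal ((K\<^sup>2) powr c) *
        (\<Sum>\<^sup>+l. (if t \<le> ?V l then ennreal (?V l powr (- c)) else 0)))"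
      by (subst nn_integral_cmult) auto
    also have "... \<le> ennreal (5 ^ CARD('n)) * (ennreal ((K\<^sup>2) powr c) * ennreal (t powr (- c) / (1 - \<delta> powr c)))"
      using K t c by (intro mult_left_mono geometric_chain_sum_ge) auto
    also have "... = ennreal (5 ^ CARD('n) * ((K\<^sup>2) powr c / (1 - \<delta> powr c)) * t powr (- c))"
      using K t \<delta> by (simp flip: ennreal_mult)
    finally show "(\<Sum>\<^sup>+a. indicator (grid a) y * (if t \<le> measure N (grid a) then ennreal (measure N (grid a) powr (- c)) else 0)) \<le> ennreal (5 ^ CARD('n) * ((K\<^sup>2) powr c / (1 - \<delta> powr c)) * t powr (- c))" .
  qed (use K \<delta> in auto)
qed

text \<open>Integrated against \<open>g\<close> it gives the average of \<open>g\<close> over the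
  cube times \<open>N(Q)^(1/p)\<close>, a quantity that Hoelder bounds by the L^p norm of
  \<open>g\<close>. The embedding below improves this uniform bound to summability of the q-th
  powers.\<close>

definition avg_kernel :: "(real^'n) measure \<Rightarrow> real \<Rightarrow> int \<times> ('n \<Rightarrow> int) \<Rightarrow> real^'n \<Rightarrow> ennreal" where
  "avg_kernel N p a x = ennreal (measure N (grid a) powr (1 / p - 1)) * indicator (grid a) x"

lemma avg_kernel_measurable [measurable]:
  assumes [simp, measurable_cong]: "sets N = sets borel"
  shows "avg_kernel N p a \<in> borel_measurable N"
  unfolding avg_kernel_def by measurable

text \<open>Exchanging sum and integral leaves, at each point, a sum over the grid cubes containing
  it. Where \<open>g x = \<gamma>\<close>, the threshold for \<open>V a\<close> is
  \<open>\<gamma> powr (- p)\<close>, and the exponents combine to \<open>\<gamma> powr p\<close>.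
  The low part uses \<open>r = q\<close>, the high part \<open>r = 1\<close>.\<close>

lemma grid_sum_integral_le:
  fixes N :: "(real^'n) measure"
  assumes sets [measurable_cong]: "sets N = sets borel" and g [measurable]: "g \<in> borel_measurable N"
    and V: "\<And>a. 0 < V a" and [measurable]: "\<And>a. Measurable.pred N (\<lambda>x. P (V a) (g x))"
    and r: "0 < r" and C: "0 < C" "\<And>\<gamma> x. 0 < \<gamma> \<Longrightarrow>
      (\<Sum>\<^sup>+a. indicator (grid a) x * (if P (V a) (ennreal \<gamma>) then ennreal (V a powr (r / p - 1)) else 0))
        \<le> ennreal (C * (\<gamma> powr (- p)) powr (r / p - 1))"
    and p: "0 < p"
  shows "(\<Sum>\<^sup>+a. \<integral>\<^sup>+x. ennreal (V a powr (r / p - 1)) * indicator (grid a) x *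
      (if P (V a) (g x) then g x else 0) epowr r \<partial>N) \<le> ennreal C * (\<integral>\<^sup>+x. g x epowr p \<partial>N)"
    (is "(\<Sum>\<^sup>+a. \<integral>\<^sup>+x. ?F a x \<partial>N) \<le> _")
proof -
  have "(\<Sum>\<^sup>+a. \<integral>\<^sup>+x. ?F a x \<partial>N) = (\<integral>\<^sup>+x. (\<Sum>\<^sup>+a. ?F a x) \<partial>N)"
    by (rule nn_integral_count_space_nn_integral[symmetric]) auto
  also have "... \<le> (\<integral>\<^sup>+x. ennreal C * g x epowr p \<partial>N)"
  proof (rule nn_integral_mono)
    fix x
    consider "g x = 0" | "g x = top" | \<gamma> where "g x = ennreal \<gamma>" "0 < \<gamma>"
      by (cases "g x") (auto simp: order.order_iff_strict)
    then show "(\<Sum>\<^sup>+a. ?F a x) \<le> ennreal C * g x epowr p"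
    proof cases
      case 3
      have "(\<Sum>\<^sup>+a. ?F a x) = (\<Sum>\<^sup>+a. ennreal (\<gamma> powr r) * (indicator (grid a) x *
          (if P (V a) (ennreal \<gamma>) then ennreal (V a powr (r / p - 1)) else 0)))"
        using 3 by (intro nn_integral_cong) (auto simp: epowr_ennreal mult_ac)
      also have "... = ennreal (\<gamma> powr r) * (\<Sum>\<^sup>+a. indicator (grid a) x *
          (if P (V a) (ennreal \<gamma>) then ennreal (V a powr (r / p - 1)) else 0))"
        by (rule nn_integral_cmult) auto
      also have "... \<le> ennreal (\<gamma> powr r) * ennreal (C * (\<gamma> powr (- p)) powr (r / p - 1))"
        using 3 by (intro mult_left_mono C) auto
      also have "... = ennreal (C * (\<gamma> powr r * \<gamma> powr (- p * (r / p - 1))))"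
        using C(1) by (simp add: powr_powr mult_ac flip: ennreal_mult)
      also have "\<gamma> powr r * \<gamma> powr (- p * (r / p - 1)) = \<gamma> powr p"
        using p by (simp add: algebra_simps flip: powr_add)
      also have "ennreal (C * \<gamma> powr p) = ennreal C * g x epowr p"
        using C(1) 3 by (simp add: epowr_ennreal ennreal_mult)
      finally show ?thesis .
    qed (use C(1) in \<open>simp_all add: ennreal_mult_top cong: if_cong\<close>)
  qed
  also have "... = ennreal C * (\<integral>\<^sup>+x. g x epowr p \<partial>N)" by (rule nn_integral_cmult) measurable
  finally show ?thesis .
qed

text \<open>For \<open>g\<close> of norm 1 in \<open>L^p\<close>, the average of \<open>g\<close> over \<open>Q\<close> is at most the height \<open>N(Q)^(-1/p)\<close>.\<close>

definition low_part :: "(real^'n) measure \<Rightarrow> real \<Rightarrow> (real^'n \<Rightarrow> ennreal) \<Rightarrow> int \<times> ('n \<Rightarrow> int) \<Rightarrow> real^'n \<Rightarrow> ennreal" where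
  "low_part N p g a x = (if g x \<le> ennreal (measure N (grid a) powr (- 1 / p)) then g x else 0)"

definition high_part :: "(real^'n) measure \<Rightarrow> real \<Rightarrow> (real^'n \<Rightarrow> ennreal) \<Rightarrow> int \<times> ('n \<Rightarrow> int) \<Rightarrow> real^'n \<Rightarrow> ennreal" where
  "high_part N p g a x = (if \<not> g x \<le> ennreal (measure N (grid a) powr (- 1 / p)) then g x else 0)"

text \<open>Hoelder over the cube moves the power \<open>q\<close> inside the integral and leaves
  the factor \<open>V a powr (q / p - 1)\<close>. This exponent is positive, so at a point with
  \<open>g x = \<gamma>\<close> the sum over the cubes with
  \<open>V a <= \<gamma> powr (- p)\<close> converges.\<close>

lemma avg_embedding_low:
  fixes N :: "(real^'n) measure"
  assumes N: "A_infty_measure N" and pq: "1 < p" "p < q"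
  obtains C where "0 < C" "\<And>g. g \<in> borel_measurable N \<Longrightarrow>
    (\<Sum>\<^sup>+a. (\<integral>\<^sup>+x. avg_kernel N p a x * low_part N p g a x \<partial>N) epowr q) \<le> ennreal C * (\<integral>\<^sup>+x. g x epowr p \<partial>N)"
proof -
  have sets [simp, measurable_cong]: "sets N = sets borel" using N by (simp add: A_infty_measure_def)
  define V where "V a = measure N (grid a)" for a
  have V: "0 < V a" "emeasure N (grid a) = ennreal (V a)" for a
    using A_infty_measure_grid_pos[OF N] by (auto simp: V_def)
  have "0 < q / p - 1" using pq by (simp add: field_simps)
  from grid_sum_small[OF N this] obtain C where C: "0 < C" "\<And>y t. 0 < t \<Longrightarrow>
    (\<Sum>\<^sup>+a. indicator (grid a) y * (if V a \<le> t then ennreal (V a powr (q / p - 1)) else 0)) \<le> ennreal (C * t powr (q / p - 1))"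
    unfolding V_def by blast
  show thesis
  proof (rule that[OF C(1)])
    fix g :: "real^'n \<Rightarrow> ennreal" assume g [measurable]: "g \<in> borel_measurable N"
    define lo where "lo a x = (if g x \<le> ennreal (V a powr (- 1 / p)) then g x else 0)" for a x
    have [measurable]: "lo a \<in> borel_measurable N" for a unfolding lo_def by measurable
    have "(\<integral>\<^sup>+x. avg_kernel N p a x * lo a x \<partial>N) epowr q \<le>
        (\<integral>\<^sup>+x. ennreal (V a powr (q / p - 1)) * indicator (grid a) x * lo a x epowr q \<partial>N)" for a
    proof -
      define I where "I = (\<integral>\<^sup>+x. (indicator (grid a) x * lo a x) epowr q \<partial>N)"
      have "(\<integral>\<^sup>+x. avg_kernel N p a x * lo a x \<partial>N) =
          ennreal (V a powr (1 / p - 1)) * (\<integral>\<^sup>+x\<in>grid a. (indicator (grid a) x * lo a x) \<partial>N)"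
        unfolding avg_kernel_def V_def[symmetric]
        by (subst nn_integral_cmult[symmetric]) (auto intro!: nn_integral_cong simp: indicator_def)
      also have "... \<le> ennreal (V a powr (1 / p - 1)) *
          (I epowr (1 / q) * (\<integral>\<^sup>+x. indicator (grid a) x epowr (q / (q - 1)) \<partial>N) epowr (1 - 1 / q))"
        unfolding I_def using pq by (intro mult_left_mono nn_integral_Hoelder2) auto
      also have "(\<integral>\<^sup>+x. indicator (grid a) x epowr (q / (q - 1)) \<partial>N) = (\<integral>\<^sup>+x. indicator (grid a) x \<partial>N)"
        by (intro nn_integral_cong) (simp add: indicator_def)
      also have "... = ennreal (V a)" by (simp add: V)
      also have "ennreal (V a powr (1 / p - 1)) * (I epowr (1 / q) * ennreal (V a) epowr (1 - 1 / q)) =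
          ennreal (V a powr (1 / p - 1 / q)) * I epowr (1 / q)"
      proof -
        have "V a powr (1 / p - 1) * V a powr (1 - 1 / q) = V a powr (1 / p - 1 / q)"
          by (simp flip: powr_add)
        then have "ennreal (V a powr (1 / p - 1)) * ennreal (V a powr (1 - 1 / q)) =
            ennreal (V a powr (1 / p - 1 / q))"
          by (simp flip: ennreal_mult)
        moreover have "ennreal (V a) epowr (1 - 1 / q) = ennreal (V a powr (1 - 1 / q))"
          using V(1)[of a] by (intro epowr_ennreal) simp
        ultimately show ?thesis by (metis mult.assoc mult.commute)
      qed
      finally have "(\<integral>\<^sup>+x. avg_kernel N p a x * lo a x \<partial>N) epowr q \<le>
          (ennreal (V a powr (1 / p - 1 / q)) * I epowr (1 / q)) epowr q"
        using pq by (intro epowr_mono) auto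
      also have "... = ennreal (V a powr (q / p - 1)) * I"
        using pq by (simp add: epowr_mult epowr_epowr epowr_ennreal powr_powr algebra_simps)
      also have "... = (\<integral>\<^sup>+x. ennreal (V a powr (q / p - 1)) * indicator (grid a) x * lo a x epowr q \<partial>N)"
        unfolding I_def
        by (subst nn_integral_cmult[symmetric]) (auto intro!: nn_integral_cong simp: indicator_def)
      finally show ?thesis .
    qed
    then have "(\<Sum>\<^sup>+a. (\<integral>\<^sup>+x. avg_kernel N p a x * lo a x \<partial>N) epowr q) \<le>
        (\<Sum>\<^sup>+a. \<integral>\<^sup>+x. ennreal (V a powr (q / p - 1)) * indicator (grid a) x * lo a x epowr q \<partial>N)"
      by (rule nn_integral_mono)
    also have "... \<le> ennreal C * (\<integral>\<^sup>+x. g x epowr p \<partial>N)"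
      unfolding lo_def
    proof (rule grid_sum_integral_le[OF sets g V(1)])
      fix \<gamma> :: real and x assume \<gamma>: "0 < \<gamma>"
      have "\<gamma> \<le> V a powr (- 1 / p) \<longleftrightarrow> V a \<le> \<gamma> powr (- p)" for a
      proof -
        have "\<gamma> \<le> V a powr (- 1 / p) \<longleftrightarrow> ln \<gamma> \<le> (- 1 / p) * ln (V a)"
          using \<gamma> V(1)[of a] by (simp add: powr_def flip: ln_le_cancel_iff[of \<gamma>])
        also have "... \<longleftrightarrow> ln (V a) \<le> - p * ln \<gamma>" using pq by (simp add: field_simps) linarith
        also have "... \<longleftrightarrow> V a \<le> \<gamma> powr (- p)"
          using \<gamma> V(1)[of a] by (simp add: powr_def flip: ln_le_cancel_iff[of "V a"])
        finally show ?thesis .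
      qed
      then show "(\<Sum>\<^sup>+a. indicator (grid a) x * (if ennreal \<gamma> \<le> ennreal (V a powr (- 1 / p))
          then ennreal (V a powr (q / p - 1)) else 0)) \<le> ennreal (C * (\<gamma> powr (- p)) powr (q / p - 1))"
        using C(2)[of "\<gamma> powr (- p)" x] \<gamma> by simp
    qed (use C(1) pq in auto)
    finally show "(\<Sum>\<^sup>+a. (\<integral>\<^sup>+x. avg_kernel N p a x * low_part N p g a x \<partial>N) epowr q)
      \<le> ennreal C * (\<integral>\<^sup>+x. g x epowr p \<partial>N)"
      by (simp add: lo_def V_def low_part_def)
  qed
qed

text \<open>On the high part \<open>g\<close> is at most \<open>N(Q)^(1-1/p) * g^p\<close>, so norm
  at most 1 bounds every term by 1, and its power \<open>q > 1\<close> by the term itself. What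
  remains is linear in the high part and carries the negative exponent \<open>1 / p - 1\<close>,
  which is summable over the large cubes.\<close>

lemma avg_embedding_high:
  fixes N :: "(real^'n) measure"
  assumes N: "A_infty_measure N" and pq: "1 < p" "p < q"
  obtains C where "0 < C" "\<And>g. g \<in> borel_measurable N \<Longrightarrow> (\<integral>\<^sup>+x. g x epowr p \<partial>N) \<le> 1 \<Longrightarrow>
    (\<Sum>\<^sup>+a. (\<integral>\<^sup>+x. avg_kernel N p a x * high_part N p g a x \<partial>N) epowr q) \<le> ennreal C * (\<integral>\<^sup>+x. g x epowr p \<partial>N)"
proof -
  have sets [simp, measurable_cong]: "sets N = sets borel" using N by (simp add: A_infty_measure_def)
  define V where "V a = measure N (grid a)" for a
  have V: "0 < V a" "emeasure N (grid a) = ennreal (V a)" for a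
    using A_infty_measure_grid_pos[OF N] by (auto simp: V_def)
  have "0 < 1 - 1 / p" using pq by (simp add: field_simps)
  from grid_sum_large[OF N this] obtain C where C: "0 < C" "\<And>y t. 0 < t \<Longrightarrow>
    (\<Sum>\<^sup>+a. indicator (grid a) y * (if t \<le> V a then ennreal (V a powr (- (1 - 1 / p))) else 0)) \<le> ennreal (C * t powr (- (1 - 1 / p)))"
    unfolding V_def by blast
  show thesis
  proof (rule that[OF C(1)])
    fix g :: "real^'n \<Rightarrow> ennreal"
    assume g [measurable]: "g \<in> borel_measurable N" and g1: "(\<integral>\<^sup>+x. g x epowr p \<partial>N) \<le> 1"
    define hi where "hi a x = (if \<not> g x \<le> ennreal (V a powr (- 1 / p)) then g x else 0)" for a x
    have [measurable]: "hi a \<in> borel_measurable N" for a unfolding hi_def by measurable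
    have hi_le: "hi a x \<le> ennreal (V a powr (1 - 1 / p)) * g x epowr p" for a x
    proof (cases "g x \<le> ennreal (V a powr (- 1 / p))")
      case False
      then have "ennreal (V a powr (- 1 / p)) \<le> g x" by simp
      then have "ennreal (V a powr (- 1 / p)) epowr (p - 1) \<le> g x epowr (p - 1)"
        using pq by (intro epowr_mono) auto
      moreover have "ennreal (V a powr (- 1 / p)) epowr (p - 1) = ennreal (V a powr (- (1 - 1 / p)))"
        using pq by (simp add: epowr_ennreal powr_powr field_simps)
      ultimately have "ennreal (V a powr (1 - 1 / p)) * ennreal (V a powr (- (1 - 1 / p))) \<le>
          ennreal (V a powr (1 - 1 / p)) * g x epowr (p - 1)"
        by (intro mult_left_mono) auto
      moreover have "ennreal (V a powr (1 - 1 / p)) * ennreal (V a powr (- (1 - 1 / p))) = 1"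
        using V(1)[of a] by (simp flip: ennreal_mult powr_add)
      ultimately have "1 * g x \<le> ennreal (V a powr (1 - 1 / p)) * g x epowr (p - 1) * g x"
        by (intro mult_right_mono) auto
      also have "... = ennreal (V a powr (1 - 1 / p)) * g x epowr p"
        using epowr_add[of "g x" "p - 1" 1] by (simp add: mult.assoc)
      finally show ?thesis using False by (simp add: hi_def)
    qed (simp add: hi_def)
    have T: "(\<integral>\<^sup>+x. avg_kernel N p a x * hi a x \<partial>N) \<le> 1" for a
    proof -
      have "(\<integral>\<^sup>+x. avg_kernel N p a x * hi a x \<partial>N) \<le>
          (\<integral>\<^sup>+x. ennreal (V a powr (1 / p - 1)) * (ennreal (V a powr (1 - 1 / p)) * g x epowr p) \<partial>N)"
        by (intro nn_integral_mono mult_mono hi_le) (auto simp: avg_kernel_def V_def[symmetric] indicator_def)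
      also have "... = (\<integral>\<^sup>+x. g x epowr p \<partial>N)"
      proof -
        have "ennreal (V a powr (1 / p - 1)) * ennreal (V a powr (1 - 1 / p)) = 1"
          using V(1)[of a] by (simp flip: ennreal_mult powr_add)
        then show ?thesis by (simp add: mult.assoc[symmetric])
      qed
      finally show ?thesis using g1 by simp
    qed
    have "(\<integral>\<^sup>+x. avg_kernel N p a x * hi a x \<partial>N) epowr q \<le> (\<integral>\<^sup>+x. avg_kernel N p a x * hi a x \<partial>N)" for a
    proof -
      let ?T = "\<integral>\<^sup>+x. avg_kernel N p a x * hi a x \<partial>N"
      have "?T epowr (q - 1) \<le> 1 epowr (q - 1)" using pq T by (intro epowr_mono) auto
      then have "?T * ?T epowr (q - 1) \<le> ?T * 1" by (intro mult_left_mono) auto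
      then show ?thesis using epowr_add[of ?T 1 "q - 1"] by simp
    qed
    then have "(\<Sum>\<^sup>+a. (\<integral>\<^sup>+x. avg_kernel N p a x * hi a x \<partial>N) epowr q) \<le>
        (\<Sum>\<^sup>+a. \<integral>\<^sup>+x. ennreal (V a powr (1 / p - 1)) * indicator (grid a) x * hi a x epowr 1 \<partial>N)"
      unfolding epowr_one by (simp add: avg_kernel_def V_def nn_integral_mono)
    also have "... \<le> ennreal C * (\<integral>\<^sup>+x. g x epowr p \<partial>N)"
      unfolding hi_def
    proof (rule grid_sum_integral_le[OF sets g V(1)])
      fix \<gamma> :: real and x assume \<gamma>: "0 < \<gamma>"
      have "\<gamma> powr (- p) \<le> V a" if "\<not> \<gamma> \<le> V a powr (- 1 / p)" for a
      proof -
        have "\<gamma> powr (- p) \<le> (V a powr (- 1 / p)) powr (- p)"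
          using that \<gamma> V(1)[of a] pq by (intro powr_mono2') auto
        then show ?thesis using pq V(1)[of a] by (simp add: powr_powr)
      qed
      then have "(\<Sum>\<^sup>+a. indicator (grid a) x * (if \<not> ennreal \<gamma> \<le> ennreal (V a powr (- 1 / p))
          then ennreal (V a powr (1 / p - 1)) else 0)) \<le> (\<Sum>\<^sup>+a. indicator (grid a) x *
          (if \<gamma> powr (- p) \<le> V a then ennreal (V a powr (- (1 - 1 / p))) else 0))"
        by (intro nn_integral_mono mult_left_mono) auto
      also have "... \<le> ennreal (C * (\<gamma> powr (- p)) powr (1 / p - 1))"
        using C(2)[of "\<gamma> powr (- p)" x] \<gamma> by simp
      finally show "(\<Sum>\<^sup>+a. indicator (grid a) x * (if \<not> ennreal \<gamma> \<le> ennreal (V a powr (- 1 / p))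
          then ennreal (V a powr (1 / p - 1)) else 0)) \<le> ennreal (C * (\<gamma> powr (- p)) powr (1 / p - 1))" .
    qed (use C(1) pq in auto)
    finally show "(\<Sum>\<^sup>+a. (\<integral>\<^sup>+x. avg_kernel N p a x * high_part N p g a x \<partial>N) epowr q)
      \<le> ennreal C * (\<integral>\<^sup>+x. g x epowr p \<partial>N)"
      by (simp add: hi_def V_def high_part_def)
  qed
qed

text \<open>The heights of the split presuppose norm at most 1, so it is applied to \<open>g\<close>
  scaled by \<open>\<gamma> powr (- 1 / p)\<close>; both sides are homogeneous of degree
  \<open>q\<close>, which restores the general case.\<close>

theorem avg_embedding:
  fixes N :: "(real^'n) measure"
  assumes N: "A_infty_measure N" and pq: "1 < p" "p < q"
  obtains C where "0 < C" "\<And>g. g \<in> borel_measurable N \<Longrightarrow>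
    (\<Sum>\<^sup>+a. (\<integral>\<^sup>+x. avg_kernel N p a x * g x \<partial>N) epowr q)
      \<le> ennreal C * (\<integral>\<^sup>+x. g x epowr p \<partial>N) epowr (q / p)"
proof -
  have sets [simp, measurable_cong]: "sets N = sets borel" using N by (simp add: A_infty_measure_def)
  obtain C1 where C1: "0 < C1" "\<And>g. g \<in> borel_measurable N \<Longrightarrow>
    (\<Sum>\<^sup>+a. (\<integral>\<^sup>+x. avg_kernel N p a x * low_part N p g a x \<partial>N) epowr q) \<le> ennreal C1 * (\<integral>\<^sup>+x. g x epowr p \<partial>N)"
    using avg_embedding_low[OF N pq] by blast
  obtain C2 where C2: "0 < C2" "\<And>g. g \<in> borel_measurable N \<Longrightarrow> (\<integral>\<^sup>+x. g x epowr p \<partial>N) \<le> 1 \<Longrightarrow>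
    (\<Sum>\<^sup>+a. (\<integral>\<^sup>+x. avg_kernel N p a x * high_part N p g a x \<partial>N) epowr q) \<le> ennreal C2 * (\<integral>\<^sup>+x. g x epowr p \<partial>N)"
    using avg_embedding_high[OF N pq] by blast
  define C where "C = 2 powr q * (C1 + C2)"
  have C: "0 < C" using C1(1) C2(1) by (simp add: C_def)
  have unit: "(\<Sum>\<^sup>+a. (\<integral>\<^sup>+x. avg_kernel N p a x * g x \<partial>N) epowr q) \<le> ennreal C"
    if [measurable]: "g \<in> borel_measurable N" and g1: "(\<integral>\<^sup>+x. g x epowr p \<partial>N) \<le> 1" for g
  proof -
    have [measurable]: "low_part N p g a \<in> borel_measurable N" "high_part N p g a \<in> borel_measurable N" for a
      unfolding low_part_def[abs_def] high_part_def[abs_def] by measurable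
    have "(\<integral>\<^sup>+x. avg_kernel N p a x * g x \<partial>N) epowr q \<le> ennreal (2 powr q) *
        ((\<integral>\<^sup>+x. avg_kernel N p a x * low_part N p g a x \<partial>N) epowr q + (\<integral>\<^sup>+x. avg_kernel N p a x * high_part N p g a x \<partial>N) epowr q)" for a
    proof -
      have "(\<integral>\<^sup>+x. avg_kernel N p a x * g x \<partial>N) =
          (\<integral>\<^sup>+x. avg_kernel N p a x * low_part N p g a x \<partial>N) + (\<integral>\<^sup>+x. avg_kernel N p a x * high_part N p g a x \<partial>N)"
        by (subst nn_integral_add[symmetric]) (auto intro!: nn_integral_cong simp: low_part_def high_part_def)
      then show ?thesis using pq by (simp add: epowr_add_le)
    qed
    then have "(\<Sum>\<^sup>+a. (\<integral>\<^sup>+x. avg_kernel N p a x * g x \<partial>N) epowr q) \<le>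
        (\<Sum>\<^sup>+a. ennreal (2 powr q) * ((\<integral>\<^sup>+x. avg_kernel N p a x * low_part N p g a x \<partial>N) epowr q +
          (\<integral>\<^sup>+x. avg_kernel N p a x * high_part N p g a x \<partial>N) epowr q))"
      by (rule nn_integral_mono)
    also have "... = ennreal (2 powr q) * ((\<Sum>\<^sup>+a. (\<integral>\<^sup>+x. avg_kernel N p a x * low_part N p g a x \<partial>N) epowr q) +
          (\<Sum>\<^sup>+a. (\<integral>\<^sup>+x. avg_kernel N p a x * high_part N p g a x \<partial>N) epowr q))"
      by (subst nn_integral_cmult) (auto simp: nn_integral_add)
    also have "... \<le> ennreal (2 powr q) * (ennreal C1 * 1 + ennreal C2 * 1)"
    proof (intro mult_left_mono add_mono)
      show "(\<Sum>\<^sup>+a. (\<integral>\<^sup>+x. avg_kernel N p a x * low_part N p g a x \<partial>N) epowr q) \<le> ennreal C1 * 1"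
        by (rule order_trans[OF C1(2)]) (use g1 in \<open>auto simp del: mult_1_right intro!: mult_left_mono\<close>)
      show "(\<Sum>\<^sup>+a. (\<integral>\<^sup>+x. avg_kernel N p a x * high_part N p g a x \<partial>N) epowr q) \<le> ennreal C2 * 1"
        by (rule order_trans[OF C2(2)[OF _ g1]]) (use g1 in \<open>auto simp del: mult_1_right intro!: mult_left_mono\<close>)
    qed auto
    also have "... = ennreal C"
      using C1(1) C2(1) by (simp add: C_def ennreal_mult)
    finally show ?thesis .
  qed
  show thesis
  proof (rule that[OF C])
    fix g :: "real^'n \<Rightarrow> ennreal" assume g [measurable]: "g \<in> borel_measurable N"
    define G where "G = (\<integral>\<^sup>+x. g x epowr p \<partial>N)"
    consider "G = 0" | "G = top" | \<gamma> where "G = ennreal \<gamma>" "0 < \<gamma>"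
      by (cases G) (auto simp: order.order_iff_strict)
    then show "(\<Sum>\<^sup>+a. (\<integral>\<^sup>+x. avg_kernel N p a x * g x \<partial>N) epowr q)
      \<le> ennreal C * (\<integral>\<^sup>+x. g x epowr p \<partial>N) epowr (q / p)"
    proof cases
      case 1
      then have ae: "AE x in N. g x = 0" unfolding G_def by (subst (asm) nn_integral_0_iff_AE) auto
      have "(\<integral>\<^sup>+x. avg_kernel N p a x * g x \<partial>N) = (\<integral>\<^sup>+x. 0 \<partial>N)" for a
        by (rule nn_integral_cong_AE) (use ae in \<open>auto elim!: eventually_mono\<close>)
      then show ?thesis by simp
    next
      case 2
      then show ?thesis using C by (simp add: G_def[symmetric] ennreal_mult_top)
    next
      case 3
      define c where "c = \<gamma> powr (- 1 / p)"
      have c: "0 < c" using 3 by (simp add: c_def)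
      have "(\<integral>\<^sup>+x. (ennreal c * g x) epowr p \<partial>N) = ennreal (c powr p) * G"
        unfolding G_def using c by (simp add: epowr_mult epowr_ennreal nn_integral_cmult)
      also have "... = 1"
      proof -
        have "c powr p * \<gamma> = \<gamma> powr (- 1) * \<gamma>" using pq by (simp add: c_def powr_powr)
        then have "c powr p * \<gamma> = 1" using 3 by (simp add: powr_minus)
        then show ?thesis using 3 by (simp flip: ennreal_mult)
      qed
      finally have "(\<Sum>\<^sup>+a. (\<integral>\<^sup>+x. avg_kernel N p a x * (ennreal c * g x) \<partial>N) epowr q) \<le> ennreal C"
        by (intro unit) auto
      also have "(\<Sum>\<^sup>+a. (\<integral>\<^sup>+x. avg_kernel N p a x * (ennreal c * g x) \<partial>N) epowr q) =
          (\<Sum>\<^sup>+a. ennreal (c powr q) * (\<integral>\<^sup>+x. avg_kernel N p a x * g x \<partial>N) epowr q)"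
        using c by (intro nn_integral_cong)
          (simp add: mult.left_commute[of _ "ennreal c"] nn_integral_cmult epowr_mult epowr_ennreal)
      also have "... = ennreal (c powr q) * (\<Sum>\<^sup>+a. (\<integral>\<^sup>+x. avg_kernel N p a x * g x \<partial>N) epowr q)"
        by (rule nn_integral_cmult) auto
      finally have "ennreal (c powr (- q)) * (ennreal (c powr q) *
          (\<Sum>\<^sup>+a. (\<integral>\<^sup>+x. avg_kernel N p a x * g x \<partial>N) epowr q)) \<le> ennreal (c powr (- q)) * ennreal C"
        by (intro mult_left_mono) auto
      moreover have "ennreal (c powr (- q)) * (ennreal (c powr q) * X) = X" for X
        using c by (simp add: mult.assoc[symmetric] flip: ennreal_mult powr_add)
      ultimately have "(\<Sum>\<^sup>+a. (\<integral>\<^sup>+x. avg_kernel N p a x * g x \<partial>N) epowr q)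
          \<le> ennreal (c powr (- q)) * ennreal C" by simp
      moreover have "c powr (- q) = \<gamma> powr (q / p)" using 3 by (simp add: c_def powr_powr)
      moreover have "(\<integral>\<^sup>+x. g x epowr p \<partial>N) epowr (q / p) = ennreal (\<gamma> powr (q / p))"
        using 3 by (simp add: G_def[symmetric] epowr_ennreal)
      ultimately show ?thesis by (simp add: mult.commute)
    qed
  qed
qed

section \<open>The product embedding and joint weight conditions\<close>

lemma PiM_count_space_eq:
  "PiM (UNIV :: 'k::finite set) (\<lambda>_. count_space (UNIV :: 'a::countable set)) = count_space UNIV"
proof -
  interpret product_sigma_finite "\<lambda>_::'k. count_space (UNIV :: 'a set)"
    by (rule product_sigma_finite_count_space)
  interpret finite_product_sigma_finite "\<lambda>_::'k. count_space (UNIV :: 'a set)" UNIV by standard simp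
  have sing: "{f} = (\<Pi>\<^sub>E i\<in>UNIV. {f i})" for f :: "'k \<Rightarrow> 'a"
    by (auto simp: PiE_UNIV_domain)
  have s1: "{f} \<in> sets (PiM UNIV (\<lambda>_::'k. count_space (UNIV :: 'a set)))" for f
    unfolding sing by (rule sets_PiM_I_finite) auto
  show ?thesis
  proof (rule measure_eqI_countable[of _ UNIV])
    have "X \<in> sets (PiM UNIV (\<lambda>_::'k. count_space (UNIV :: 'a set)))" for X
    proof -
      have "(\<Union>f\<in>X. {f}) \<in> sets (PiM UNIV (\<lambda>_::'k. count_space (UNIV :: 'a set)))"
        by (rule sets.countable_UN') (use s1 in \<open>auto intro: countableI_type\<close>)
      then show ?thesis by simp
    qed
    then show "sets (PiM UNIV (\<lambda>_::'k. count_space (UNIV :: 'a set))) = Pow UNIV" by auto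
    fix f :: "'k \<Rightarrow> 'a"
    show "emeasure (PiM UNIV (\<lambda>_::'k. count_space UNIV)) {f} = emeasure (count_space UNIV) {f}"
    proof -
      have "emeasure (PiM UNIV (\<lambda>_::'k. count_space UNIV)) {f} = (\<Prod>i\<in>UNIV. emeasure (count_space UNIV) {f i})"
        by (subst sing[of f], subst measure_times) auto
      then show ?thesis by simp
    qed
  qed auto
qed

lemma nn_integral_PiM_density:
  fixes \<rho> :: "'k::finite \<Rightarrow> 'a::euclidean_space \<Rightarrow> ennreal"
  assumes \<rho> [measurable]: "\<And>j. \<rho> j \<in> borel_measurable borel"
    and N: "product_sigma_finite (\<lambda>j. density lborel (\<rho> j))"
    and f [measurable]: "f \<in> borel_measurable (borel :: ('a^'k) measure)"
  shows "(\<integral>\<^sup>+x. f (vec_lambda x) \<partial>PiM UNIV (\<lambda>j. density lborel (\<rho> j))) =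
    (\<integral>\<^sup>+x. f x * (\<Prod>j\<in>UNIV. \<rho> j (x $ j)) \<partial>lborel)"
proof -
  interpret L: product_sigma_finite "\<lambda>_::'k. lborel :: 'a measure" ..
  interpret product_sigma_finite "\<lambda>j. density lborel (\<rho> j)" by fact
  let ?d = "density (PiM UNIV (\<lambda>_. lborel)) (\<lambda>x. \<Prod>j\<in>UNIV. \<rho> j (x j))"
  have "?d = PiM UNIV (\<lambda>j. density lborel (\<rho> j))"
  proof (rule PiM_eqI)
    show "sets ?d = sets (PiM UNIV (\<lambda>j. density lborel (\<rho> j)))"
      unfolding sets_density by (rule sets_PiM_cong) auto
    fix A assume A: "\<And>j. j \<in> UNIV \<Longrightarrow> A j \<in> sets (density lborel (\<rho> j))"
    then have [measurable]: "A j \<in> sets borel" for j by simp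
    have "emeasure ?d (PiE UNIV A) = (\<integral>\<^sup>+x\<in>PiE UNIV A. (\<Prod>j\<in>UNIV. \<rho> j (x j)) \<partial>PiM UNIV (\<lambda>_. lborel))"
      by (rule emeasure_density) (auto intro!: sets_PiM_I_finite)
    also have "... = (\<integral>\<^sup>+x. (\<Prod>j\<in>UNIV. \<rho> j (x j) * indicator (A j) (x j)) \<partial>PiM UNIV (\<lambda>_. lborel))"
    proof (rule nn_integral_cong)
      fix x
      have "indicator (PiE UNIV A) x = (\<Prod>j\<in>UNIV. indicator (A j) (x j) :: ennreal)"
        by (simp add: indicator_def PiE_UNIV_domain Pi_iff)
      then show "(\<Prod>j\<in>UNIV. \<rho> j (x j)) * indicator (PiE UNIV A) x =
          (\<Prod>j\<in>UNIV. \<rho> j (x j) * indicator (A j) (x j))"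
        by (simp add: prod.distrib)
    qed
    also have "... = (\<Prod>j\<in>UNIV. \<integral>\<^sup>+x\<in>A j. \<rho> j x \<partial>lborel)"
      by (rule L.product_nn_integral_prod) auto
    also have "... = (\<Prod>j\<in>UNIV. emeasure (density lborel (\<rho> j)) (A j))"
      by (simp add: emeasure_density)
    finally show "emeasure ?d (PiE UNIV A) = (\<Prod>j\<in>UNIV. emeasure (density lborel (\<rho> j)) (A j))" .
  qed simp
  then have "(\<integral>\<^sup>+x. f (vec_lambda x) \<partial>PiM UNIV (\<lambda>j. density lborel (\<rho> j))) = (\<integral>\<^sup>+x. f (vec_lambda x) \<partial>?d)"
    by simp
  also have "... = (\<integral>\<^sup>+x. (\<Prod>j\<in>UNIV. \<rho> j (x j)) * f (vec_lambda x) \<partial>PiM UNIV (\<lambda>_. lborel))"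
    by (rule nn_integral_density) auto
  also have "... = (\<integral>\<^sup>+x. f x * (\<Prod>j\<in>UNIV. \<rho> j (x $ j)) \<partial>lborel)"
    by (subst nn_integral_lborel_vec) (auto simp: mult.commute)
  finally show ?thesis .
qed

definition rect :: "('k \<Rightarrow> int \<times> ('n \<Rightarrow> int)) \<Rightarrow> (real^'n^'k) set" where
  "rect a = cube_prod (\<lambda>j. grid (a j))"

lemma indicator_cube_prod:
  "indicator (cube_prod Q) x = (\<Prod>j\<in>UNIV. indicator (Q (j::'k::finite)) (x $ j) :: ennreal)"
  by (simp add: cube_prod_def indicator_def)

lemma cube_prod_borel:
  fixes Q :: "'k::finite \<Rightarrow> (real^'n) set"
  assumes [measurable]: "\<And>j. Q j \<in> sets borel"
  shows "cube_prod Q \<in> sets borel"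
proof -
  have "{x \<in> space borel. \<forall>j. x $ j \<in> Q j} \<in> sets (borel :: (real^'n^'k) measure)" by measurable
  then show ?thesis by (simp add: cube_prod_def)
qed

lemma rect_borel [measurable]: "rect a \<in> sets (borel :: (real^'n^'k::finite) measure)"
  unfolding rect_def by (rule cube_prod_borel) (rule grid_borel)

lemma nn_integral_cube_prod:
  fixes \<rho> :: "'k::finite \<Rightarrow> real^'n \<Rightarrow> ennreal"
  assumes [measurable]: "\<And>j. \<rho> j \<in> borel_measurable borel" "\<And>j. Q j \<in> sets borel"
  shows "(\<integral>\<^sup>+x\<in>cube_prod Q. (\<Prod>j\<in>UNIV. \<rho> j (x $ j)) \<partial>lborel) =
    (\<Prod>j\<in>UNIV. \<integral>\<^sup>+x\<in>Q j. \<rho> j x \<partial>lborel)"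
  by (subst nn_integral_lborel_vec_prod[symmetric]) (auto simp: indicator_cube_prod prod.distrib)

text \<open>The tensor product of the kernels \<open>avg_kernel\<close> applied to \<open>g\<close>,
  written with Lebesgue measure. For \<open>g = f / \<sigma>\<close>, where \<sigma> is the product
  of the \<open>\<rho> j\<close>, the integral is simply that of \<open>f\<close> over the
  rectangle.\<close>

definition avg_op :: "('k::finite \<Rightarrow> real^'n \<Rightarrow> real) \<Rightarrow> real \<Rightarrow> (real^'n^'k \<Rightarrow> ennreal) \<Rightarrow>
    ('k \<Rightarrow> int \<times> ('n \<Rightarrow> int)) \<Rightarrow> ennreal" where
  "avg_op \<rho> p g a = ennreal (\<Prod>j\<in>UNIV. measure (density lborel (\<lambda>x. ennreal (\<rho> j x))) (grid (a j)) powr (1 / p - 1)) *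
    (\<integral>\<^sup>+x. indicator (rect a) x * (g x * ennreal (\<Prod>j\<in>UNIV. \<rho> j (x $ j))) \<partial>lborel)"

text \<open>The tensor bound applied to \<open>avg_embedding\<close> in each coordinate, with the
  product measure rewritten as a density and the product of counting measures as a sum over
  tuples.\<close>

theorem avg_op_embedding:
  fixes \<rho> :: "'k::finite \<Rightarrow> real^'n \<Rightarrow> real"
  assumes \<rho> [measurable]: "\<And>j. \<rho> j \<in> borel_measurable borel" and \<rho>0: "\<And>j x. 0 \<le> \<rho> j x"
    and N: "\<And>j. A_infty_measure (density lborel (\<lambda>x. ennreal (\<rho> j x)))"
    and pq: "1 < p" "p < q"
  obtains C where "0 < C" "\<And>g. g \<in> borel_measurable borel \<Longrightarrow>
    (\<Sum>\<^sup>+a. avg_op \<rho> p g a epowr q)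
      \<le> ennreal C * (\<integral>\<^sup>+x. g x epowr p * ennreal (\<Prod>j\<in>UNIV. \<rho> j (x $ j)) \<partial>lborel) epowr (q / p)"
proof -
  define M where "M j = density lborel (\<lambda>x. ennreal (\<rho> j x))" for j
  have N': "A_infty_measure (M j)" and setsM [simp, measurable_cong]: "sets (M j) = sets borel" for j
    using N by (auto simp: M_def)
  have psf: "product_sigma_finite M"
    by (intro product_sigma_finite.intro A_infty_measure_sigma_finite N')
  have "\<forall>j. \<exists>C>0. \<forall>g\<in>borel_measurable (M j).
    (\<Sum>\<^sup>+a. (\<integral>\<^sup>+x. avg_kernel (M j) p a x * g x \<partial>M j) epowr q)
      \<le> ennreal C * (\<integral>\<^sup>+x. g x epowr p \<partial>M j) epowr (q / p)" (is "\<forall>j. \<exists>C>0. ?P j C")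
  proof
    show "\<exists>C>0. ?P j C" for j
      by (rule avg_embedding[OF N'[of j] pq]) blast
  qed
  from choice[OF this] obtain C where C': "\<forall>j. 0 < C j \<and> ?P j (C j)" by (rule exE)
  have C: "\<And>j. 0 < C j" "\<And>j g. g \<in> borel_measurable (M j) \<Longrightarrow>
    (\<Sum>\<^sup>+a. (\<integral>\<^sup>+x. avg_kernel (M j) p a x * g x \<partial>M j) epowr q)
      \<le> ennreal (C j) * (\<integral>\<^sup>+x. g x epowr p \<partial>M j) epowr (q / p)"
    by (rule conjunct1[OF C'[rule_format]]) (rule bspec[OF conjunct2[OF C'[rule_format]]])
  show thesis
  proof (rule that[of "\<Prod>j\<in>UNIV. C j"])
    show "0 < (\<Prod>j\<in>UNIV. C j)" using C(1) by (simp add: prod_pos)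
    fix g :: "real^'n^'k \<Rightarrow> ennreal" assume g [measurable]: "g \<in> borel_measurable borel"
    have conv: "(\<integral>\<^sup>+x. f (vec_lambda x) \<partial>PiM UNIV M) = (\<integral>\<^sup>+x. f x * ennreal (\<Prod>j\<in>UNIV. \<rho> j (x $ j)) \<partial>lborel)"
      if "f \<in> borel_measurable (borel :: (real^'n^'k) measure)" for f
      using nn_integral_PiM_density[of "\<lambda>j x. ennreal (\<rho> j x)" f] that psf \<rho>0
      by (simp add: M_def[abs_def] prod_ennreal)
    have [measurable]: "vec_lambda \<in> PiM UNIV M \<rightarrow>\<^sub>M borel"
      using measurable_vec_lambda by (simp cong: measurable_cong_sets sets_PiM_cong)
    have "avg_op \<rho> p g a = (\<integral>\<^sup>+x. (\<Prod>j\<in>UNIV. avg_kernel (M j) p (a j) (x j)) * g (vec_lambda x) \<partial>PiM UNIV M)" for a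
    proof -
      define c where "c = (\<Prod>j\<in>UNIV. measure (M j) (grid (a j)) powr (1 / p - 1))"
      have "(\<Prod>j\<in>UNIV. avg_kernel (M j) p (a j) (x j)) * g (vec_lambda x) =
          ennreal c * (indicator (rect a) (vec_lambda x) * g (vec_lambda x))" for x
        by (simp add: avg_kernel_def rect_def indicator_cube_prod prod.distrib c_def prod_ennreal mult.assoc)
      then have "(\<integral>\<^sup>+x. (\<Prod>j\<in>UNIV. avg_kernel (M j) p (a j) (x j)) * g (vec_lambda x) \<partial>PiM UNIV M) =
          ennreal c * (\<integral>\<^sup>+x. indicator (rect a) (vec_lambda x) * g (vec_lambda x) \<partial>PiM UNIV M)"
        by (simp add: nn_integral_cmult)
      also have "... = avg_op \<rho> p g a"
        by (subst conv) (auto simp: avg_op_def c_def M_def mult.assoc)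
      finally show ?thesis by simp
    qed
    then have "(\<Sum>\<^sup>+a. avg_op \<rho> p g a epowr q) =
        (\<integral>\<^sup>+a. (\<integral>\<^sup>+x. (\<Prod>j\<in>UNIV. avg_kernel (M j) p (a j) (x j)) * g (vec_lambda x) \<partial>PiM UNIV M) epowr q
          \<partial>PiM UNIV (\<lambda>_. count_space UNIV))"
      by (simp add: PiM_count_space_eq)
    also have "... \<le> (\<Prod>j\<in>UNIV. ennreal (C j)) * (\<integral>\<^sup>+x. g (vec_lambda x) epowr p \<partial>PiM UNIV M) epowr (q / p)"
      by (rule nn_integral_tensor_le[OF _ psf]) (use pq C in auto)
    also have "(\<Prod>j\<in>UNIV. ennreal (C j)) = ennreal (\<Prod>j\<in>UNIV. C j)"
      using C(1) by (simp add: prod_ennreal less_imp_le)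
    also have "(\<integral>\<^sup>+x. g (vec_lambda x) epowr p \<partial>PiM UNIV M) =
        (\<integral>\<^sup>+x. g x epowr p * ennreal (\<Prod>j\<in>UNIV. \<rho> j (x $ j)) \<partial>lborel)"
      by (rule conv) measurable
    finally show "(\<Sum>\<^sup>+a. avg_op \<rho> p g a epowr q) \<le> ennreal (\<Prod>j\<in>UNIV. C j) *
        (\<integral>\<^sup>+x. g x epowr p * ennreal (\<Prod>j\<in>UNIV. \<rho> j (x $ j)) \<partial>lborel) epowr (q / p)" .
  qed
qed

text \<open>Hoelder over the grid with \<open>t i = r i * s\<close>, where \<open>s\<close> is the
  sum of the \<open>1 / r i\<close>: then the \<open>1 / t i\<close> add up to 1, and
  \<open>r i < e * t i\<close> says precisely \<open>1 < e * s\<close>, so the embedding applies to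
  each factor with exponent \<open>e * t i\<close>. The power \<open>e\<close> will be
  \<open>q\<close> if \<open>q <= 1\<close>, and 1 after dualising.\<close>

theorem avg_op_multilinear_bound:
  fixes \<rho> :: "'o::finite \<Rightarrow> 'k::finite \<Rightarrow> real^'n \<Rightarrow> real"
  assumes \<rho> [measurable]: "\<And>i j. \<rho> i j \<in> borel_measurable borel" and \<rho>0: "\<And>i j x. 0 \<le> \<rho> i j x"
    and N: "\<And>i j. A_infty_measure (density lborel (\<lambda>x. ennreal (\<rho> i j x)))"
    and r: "\<And>i. 1 < r i" and e: "0 < e" "1 < e * (\<Sum>i\<in>UNIV. 1 / r i)"
  obtains C where "0 < C" "\<And>g. (\<And>i. g i \<in> borel_measurable borel) \<Longrightarrow>
    (\<Sum>\<^sup>+a. (\<Prod>i\<in>UNIV. avg_op (\<rho> i) (r i) (g i) a) epowr e) \<le>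
      ennreal C * (\<Prod>i\<in>UNIV. (\<integral>\<^sup>+x. g i x epowr r i * ennreal (\<Prod>j\<in>UNIV. \<rho> i j (x $ j)) \<partial>lborel) epowr (1 / r i)) epowr e"
proof -
  define s where "s = (\<Sum>i\<in>UNIV. 1 / r i)"
  have "0 < e * s" using e by (simp add: s_def)
  then have s: "0 < s" using e(1) by (simp add: zero_less_mult_iff)
  define t where "t i = r i * s" for i
  have rpos: "0 < r i" for i using r[of i] by simp
  have t: "0 < t i" for i using rpos s by (simp add: t_def)
  have t1: "(\<Sum>i\<in>UNIV. 1 / t i) = 1"
    using s by (simp add: t_def s_def flip: sum_divide_distrib divide_divide_eq_left)
  have et: "r i < e * t i" for i
    using e rpos[of i] by (simp add: t_def s_def[symmetric] mult.left_commute)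
  have "\<forall>i. \<exists>C>0. \<forall>g\<in>borel_measurable borel.
    (\<Sum>\<^sup>+a. avg_op (\<rho> i) (r i) g a epowr (e * t i))
      \<le> ennreal C * (\<integral>\<^sup>+x. g x epowr r i * ennreal (\<Prod>j\<in>UNIV. \<rho> i j (x $ j)) \<partial>lborel) epowr (e * t i / r i)"
    (is "\<forall>i. \<exists>C>0. ?P i C")
  proof
    show "\<exists>C>0. ?P i C" for i
      by (rule avg_op_embedding[of "\<rho> i" "r i" "e * t i"]) (use \<rho> \<rho>0 N r et in blast)+
  qed
  from choice[OF this] obtain C where C': "\<forall>i. 0 < C i \<and> ?P i (C i)" by (rule exE)
  have C: "\<And>i. 0 < C i" "\<And>i g. g \<in> borel_measurable borel \<Longrightarrow>
    (\<Sum>\<^sup>+a. avg_op (\<rho> i) (r i) g a epowr (e * t i))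
      \<le> ennreal (C i) * (\<integral>\<^sup>+x. g x epowr r i * ennreal (\<Prod>j\<in>UNIV. \<rho> i j (x $ j)) \<partial>lborel) epowr (e * t i / r i)"
    by (rule conjunct1[OF C'[rule_format]]) (rule bspec[OF conjunct2[OF C'[rule_format]]])
  show thesis
  proof (rule that[of "\<Prod>i\<in>UNIV. C i powr (1 / t i)"])
    show "0 < (\<Prod>i\<in>UNIV. C i powr (1 / t i))" using C(1) by (intro prod_pos) (auto simp: less_imp_neq[symmetric])
    fix g :: "'o \<Rightarrow> real^'n^'k \<Rightarrow> ennreal" assume g: "\<And>i. g i \<in> borel_measurable borel"
    define T where "T i a = avg_op (\<rho> i) (r i) (g i) a epowr e" for i a
    define G where "G i = (\<integral>\<^sup>+x. g i x epowr r i * ennreal (\<Prod>j\<in>UNIV. \<rho> i j (x $ j)) \<partial>lborel)" for i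
    have "(\<Sum>\<^sup>+a. (\<Prod>i\<in>UNIV. avg_op (\<rho> i) (r i) (g i) a) epowr e) =
        (\<Sum>\<^sup>+a. (\<Prod>i\<in>UNIV. T i a))"
      by (simp add: T_def epowr_prod)
    also have "... \<le> (\<Prod>i\<in>UNIV. (\<Sum>\<^sup>+a. T i a epowr t i) epowr (1 / t i))"
      by (rule nn_integral_Hoelder) (use t t1 in auto)
    also have "... \<le> (\<Prod>i\<in>UNIV. (ennreal (C i) * G i epowr (e * t i / r i)) epowr (1 / t i))"
      unfolding T_def epowr_epowr G_def using t
      by (intro prod_mono_ennreal epowr_mono C g) (auto simp: less_imp_le)
    also have "... = (\<Prod>i\<in>UNIV. ennreal (C i powr (1 / t i)) * G i epowr (1 / r i * e))"
    proof (rule prod.cong[OF refl])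
      fix i
      have "e * t i / r i * (1 / t i) = 1 / r i * e" using t[of i] by (simp add: field_simps)
      then show "(ennreal (C i) * G i epowr (e * t i / r i)) epowr (1 / t i) =
          ennreal (C i powr (1 / t i)) * G i epowr (1 / r i * e)"
        using C(1)[of i] by (simp only: epowr_mult epowr_epowr epowr_ennreal less_imp_le)
    qed
    also have "... = ennreal (\<Prod>i\<in>UNIV. C i powr (1 / t i)) * (\<Prod>i\<in>UNIV. G i epowr (1 / r i)) epowr e"
      by (simp add: prod.distrib epowr_prod epowr_epowr prod_ennreal)
    finally show "(\<Sum>\<^sup>+a. (\<Prod>i\<in>UNIV. avg_op (\<rho> i) (r i) (g i) a) epowr e) \<le>
      ennreal (\<Prod>i\<in>UNIV. C i powr (1 / t i)) *
        (\<Prod>i\<in>UNIV. (\<integral>\<^sup>+x. g i x epowr r i * ennreal (\<Prod>j\<in>UNIV. \<rho> i j (x $ j)) \<partial>lborel) epowr (1 / r i)) epowr e"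
      by (simp add: G_def)
  qed
qed

text \<open>Since the \<open>\<rho> i powr \<theta> i\<close> multiply to 1, the indicator of
  \<open>E\<close> is a product of powers of the weights, and Hoelder with exponents
  \<open>\<tau> / \<theta> i\<close> applies. This bounds from below what the weight condition
  bounds from above, and it does so for sets of any shape.\<close>

lemma emeasure_le_prod_weights:
  fixes \<rho> :: "'o::finite \<Rightarrow> 'a \<Rightarrow> real"
  assumes [measurable]: "\<And>i. \<rho> i \<in> borel_measurable M" "E \<in> sets M" and pos: "\<And>i x. 0 < \<rho> i x"
    and \<theta>: "\<And>i. 0 < \<theta> i" and one: "\<And>x. (\<Prod>i\<in>UNIV. \<rho> i x powr \<theta> i) = 1"
  shows "emeasure M E epowr (\<Sum>i\<in>UNIV. \<theta> i) \<le>
    (\<Prod>i\<in>UNIV. (\<integral>\<^sup>+x\<in>E. ennreal (\<rho> i x) \<partial>M) epowr \<theta> i)"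
proof -
  define \<tau> where "\<tau> = (\<Sum>i\<in>UNIV. \<theta> i)"
  have \<tau>: "0 < \<tau>" unfolding \<tau>_def using \<theta> by (intro sum_pos) auto
  define f where "f i x = ennreal (\<rho> i x powr (\<theta> i / \<tau>)) * indicator E x" for i x
  have "(\<Prod>i\<in>UNIV. f i x) = indicator E x" for x
  proof -
    have "(\<Prod>i\<in>UNIV. \<rho> i x powr (\<theta> i / \<tau>)) = (\<Prod>i\<in>UNIV. (\<rho> i x powr \<theta> i) powr (1 / \<tau>))"
      by (simp add: powr_powr)
    also have "... = (\<Prod>i\<in>UNIV. \<rho> i x powr \<theta> i) powr (1 / \<tau>)"
      by (rule prod_powr_distrib[symmetric])
    finally have "(\<Prod>i\<in>UNIV. \<rho> i x powr (\<theta> i / \<tau>)) = 1" by (simp add: one)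
    then show ?thesis by (simp add: f_def prod.distrib prod_ennreal indicator_def)
  qed
  then have "emeasure M E = (\<integral>\<^sup>+x. (\<Prod>i\<in>UNIV. f i x) \<partial>M)" by simp
  also have "... \<le> (\<Prod>i\<in>UNIV. (\<integral>\<^sup>+x. f i x epowr (\<tau> / \<theta> i) \<partial>M) epowr (1 / (\<tau> / \<theta> i)))"
  proof (rule nn_integral_Hoelder)
    show "(\<Sum>i\<in>UNIV. 1 / (\<tau> / \<theta> i)) = 1" using \<tau> by (simp add: \<tau>_def flip: sum_divide_distrib)
  qed (use \<tau> \<theta> in \<open>auto simp: f_def\<close>)
  also have "... = (\<Prod>i\<in>UNIV. (\<integral>\<^sup>+x\<in>E. ennreal (\<rho> i x) \<partial>M) epowr (\<theta> i * (1 / \<tau>)))"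
  proof (rule prod.cong[OF refl])
    fix i
    have "f i x epowr (\<tau> / \<theta> i) = ennreal (\<rho> i x) * indicator E x" for x
      using pos[of i x] \<theta>[of i] \<tau>
      by (auto simp: f_def epowr_mult epowr_ennreal powr_powr indicator_def)
    then show "(\<integral>\<^sup>+x. f i x epowr (\<tau> / \<theta> i) \<partial>M) epowr (1 / (\<tau> / \<theta> i)) =
      (\<integral>\<^sup>+x\<in>E. ennreal (\<rho> i x) \<partial>M) epowr (\<theta> i * (1 / \<tau>))" by simp
  qed
  also have "... = (\<Prod>i\<in>UNIV. (\<integral>\<^sup>+x\<in>E. ennreal (\<rho> i x) \<partial>M) epowr \<theta> i) epowr (1 / \<tau>)"
    by (simp only: epowr_epowr[symmetric] epowr_prod)
  finally show ?thesis using \<tau> by (simp add: \<tau>_def[symmetric] epowr_le_iff)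
qed

text \<open>If \<open>E\<close> fills a portion 2^-n of \<open>Q\<close>, the upper bound on
  \<open>Q\<close> and the lower bound \<open>emeasure_le_prod_weights\<close> on \<open>E\<close>
  make the products over all weights on \<open>Q\<close> and on \<open>E\<close> comparable.
  Bounding the other weights on \<open>E\<close> by those on \<open>Q\<close> and cancelling them
  isolates the weight \<open>i\<close>.\<close>

lemma A_infty_of_joint_condition:
  fixes \<rho> :: "'o::finite \<Rightarrow> real^'n \<Rightarrow> real"
  assumes \<rho> [measurable]: "\<And>i. \<rho> i \<in> borel_measurable borel" and pos: "\<And>i x. 0 < \<rho> i x"
    and \<theta>: "\<And>i. 0 < \<theta> i" and one: "\<And>x. (\<Prod>i\<in>UNIV. \<rho> i x powr \<theta> i) = 1"
    and A: "\<And>Q. Q \<in> cubes \<Longrightarrow>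
      (\<Prod>i\<in>UNIV. (\<integral>\<^sup>+x\<in>Q. ennreal (\<rho> i x) \<partial>lborel) epowr \<theta> i)
        \<le> ennreal A * emeasure lborel Q epowr (\<Sum>i\<in>UNIV. \<theta> i)"
  shows "A_infty_measure (density lborel (\<lambda>x. ennreal (\<rho> i x)))"
proof -
  define \<tau> where "\<tau> = (\<Sum>i\<in>UNIV. \<theta> i)"
  have \<tau>: "0 < \<tau>" unfolding \<tau>_def using \<theta> by (intro sum_pos) auto
  define I where "I i E = (\<integral>\<^sup>+x\<in>E. ennreal (\<rho> i x) \<partial>lborel)" for i E
  have I: "emeasure (density lborel (\<lambda>x. ennreal (\<rho> i x))) E = I i E" if "E \<in> sets borel" for i E
    using that unfolding I_def by (simp add: emeasure_density)
  have Ipos: "0 < I i (qball z r)" if r: "0 < r" for i z r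
  proof (rule ccontr)
    assume "\<not> 0 < I i (qball z r)"
    then have "AE x in lborel. ennreal (\<rho> i x) * indicator (qball z r) x = 0"
      unfolding I_def by (subst nn_integral_0_iff_AE[symmetric]) auto
    then have "AE x in lborel. x \<notin> qball z r"
      by (rule eventually_mono) (use pos[of i] in \<open>auto simp: indicator_def ennreal_eq_0_iff not_le[symmetric] split: if_splits\<close>)
    then have "emeasure lborel (qball z r) = 0"
      by (subst (asm) AE_iff_measurable[OF _ refl]) (auto simp: emeasure_qball)
    then show False using r by (simp add: emeasure_qball)
  qed
  \<comment> \<open>Positivity of all factors comes first: an infinite factor could otherwise be
    hidden by a zero factor in the bounded product.\<close>
  have Ifin: "I i (qball z r) < top" if r: "0 < r" for i z r
  proof (rule ccontr)
    assume "\<not> I i (qball z r) < top"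
    then have "I i (qball z r) = top" using less_top by blast
    then have "(\<Prod>i\<in>UNIV. I i (qball z r) epowr \<theta> i) = top"
      using Ipos[OF r, of _ z] by (auto simp: ennreal_prod_eq_top less_imp_neq[symmetric])
    moreover have "(\<Prod>i\<in>UNIV. I i (qball z r) epowr \<theta> i) \<le> ennreal A * emeasure lborel (qball z r) epowr \<tau>"
      unfolding I_def \<tau>_def using r by (intro A qball_in_cubes)
    ultimately show False
      using r by (simp add: emeasure_qball epowr_ennreal top_unique flip: ennreal_mult'')
  qed
  have "I i (qball z r) \<le> ennreal ((max A 0 * 2 powr (CARD('n) * \<tau>)) powr (1 / \<theta> i)) * I i E"
    if r: "0 < r" and E [measurable]: "E \<in> sets borel" "E \<subseteq> qball z r"
      and large: "emeasure lborel (qball z r) \<le> 2 ^ CARD('n) * emeasure lborel E" for z r E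
  proof -
    let ?Q = "qball z r"
    define P where "P = (\<Prod>l\<in>UNIV - {i}. I l ?Q epowr \<theta> l)"
    have P: "P \<noteq> 0" "P \<noteq> top"
      using Ipos[OF r, of _ z] Ifin[OF r, of _ z]
      by (auto simp: P_def less_imp_neq[symmetric] less_top ennreal_prod_eq_top)
    have mono: "I l E \<le> I l ?Q" for l
      unfolding I_def using E(2) by (intro nn_integral_mono mult_left_mono) (auto simp: indicator_def)
    have "I i ?Q epowr \<theta> i * P = (\<Prod>i\<in>UNIV. I i ?Q epowr \<theta> i)"
      unfolding P_def by (simp add: prod.remove[of UNIV i])
    also have "... \<le> ennreal A * emeasure lborel ?Q epowr \<tau>"
      unfolding I_def \<tau>_def using r by (intro A qball_in_cubes)
    also have "... \<le> ennreal (max A 0) * (2 ^ CARD('n) * emeasure lborel E) epowr \<tau>"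
      using large \<tau> by (intro mult_mono epowr_mono ennreal_leI) auto
    also have "... = ennreal (max A 0 * 2 powr (CARD('n) * \<tau>)) * emeasure lborel E epowr \<tau>"
    proof -
      have "(2 ^ CARD('n) :: ennreal) epowr \<tau> = ennreal (2 powr (CARD('n) * \<tau>))"
      proof -
        have "(2 ^ CARD('n) :: ennreal) = ennreal (2 powr CARD('n))"
          by (simp add: powr_realpow ennreal_power flip: ennreal_numeral)
        then show ?thesis by (simp add: epowr_ennreal powr_powr)
      qed
      then show ?thesis by (simp add: epowr_mult ennreal_mult mult.assoc)
    qed
    also have "emeasure lborel E epowr \<tau> \<le> (\<Prod>i\<in>UNIV. I i E epowr \<theta> i)"
      unfolding I_def \<tau>_def by (rule emeasure_le_prod_weights) (use pos \<theta> one in auto)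
    also have "... = I i E epowr \<theta> i * (\<Prod>l\<in>UNIV - {i}. I l E epowr \<theta> l)"
      by (simp add: prod.remove[of UNIV i])
    also have "(\<Prod>l\<in>UNIV - {i}. I l E epowr \<theta> l) \<le> P"
      unfolding P_def using \<theta> by (intro prod_mono_ennreal epowr_mono mono) (auto simp: less_imp_le)
    finally have "I i ?Q epowr \<theta> i * P \<le> ennreal (max A 0 * 2 powr (CARD('n) * \<tau>)) * (I i E epowr \<theta> i * P)"
      by (simp add: mult_left_mono)
    then have "P * (I i ?Q epowr \<theta> i) \<le> P * (ennreal (max A 0 * 2 powr (CARD('n) * \<tau>)) * I i E epowr \<theta> i)"
      by (simp add: mult_ac)
    then have "I i ?Q epowr \<theta> i \<le> ennreal (max A 0 * 2 powr (CARD('n) * \<tau>)) * I i E epowr \<theta> i"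
      using P by (simp add: ennreal_mult_le_mult_iff)
    then have "I i ?Q \<le> (ennreal (max A 0 * 2 powr (CARD('n) * \<tau>)) * I i E epowr \<theta> i) epowr (1 / \<theta> i)"
      using \<theta>[of i] by (simp add: epowr_le_iff)
    then show ?thesis
      using \<theta>[of i] by (simp add: epowr_mult epowr_epowr epowr_ennreal)
  qed
  then have "\<exists>K. \<forall>z r E. 0 < r \<longrightarrow> E \<in> sets borel \<longrightarrow> E \<subseteq> qball z r \<longrightarrow>
      emeasure lborel (qball z r) \<le> 2 ^ CARD('n) * emeasure lborel E \<longrightarrow> I i (qball z r) \<le> ennreal K * I i E"
    by blast
  then show ?thesis
    unfolding A_infty_measure_def using Ipos Ifin by (simp add: I cong: imp_cong)
qed

section \<open>The grid operator\<close>

text \<open>Each \<open>X a epowr q\<close> is at most the whole sum \<open>B\<close>, hence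
  \<open>X a\<close> is at most \<open>X a epowr q * B epowr (1 / q - 1)\<close>; summation gives
  the claim.\<close>

lemma epowr_nn_integral_count_space_le:
  fixes X :: "'a \<Rightarrow> ennreal"
  assumes q: "0 < q" "q \<le> 1"
  shows "(\<Sum>\<^sup>+a. X a) epowr q \<le> (\<Sum>\<^sup>+a. X a epowr q)"
proof (cases "(\<Sum>\<^sup>+a. X a epowr q) = top \<or> q = 1")
  case True
  then show ?thesis by auto
next
  case False
  define B where "B = (\<Sum>\<^sup>+a. X a epowr q)"
  have X_le: "X a epowr q \<le> B" for a
    unfolding B_def by (rule nn_integral_ge_point) simp
  have "X a \<le> X a epowr q * B epowr (1 / q - 1)" for a
  proof -
    have "X a = X a epowr q * (X a epowr q) epowr (1 / q - 1)"
      using q epowr_add[of "X a" q "q * (1 / q - 1)"] by (simp add: epowr_epowr algebra_simps)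
    also have "... \<le> X a epowr q * B epowr (1 / q - 1)"
      using q by (intro mult_left_mono epowr_mono X_le) auto
    finally show ?thesis .
  qed
  then have "(\<Sum>\<^sup>+a. X a) \<le> (\<Sum>\<^sup>+a. X a epowr q * B epowr (1 / q - 1))"
    by (rule nn_integral_mono)
  also have "... = B * B epowr (1 / q - 1)"
    unfolding B_def by (rule nn_integral_multc) simp
  also have "... = B epowr (1 / q)"
    using epowr_add[of B 1 "1 / q - 1"] by simp
  finally show ?thesis using q by (simp add: epowr_le_iff B_def)
qed

lemma joint_condition_single:
  fixes \<rho> :: "'o::finite \<Rightarrow> 'k::finite \<Rightarrow> real^'n \<Rightarrow> real"
  assumes \<rho> [measurable]: "\<And>i j. \<rho> i j \<in> borel_measurable borel" and pos: "\<And>i j x. 0 < \<rho> i j x"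
    and \<theta>: "\<And>i. 0 < \<theta> i" and one: "\<And>j x. (\<Prod>i\<in>UNIV. \<rho> i j x powr \<theta> i) = 1"
    and A: "\<And>Q :: 'k \<Rightarrow> (real^'n) set. (\<And>j. Q j \<in> cubes) \<Longrightarrow>
      (\<Prod>i\<in>UNIV. (\<Prod>j\<in>UNIV. \<integral>\<^sup>+x\<in>Q j. ennreal (\<rho> i j x) \<partial>lborel) epowr \<theta> i)
        \<le> ennreal A * (\<Prod>j\<in>UNIV. emeasure lborel (Q j)) epowr (\<Sum>i\<in>UNIV. \<theta> i)"
    and Q: "Q \<in> cubes"
  shows "(\<Prod>i\<in>UNIV. (\<integral>\<^sup>+x\<in>Q. ennreal (\<rho> i j x) \<partial>lborel) epowr \<theta> i)
        \<le> ennreal A * emeasure lborel Q epowr (\<Sum>i\<in>UNIV. \<theta> i)"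
proof -
  define U where "U = qball (0::real^'n) (1 / 2)"
  have U: "U \<in> cubes" "U \<in> sets borel" "emeasure lborel U = 1"
    by (auto simp: U_def qball_in_cubes emeasure_qball)
  define Q' where "Q' l = (if l = j then Q else U)" for l
  define \<Phi> where "\<Phi> l = (\<Prod>i\<in>UNIV. (\<integral>\<^sup>+x\<in>Q' l. ennreal (\<rho> i l x) \<partial>lborel) epowr \<theta> i)" for l
  have "1 \<le> \<Phi> l" if "l \<noteq> j" for l
  proof -
    have "emeasure lborel U epowr (\<Sum>i\<in>UNIV. \<theta> i) \<le>
        (\<Prod>i\<in>UNIV. (\<integral>\<^sup>+x\<in>U. ennreal (\<rho> i l x) \<partial>lborel) epowr \<theta> i)"
      by (rule emeasure_le_prod_weights) (use \<rho> U pos \<theta> one in auto)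
    then show ?thesis using that U by (simp add: \<Phi>_def Q'_def)
  qed
  then have "\<Phi> j * 1 \<le> \<Phi> j * (\<Prod>l\<in>UNIV - {j}. \<Phi> l)"
    by (intro mult_left_mono) (auto intro!: prod_ge_1)
  also have "... = (\<Prod>l\<in>UNIV. \<Phi> l)" by (simp add: prod.remove[of UNIV j])
  also have "... = (\<Prod>i\<in>UNIV. (\<Prod>j\<in>UNIV. \<integral>\<^sup>+x\<in>Q' j. ennreal (\<rho> i j x) \<partial>lborel) epowr \<theta> i)"
    unfolding \<Phi>_def epowr_prod by (rule prod.swap)
  also have "... \<le> ennreal A * (\<Prod>j\<in>UNIV. emeasure lborel (Q' j)) epowr (\<Sum>i\<in>UNIV. \<theta> i)"
    by (rule A) (use Q U in \<open>auto simp: Q'_def\<close>)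
  also have "(\<Prod>l\<in>UNIV. emeasure lborel (Q' l)) = emeasure lborel Q"
    by (subst prod.remove[of _ j]) (use U in \<open>auto simp: Q'_def intro!: prod.neutral\<close>)
  finally show ?thesis by (simp add: \<Phi>_def Q'_def)
qed

definition grid_op :: "real \<Rightarrow> ('m::finite \<Rightarrow> real^'n^'k::finite \<Rightarrow> ennreal) \<Rightarrow> real^'n^'k \<Rightarrow> ennreal" where
  "grid_op \<tau> f x = (\<Sum>\<^sup>+a. ennreal (\<Prod>j\<in>UNIV. measure lborel (grid (a j)) powr (- \<tau>)) * indicator (rect a) x *
     (\<Prod>i\<in>UNIV. \<integral>\<^sup>+y\<in>rect a. f i y \<partial>lborel))"

lemma measure_grid_pos: "0 < measure lborel (grid (a :: int \<times> ('n \<Rightarrow> int)) :: (real^'n) set)"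
  by (simp add: grid_def measure_qball)

lemma emeasure_grid: "emeasure lborel (grid a) = ennreal (measure lborel (grid a))"
  by (simp add: grid_def measure_qball emeasure_qball)

lemma prod_UNIV_option: "(\<Prod>i\<in>(UNIV :: 'm::finite option set). f i) = f None * (\<Prod>i\<in>UNIV. f (Some i))"
  by (simp add: UNIV_option_conv prod.reindex)

lemma sum_UNIV_option: "(\<Sum>i\<in>(UNIV :: 'm::finite option set). f i) = f None + (\<Sum>i\<in>UNIV. f (Some i))"
  by (simp add: UNIV_option_conv sum.reindex)

lemma borel_measurable_grid_op [measurable]:
  fixes f :: "'m::finite \<Rightarrow> real^'n^'k::finite \<Rightarrow> ennreal"
  shows "grid_op \<tau> f \<in> borel_measurable borel"
proof -
  have "(\<lambda>(x, a). ennreal (\<Prod>j\<in>UNIV. measure lborel (grid (a j)) powr (- \<tau>)) * indicator (rect a) x *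
     (\<Prod>i\<in>UNIV. \<integral>\<^sup>+y\<in>rect a. f i y \<partial>lborel))
     \<in> borel_measurable (borel \<Otimes>\<^sub>M count_space (UNIV :: ('k \<Rightarrow> int \<times> ('n \<Rightarrow> int)) set))"
    (is "case_prod ?f \<in> _")
  proof -
    have "(\<lambda>(a, x). ?f x a) \<in> borel_measurable (count_space UNIV \<Otimes>\<^sub>M borel)"
      by (rule measurable_pair_measure_countable1) (auto intro: countableI_type)
    then show ?thesis by (subst measurable_pair_swap_iff) (simp add: case_prod_beta')
  qed
  then have "(\<lambda>x. \<Sum>\<^sup>+a. ?f x a) \<in> borel_measurable borel"
    by (intro sigma_finite_measure.borel_measurable_nn_integral sigma_finite_measure_count_space)
  then show ?thesis by (simp add: grid_op_def[abs_def])
qed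

text \<open>The weight condition bounds the coefficient of a rectangle by the product of the powers
  \<open>W i\<close>, which for the indices \<open>Some i\<close> are exactly the normalisations of
  \<open>avg_op\<close>. The power \<open>W None\<close> of u is disposed of in two ways: for
  \<open>q <= 1\<close> it cancels against the integral of u over the rectangle, for
  \<open>q > 1\<close> it normalises the average of the dual function.\<close>

theorem grid_op_bound:
  fixes \<rho> :: "'m::finite option \<Rightarrow> 'k::finite \<Rightarrow> real^'n \<Rightarrow> real"
  assumes \<rho> [measurable]: "\<And>i j. \<rho> i j \<in> borel_measurable borel" and pos: "\<And>i j x. 0 < \<rho> i j x"
    and p: "\<And>i. 1 < p i" and q: "0 < q" "1 / q < (\<Sum>i\<in>UNIV. 1 / p i)"
    and \<theta>: "\<theta> None = 1 / q" "\<And>i. \<theta> (Some i) = 1 - 1 / p i"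
    and one: "\<And>j x. (\<Prod>i\<in>UNIV. \<rho> i j x powr \<theta> i) = 1"
    and A: "\<And>Q :: 'k \<Rightarrow> (real^'n) set. (\<And>j. Q j \<in> cubes) \<Longrightarrow>
      (\<Prod>i\<in>UNIV. (\<Prod>j\<in>UNIV. \<integral>\<^sup>+x\<in>Q j. ennreal (\<rho> i j x) \<partial>lborel) epowr \<theta> i)
        \<le> ennreal A * (\<Prod>j\<in>UNIV. emeasure lborel (Q j)) epowr (\<Sum>i\<in>UNIV. \<theta> i)"
  obtains C where "0 < C" "\<And>f. (\<And>i. f i \<in> borel_measurable borel) \<Longrightarrow>
    (\<integral>\<^sup>+x. grid_op (\<Sum>i\<in>UNIV. \<theta> i) f x epowr q * ennreal (\<Prod>j\<in>UNIV. \<rho> None j (x $ j)) \<partial>lborel) epowr (1 / q) \<le>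
      ennreal C * (\<Prod>i\<in>UNIV. (\<integral>\<^sup>+x. (f i x * ennreal (1 / (\<Prod>j\<in>UNIV. \<rho> (Some i) j (x $ j)))) epowr p i *
        ennreal (\<Prod>j\<in>UNIV. \<rho> (Some i) j (x $ j)) \<partial>lborel) epowr (1 / p i))"
proof -
  define \<tau> where "\<tau> = (\<Sum>i\<in>UNIV. \<theta> i)"
  have \<theta>pos: "0 < \<theta> i" for i
  proof (cases i)
    case (Some l)
    then show ?thesis using p[of l] by (simp add: \<theta>)
  qed (use q in \<open>simp add: \<theta>\<close>)
  have inf: "A_infty_measure (density lborel (\<lambda>x. ennreal (\<rho> i j x)))" for i j
  proof (rule A_infty_of_joint_condition[where \<rho> = "\<lambda>i. \<rho> i j" and \<theta> = \<theta> and A = A])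
    show "(\<Prod>i\<in>UNIV. (\<integral>\<^sup>+x\<in>Q. ennreal (\<rho> i j x) \<partial>lborel) epowr \<theta> i)
        \<le> ennreal A * emeasure lborel Q epowr (\<Sum>i\<in>UNIV. \<theta> i)" if "Q \<in> cubes" for Q
      by (rule joint_condition_single) (use \<rho> pos \<theta>pos one A that in auto)
  qed (use pos \<theta>pos one in auto)
  define V where "V i j a = measure (density lborel (\<lambda>x. ennreal (\<rho> i j x))) (grid a)" for i j a
  have Vpos: "0 < V i j (a j)" for i j and a :: "'k \<Rightarrow> int \<times> ('n \<Rightarrow> int)" unfolding V_def by (rule A_infty_measure_grid_pos[OF inf])
  have Vint: "(\<integral>\<^sup>+x\<in>grid a. ennreal (\<rho> i j x) \<partial>lborel) = ennreal (V i j a)" for i j a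
    unfolding V_def A_infty_measure_grid_pos(2)[OF inf, symmetric] by (simp add: emeasure_density)
  define R where "R i x = (\<Prod>j\<in>UNIV. \<rho> i j (x $ j))" for i x
  have Rpos: "0 < R i x" for i x unfolding R_def using pos by (intro prod_pos) auto
  have [measurable]: "R i \<in> borel_measurable borel" for i unfolding R_def by measurable
  have Rint: "(\<integral>\<^sup>+x\<in>rect a. ennreal (R i x) \<partial>lborel) = ennreal (\<Prod>j\<in>UNIV. V i j (a j))" for i a
  proof -
    have "(\<integral>\<^sup>+x\<in>rect a. ennreal (R i x) \<partial>lborel) =
        (\<integral>\<^sup>+x\<in>cube_prod (\<lambda>j. grid (a j)). (\<Prod>j\<in>UNIV. ennreal (\<rho> i j (x $ j))) \<partial>lborel)"
      using pos by (simp add: R_def rect_def prod_ennreal less_imp_le)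
    also have "... = (\<Prod>j\<in>UNIV. \<integral>\<^sup>+x\<in>grid (a j). ennreal (\<rho> i j x) \<partial>lborel)"
      by (rule nn_integral_cube_prod) auto
    finally show ?thesis using Vpos by (simp add: Vint prod_ennreal less_imp_le)
  qed
  define c where "c a = (\<Prod>j\<in>UNIV. measure lborel (grid (a j) :: (real^'n) set) powr (- \<tau>))" for a :: "'k \<Rightarrow> int \<times> ('n \<Rightarrow> int)"
  define W where "W i a = (\<Prod>j\<in>UNIV. V i j (a j) powr (- \<theta> i))" for i a
  \<comment> \<open>\<open>A\<close> may be any real number; the maximum makes the resulting
    constants positive.\<close>
  define A' where "A' = max A 1"
  have c_le: "c a \<le> A' * (\<Prod>i\<in>UNIV. W i a)" for a
  proof -
    define g where "g = (\<Prod>j\<in>UNIV. measure lborel (grid (a j) :: (real^'n) set))"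
    have g: "0 < g" unfolding g_def by (intro prod_pos measure_grid_pos)
    have cg: "c a = g powr (- \<tau>)" unfolding c_def g_def by (rule prod_powr_distrib[symmetric])
    define X where "X = (\<Prod>i\<in>UNIV. (\<Prod>j\<in>UNIV. V i j (a j)) powr \<theta> i)"
    have "ennreal X = (\<Prod>i\<in>UNIV. (\<Prod>j\<in>UNIV. \<integral>\<^sup>+x\<in>grid (a j). ennreal (\<rho> i j x) \<partial>lborel) epowr \<theta> i)"
      using Vpos by (simp add: Vint X_def prod_ennreal epowr_ennreal less_imp_le prod_nonneg)
    also have "... \<le> ennreal A * (\<Prod>j\<in>UNIV. emeasure lborel (grid (a j) :: (real^'n) set)) epowr \<tau>"
      unfolding \<tau>_def by (rule A) (rule grid_in_cubes)
    also have "... = ennreal A * ennreal (g powr \<tau>)"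
      by (simp add: emeasure_grid g_def prod_ennreal epowr_ennreal prod_nonneg)
    also have "... \<le> ennreal A' * ennreal (g powr \<tau>)" by (intro mult_right_mono ennreal_leI) (auto simp: A'_def)
    finally have X: "X \<le> A' * g powr \<tau>"
      using g by (simp add: A'_def ennreal_mult[symmetric])
    have Xpos: "0 < X"
      unfolding X_def using Vpos by (intro prod_pos) (auto simp: less_imp_neq[symmetric])
    have "(\<Prod>i\<in>UNIV. W i a) = 1 / X"
    proof -
      have "W i a = 1 / (\<Prod>j\<in>UNIV. V i j (a j)) powr \<theta> i" for i
        unfolding W_def prod_powr_distrib[symmetric] by (simp add: powr_minus_divide)
      then show ?thesis by (simp add: X_def prod_dividef)
    qed
    moreover have "g powr (- \<tau>) \<le> A' * (1 / X)"
      using X Xpos g by (simp add: powr_minus field_simps)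
    ultimately show ?thesis by (simp add: cg)
  qed
  have Wpos: "0 < W i a" for i a
    unfolding W_def using Vpos by (intro prod_pos) (auto simp: less_imp_neq[symmetric])
  define S where "S f i x = f i x * ennreal (1 / R (Some i) x)" for f :: "'m \<Rightarrow> real^'n^'k \<Rightarrow> ennreal" and i x
  have S: "S f i x * ennreal (R (Some i) x) = f i x" for f i x
  proof -
    have "ennreal (1 / R (Some i) x) * ennreal (R (Some i) x) = 1"
      using Rpos[of "Some i" x] by (simp flip: ennreal_mult)
    then show ?thesis by (simp add: S_def mult.assoc)
  qed
  have avg: "avg_op (\<rho> (Some i)) (p i) (S f i) a =
      ennreal (W (Some i) a) * (\<integral>\<^sup>+y\<in>rect a. f i y \<partial>lborel)" for f i a
    unfolding avg_op_def V_def[symmetric] R_def[symmetric] S by (simp add: W_def \<theta> mult.commute)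
  define X where "X f a = ennreal (c a) * (\<Prod>i\<in>UNIV. \<integral>\<^sup>+y\<in>rect a. f i y \<partial>lborel)"
    for f :: "'m \<Rightarrow> real^'n^'k \<Rightarrow> ennreal" and a
  have X_le: "X f a \<le> ennreal A' * ennreal (W None a) * (\<Prod>i\<in>UNIV. avg_op (\<rho> (Some i)) (p i) (S f i) a)" for f a
  proof -
    have "ennreal (c a) \<le> ennreal (A' * (W None a * (\<Prod>i\<in>UNIV. W (Some i) a)))"
      using c_le[of a] by (intro ennreal_leI) (simp add: prod_UNIV_option)
    also have "... = ennreal A' * ennreal (W None a) * (\<Prod>i\<in>UNIV. ennreal (W (Some i) a))"
      using Wpos by (simp add: A'_def ennreal_mult prod_ennreal less_imp_le prod_nonneg mult.assoc)
    finally have "X f a \<le> ennreal A' * ennreal (W None a) * (\<Prod>i\<in>UNIV. ennreal (W (Some i) a)) *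
        (\<Prod>i\<in>UNIV. \<integral>\<^sup>+y\<in>rect a. f i y \<partial>lborel)"
      unfolding X_def by (rule mult_right_mono) simp
    then show ?thesis by (simp add: avg prod.distrib mult.assoc)
  qed
  have gop: "grid_op \<tau> f x = (\<Sum>\<^sup>+a. X f a * indicator (rect a) x)" for f x
    by (simp add: grid_op_def X_def c_def mult_ac)
  have meas_S [measurable]: "S f i \<in> borel_measurable borel" if "\<And>i. f i \<in> borel_measurable borel" for f i
    using that unfolding S_def by measurable
  define D where "D f = (\<Prod>i\<in>UNIV. (\<integral>\<^sup>+x. S f i x epowr p i * ennreal (R (Some i) x) \<partial>lborel) epowr (1 / p i))" for f
  have "\<exists>C>0. \<forall>f. (\<forall>i. f i \<in> borel_measurable borel) \<longrightarrow>
    (\<integral>\<^sup>+x. grid_op \<tau> f x epowr q * ennreal (R None x) \<partial>lborel) epowr (1 / q) \<le> ennreal C * D f"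
  proof (cases "q \<le> 1")
    case True
    have eq: "1 < q * (\<Sum>i\<in>UNIV. 1 / p i)" using q by (simp add: field_simps)
    obtain C where C: "0 < C" "\<And>g. (\<And>i. g i \<in> borel_measurable borel) \<Longrightarrow>
      (\<Sum>\<^sup>+a. (\<Prod>i\<in>UNIV. avg_op (\<rho> (Some i)) (p i) (g i) a) epowr q) \<le>
      ennreal C * (\<Prod>i\<in>UNIV. (\<integral>\<^sup>+x. g i x epowr p i * ennreal (R (Some i) x) \<partial>lborel) epowr (1 / p i)) epowr q"
      unfolding R_def
      by (rule avg_op_multilinear_bound[of "\<lambda>i. \<rho> (Some i)" p q]) (use \<rho> pos inf p q eq in \<open>blast intro: less_imp_le\<close>)+
    show ?thesis
    proof (intro exI[of _ "(A' powr q * C) powr (1 / q)"] conjI allI impI)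
      show "0 < (A' powr q * C) powr (1 / q)" using C(1) by (simp add: A'_def)
      fix f :: "'m \<Rightarrow> real^'n^'k \<Rightarrow> ennreal" assume f [rule_format, measurable]: "\<forall>i. f i \<in> borel_measurable borel"
      have "(\<integral>\<^sup>+x. grid_op \<tau> f x epowr q * ennreal (R None x) \<partial>lborel) \<le>
          (\<integral>\<^sup>+x. (\<Sum>\<^sup>+a. X f a epowr q * (indicator (rect a) x * ennreal (R None x))) \<partial>lborel)"
      proof (rule nn_integral_mono)
        fix x
        have "grid_op \<tau> f x epowr q \<le> (\<Sum>\<^sup>+a. (X f a * indicator (rect a) x) epowr q)"
          unfolding gop using q True by (intro epowr_nn_integral_count_space_le)
        also have "... = (\<Sum>\<^sup>+a. X f a epowr q * indicator (rect a) x)"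
          by (intro nn_integral_cong) (simp add: indicator_def)
        finally have "grid_op \<tau> f x epowr q * ennreal (R None x) \<le>
            (\<Sum>\<^sup>+a. X f a epowr q * indicator (rect a) x) * ennreal (R None x)"
          by (rule mult_right_mono) simp
        also have "... = (\<Sum>\<^sup>+a. X f a epowr q * indicator (rect a) x * ennreal (R None x))"
          by (rule nn_integral_multc[symmetric]) simp
        finally show "grid_op \<tau> f x epowr q * ennreal (R None x) \<le>
            (\<Sum>\<^sup>+a. X f a epowr q * (indicator (rect a) x * ennreal (R None x)))"
          by (simp add: mult.assoc)
      qed
      also have "... = (\<Sum>\<^sup>+a. (\<integral>\<^sup>+x. X f a epowr q * (indicator (rect a) x * ennreal (R None x)) \<partial>lborel))"
        by (rule nn_integral_count_space_nn_integral) (auto intro: countableI_type)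
      also have "... = (\<Sum>\<^sup>+a. X f a epowr q * ennreal (\<Prod>j\<in>UNIV. V None j (a j)))"
        by (simp add: nn_integral_cmult Rint mult.commute[of "indicator _ _"])
      also have "... \<le> (\<Sum>\<^sup>+a. ennreal (A' powr q) * (\<Prod>i\<in>UNIV. avg_op (\<rho> (Some i)) (p i) (S f i) a) epowr q)"
      proof (rule nn_integral_mono)
        fix a
        \<comment> \<open>As \<open>\<theta> None = 1 / q\<close>, the q-th power of
          \<open>W None\<close> is the reciprocal of the integral of u over the rectangle.\<close>
        have WV: "W None a powr q * (\<Prod>j\<in>UNIV. V None j (a j)) = 1"
        proof -
          have "W None a powr q = (\<Prod>j\<in>UNIV. V None j (a j) powr (- 1))"
            unfolding W_def prod_powr_distrib using q by (simp add: powr_powr \<theta>)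
          then have "W None a powr q * (\<Prod>j\<in>UNIV. V None j (a j)) = (\<Prod>j\<in>UNIV. V None j (a j) powr (- 1) * V None j (a j))"
            by (simp only: prod.distrib)
          also have "... = 1"
            by (rule prod.neutral) (use Vpos[of None] in \<open>simp add: powr_minus less_imp_neq[symmetric] less_imp_le\<close>)
          finally show ?thesis .
        qed
        have "X f a epowr q * ennreal (\<Prod>j\<in>UNIV. V None j (a j)) \<le>
          (ennreal A' * ennreal (W None a) * (\<Prod>i\<in>UNIV. avg_op (\<rho> (Some i)) (p i) (S f i) a)) epowr q *
            ennreal (\<Prod>j\<in>UNIV. V None j (a j))"
          using q by (intro mult_right_mono epowr_mono X_le) auto
        also have "... = ennreal (A' powr q) * (ennreal (W None a powr q) * ennreal (\<Prod>j\<in>UNIV. V None j (a j))) *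
            (\<Prod>i\<in>UNIV. avg_op (\<rho> (Some i)) (p i) (S f i) a) epowr q"
          using Wpos[of None a] by (simp add: epowr_mult epowr_ennreal A'_def mult_ac)
        also have "ennreal (W None a powr q) * ennreal (\<Prod>j\<in>UNIV. V None j (a j)) = 1"
          using WV Vpos by (simp add: prod_nonneg less_imp_le flip: ennreal_mult)
        finally show "X f a epowr q * ennreal (\<Prod>j\<in>UNIV. V None j (a j)) \<le>
            ennreal (A' powr q) * (\<Prod>i\<in>UNIV. avg_op (\<rho> (Some i)) (p i) (S f i) a) epowr q" by simp
      qed
      also have "... = ennreal (A' powr q) * (\<Sum>\<^sup>+a. (\<Prod>i\<in>UNIV. avg_op (\<rho> (Some i)) (p i) (S f i) a) epowr q)"
        by (rule nn_integral_cmult) simp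
      also have "... \<le> ennreal (A' powr q) * (ennreal C * D f epowr q)"
        unfolding D_def by (intro mult_left_mono C meas_S f) auto
      also have "... = ennreal (A' powr q * C) * D f epowr q"
        using C(1) by (simp add: ennreal_mult mult.assoc)
      finally have "(\<integral>\<^sup>+x. grid_op \<tau> f x epowr q * ennreal (R None x) \<partial>lborel) epowr (1 / q) \<le>
          (ennreal (A' powr q * C) * D f epowr q) epowr (1 / q)"
        using q by (intro epowr_mono) auto
      also have "... = ennreal ((A' powr q * C) powr (1 / q)) * D f"
        using q C(1) by (simp add: epowr_mult epowr_epowr epowr_ennreal)
      finally show "(\<integral>\<^sup>+x. grid_op \<tau> f x epowr q * ennreal (R None x) \<partial>lborel) epowr (1 / q) \<le>
          ennreal ((A' powr q * C) powr (1 / q)) * D f" .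
    qed
  next
    case False
    then have q1: "1 < q" by simp
    \<comment> \<open>The dual function takes the slot \<open>None\<close> with the exponent
      conjugate to \<open>q\<close>. The reciprocals then add up to \<open>1 - 1 / q\<close> plus
      the sum of the \<open>1 / p i\<close>, which exceeds 1, so the power \<open>e = 1\<close> is
      admissible.\<close>
    define r where "r i = (case i of None \<Rightarrow> q / (q - 1) | Some i \<Rightarrow> p i)" for i
    have r: "r None = q / (q - 1)" "r (Some i) = p i" for i by (auto simp: r_def)
    have r1: "1 < r i" for i using p q1 by (cases i) (auto simp: r)
    have r2: "1 < 1 * (\<Sum>i\<in>UNIV. 1 / r i)"
      using q q1 by (simp add: sum_UNIV_option r diff_divide_distrib)
    obtain C where C: "0 < C" "\<And>g. (\<And>i. g i \<in> borel_measurable borel) \<Longrightarrow>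
      (\<Sum>\<^sup>+a. (\<Prod>i\<in>UNIV. avg_op (\<rho> i) (r i) (g i) a) epowr 1) \<le>
      ennreal C * (\<Prod>i\<in>UNIV. (\<integral>\<^sup>+x. g i x epowr r i * ennreal (R i x) \<partial>lborel) epowr (1 / r i)) epowr 1"
      unfolding R_def
      by (rule avg_op_multilinear_bound[of \<rho> r 1]) (use \<rho> pos inf r1 r2 zero_less_one in \<open>blast intro: less_imp_le\<close>)+
    define M where "M = density lborel (\<lambda>x. ennreal (R None x))"
    have [simp, measurable_cong]: "sets M = sets borel" by (simp add: M_def)
    interpret M: sigma_finite_measure M
      unfolding M_def by (subst sigma_finite_measure.sigma_finite_iff_density_finite[OF sigma_finite_lborel]) auto
    have Mint: "(\<integral>\<^sup>+x. F x \<partial>M) = (\<integral>\<^sup>+x. F x * ennreal (R None x) \<partial>lborel)" if "F \<in> borel_measurable borel" for F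
      using that unfolding M_def by (subst nn_integral_density) (auto simp: mult.commute)
    show ?thesis
    proof (intro exI[of _ "A' * C"] conjI allI impI)
      show "0 < A' * C" using C(1) by (simp add: A'_def)
      fix f :: "'m \<Rightarrow> real^'n^'k \<Rightarrow> ennreal" assume f [rule_format, measurable]: "\<forall>i. f i \<in> borel_measurable borel"
      have "(\<integral>\<^sup>+x. grid_op \<tau> f x epowr q \<partial>M) epowr (1 / q) \<le> ennreal (A' * C) * D f"
      proof (rule M.Lp_norm_le_by_duality[OF _ q1])
        fix h :: "real^'n^'k \<Rightarrow> ennreal" assume "h \<in> borel_measurable M"
        then have h [measurable]: "h \<in> borel_measurable borel" by simp
        define g where "g i = (case i of None \<Rightarrow> h | Some i \<Rightarrow> S f i)" for i
        have g: "g None = h" "g (Some i) = S f i" for i by (auto simp: g_def)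
        have gm: "g i \<in> borel_measurable borel" for i
          by (cases i) (auto simp: g)
        have "(\<integral>\<^sup>+x. grid_op \<tau> f x * h x \<partial>M) = (\<integral>\<^sup>+x. grid_op \<tau> f x * h x * ennreal (R None x) \<partial>lborel)"
          by (rule Mint) measurable
        also have "... = (\<integral>\<^sup>+x. (\<Sum>\<^sup>+a. X f a * (indicator (rect a) x * (h x * ennreal (R None x)))) \<partial>lborel)"
          by (rule nn_integral_cong) (simp add: gop mult.assoc flip: nn_integral_multc)
        also have "... = (\<Sum>\<^sup>+a. (\<integral>\<^sup>+x. X f a * (indicator (rect a) x * (h x * ennreal (R None x))) \<partial>lborel))"
          by (rule nn_integral_count_space_nn_integral) (auto intro: countableI_type)
        also have "... = (\<Sum>\<^sup>+a. X f a * (\<integral>\<^sup>+x. indicator (rect a) x * (h x * ennreal (R None x)) \<partial>lborel))"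
          by (intro nn_integral_cong nn_integral_cmult) measurable
        also have "... \<le> (\<Sum>\<^sup>+a. ennreal A' * (\<Prod>i\<in>UNIV. avg_op (\<rho> i) (r i) (g i) a))"
        proof (rule nn_integral_mono)
          fix a
          \<comment> \<open>The normalisation of \<open>avg_op\<close> for the conjugate exponent is
            exactly the power of u that the weight condition left over.\<close>
          have "1 / r None - 1 = - \<theta> None" using q1 by (simp add: r \<theta> diff_divide_distrib)
          then have "avg_op (\<rho> None) (r None) h a =
              ennreal (W None a) * (\<integral>\<^sup>+x. indicator (rect a) x * (h x * ennreal (R None x)) \<partial>lborel)"
            unfolding avg_op_def V_def[symmetric] R_def[symmetric] by (simp add: W_def)
          then have "(\<Prod>i\<in>UNIV. avg_op (\<rho> i) (r i) (g i) a) =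
              ennreal (W None a) * (\<integral>\<^sup>+x. indicator (rect a) x * (h x * ennreal (R None x)) \<partial>lborel) *
              (\<Prod>i\<in>UNIV. avg_op (\<rho> (Some i)) (p i) (S f i) a)"
            by (simp add: prod_UNIV_option g r(2))
          moreover have "X f a * (\<integral>\<^sup>+x. indicator (rect a) x * (h x * ennreal (R None x)) \<partial>lborel) \<le>
              ennreal A' * ennreal (W None a) * (\<Prod>i\<in>UNIV. avg_op (\<rho> (Some i)) (p i) (S f i) a) *
              (\<integral>\<^sup>+x. indicator (rect a) x * (h x * ennreal (R None x)) \<partial>lborel)"
            by (intro mult_right_mono X_le) simp
          ultimately show "X f a * (\<integral>\<^sup>+x. indicator (rect a) x * (h x * ennreal (R None x)) \<partial>lborel) \<le>
              ennreal A' * (\<Prod>i\<in>UNIV. avg_op (\<rho> i) (r i) (g i) a)"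
            by (simp only: mult_ac)
        qed
        also have "... = ennreal A' * (\<Sum>\<^sup>+a. (\<Prod>i\<in>UNIV. avg_op (\<rho> i) (r i) (g i) a) epowr 1)"
          by (simp add: nn_integral_cmult)
        also have "... \<le> ennreal A' * (ennreal C *
            (\<Prod>i\<in>UNIV. (\<integral>\<^sup>+x. g i x epowr r i * ennreal (R i x) \<partial>lborel) epowr (1 / r i)) epowr 1)"
          by (intro mult_left_mono C gm) auto
        also have "... = ennreal (A' * C) * D f *
            (\<integral>\<^sup>+x. h x epowr (q / (q - 1)) * ennreal (R None x) \<partial>lborel) epowr (1 / (q / (q - 1)))"
          using C(1) by (simp add: prod_UNIV_option r g D_def ennreal_mult A'_def mult_ac)
        also have "1 / (q / (q - 1)) = 1 - 1 / q" using q1 by (simp add: diff_divide_distrib)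
        also have "(\<integral>\<^sup>+x. h x epowr (q / (q - 1)) * ennreal (R None x) \<partial>lborel) = (\<integral>\<^sup>+x. h x epowr (q / (q - 1)) \<partial>M)"
          by (rule Mint[symmetric]) measurable
        finally show "(\<integral>\<^sup>+x. grid_op \<tau> f x * h x \<partial>M) \<le> ennreal (A' * C) * D f *
            (\<integral>\<^sup>+x. h x epowr (q / (q - 1)) \<partial>M) epowr (1 - 1 / q)" .
      qed measurable
      then show "(\<integral>\<^sup>+x. grid_op \<tau> f x epowr q * ennreal (R None x) \<partial>lborel) epowr (1 / q) \<le> ennreal (A' * C) * D f"
        by (subst (asm) Mint) auto
    qed
  qed
  then obtain C where C0: "0 < C" and C: "\<forall>f. (\<forall>i. f i \<in> borel_measurable borel) \<longrightarrow>
    (\<integral>\<^sup>+x. grid_op \<tau> f x epowr q * ennreal (R None x) \<partial>lborel) epowr (1 / q) \<le> ennreal C * D f"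
    by (elim exE conjE)
  show thesis
    by (rule that[OF C0]) (use C in \<open>simp only: D_def S_def R_def \<tau>_def simp_thms\<close>)
qed

section \<open>Comparison of the potential kernel with the grid\<close>

text \<open>The potential of nonnegative functions with values in [0,\<infinity>], for which
  convergence is no issue. Where a factor of the kernel has a zero denominator its value is
  \<open>1 / 0 = 0\<close>; this concerns only a null set of \<open>y\<close>.\<close>

definition riesz_pos :: "real \<Rightarrow> ('m::finite \<Rightarrow> real^'n^'k::finite \<Rightarrow> ennreal) \<Rightarrow> real^'n^'k \<Rightarrow> ennreal" where
  "riesz_pos \<beta> f x = (\<integral>\<^sup>+y. (\<Prod>i\<in>UNIV. f i (y $ i)) *
     ennreal (1 / (\<Prod>s\<in>UNIV. (\<Sum>i\<in>UNIV. norm (x $ s - y $ i $ s)) powr \<beta>)) \<partial>(lborel :: (real^'n^'k^'m) measure))"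

text \<open>One term of the sum suffices. With \<open>s\<close> the power of two in
  \<open>[d, 2 * d)\<close> and the centre obtained by rounding \<open>x\<close> down,
  \<open>x\<close> is within \<open>s\<close> of the centre in every coordinate and each
  \<open>y i\<close> within \<open>s + d <= 2 * s\<close>. The cube has side
  \<open>4 * s < 8 * d\<close>, whence the constant. For \<open>d = 0\<close> the left side is
  \<open>1 / 0 = 0\<close>.\<close>

lemma kernel_le_grid_sum:
  fixes x :: "real^'n" and y :: "'m::finite \<Rightarrow> real^'n" and \<tau> :: real
  assumes \<tau>: "0 < \<tau>"
  shows "ennreal (1 / (\<Sum>i\<in>UNIV. norm (x - y i)) powr (CARD('n) * \<tau>)) \<le>
    ennreal (8 powr (CARD('n) * \<tau>)) * (\<Sum>\<^sup>+a. ennreal (measure lborel (grid a :: (real^'n) set) powr (- \<tau>)) *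
      (indicator (grid a) x * (\<Prod>i\<in>UNIV. indicator (grid a) (y i))))"
proof -
  define d where "d = (\<Sum>i\<in>UNIV. norm (x - y i))"
  have "0 \<le> d" by (simp add: d_def sum_nonneg)
  then consider "d = 0" | "0 < d" by linarith
  then show ?thesis
  proof cases
    case 1
    then show ?thesis using \<tau> by (simp add: d_def[symmetric])
  next
    case 2
    define l where "l = \<lceil>log 2 d\<rceil>"
    define s where "s = 2 powr real_of_int l"
    have s: "0 < s" by (simp add: s_def)
    have "log 2 d \<le> l" "l - 1 < log 2 d" unfolding l_def by linarith+
    then have ds: "d \<le> s" "s < 2 * d"
      using 2 by (simp_all add: s_def log_le_iff less_log_iff powr_diff)
    define v where "v c = \<lfloor>x $ c / s\<rfloor>" for c
    have x: "\<bar>x $ c - s * v c\<bar> \<le> s" for c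
    proof -
      have "v c \<le> x $ c / s" "x $ c / s \<le> v c + 1" unfolding v_def by linarith+
      then show ?thesis using s by (simp add: field_simps abs_le_iff)
    qed
    define a where "a = (l, v)"
    have gr: "grid a = qball (\<chi> c. s * v c) (2 * s)" by (simp add: grid_def a_def s_def)
    have xg: "x \<in> grid a" unfolding gr qball_def 
    proof safe
      fix c show "\<bar>x $ c - (\<chi> c. s * v c) $ c\<bar> \<le> 2 * s" using x[of c] s by simp
    qed
    have yg: "y i \<in> grid a" for i
      unfolding gr qball_def
    proof safe
      fix c
      have "\<bar>y i $ c - x $ c\<bar> \<le> norm (x - y i)"
        using component_le_norm_cart[of "x - y i" c] by (simp add: abs_minus_commute)
      also have "... \<le> d" unfolding d_def by (rule member_le_sum) auto
      finally show "\<bar>y i $ c - (\<chi> c. s * v c) $ c\<bar> \<le> 2 * s" using x[of c] ds by simp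
    qed
    have m: "measure lborel (grid a) = (4 * s) ^ CARD('n)" using s by (simp add: gr measure_qball)
    have "1 / d powr (CARD('n) * \<tau>) = 8 powr (CARD('n) * \<tau>) * (8 * d) powr (- (CARD('n) * \<tau>))"
      using 2 by (simp add: powr_mult powr_minus_divide)
    also have "... \<le> 8 powr (CARD('n) * \<tau>) * (4 * s) powr (- (CARD('n) * \<tau>))"
      using ds s \<tau> by (intro mult_left_mono powr_mono2') auto
    also have "(4 * s) powr (- (CARD('n) * \<tau>)) = measure lborel (grid a) powr (- \<tau>)"
      using s unfolding m by (subst powr_realpow[symmetric]) (auto simp: powr_powr)
    finally have "ennreal (1 / d powr (CARD('n) * \<tau>)) \<le>
        ennreal (8 powr (CARD('n) * \<tau>)) * ennreal (measure lborel (grid a) powr (- \<tau>))"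
      by (simp add: ennreal_leI flip: ennreal_mult)
    also have "ennreal (measure lborel (grid a) powr (- \<tau>)) \<le>
        (\<Sum>\<^sup>+a. ennreal (measure lborel (grid a :: (real^'n) set) powr (- \<tau>)) *
          (indicator (grid a) x * (\<Prod>i\<in>UNIV. indicator (grid a) (y i))))"
      using nn_integral_ge_point[of a UNIV "\<lambda>a. ennreal (measure lborel (grid a :: (real^'n) set) powr (- \<tau>)) *
          (indicator (grid a) x * (\<Prod>i\<in>UNIV. indicator (grid a) (y i)))"] xg yg by simp
    finally show ?thesis by (simp add: d_def mult_left_mono)
  qed
qed

text \<open>The kernel bound is multiplied over the k factors; a product of sums over the grid is a
  sum over tuples of grid cubes, that is over rectangles. For each rectangle the indicators separate
  the \<open>y $ i\<close>, and the integral splits into the m integrals of the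
  \<open>f i\<close>.\<close>

theorem riesz_pos_le_grid_op:
  fixes f :: "'m::finite \<Rightarrow> real^'n^'k::finite \<Rightarrow> ennreal" and \<tau> :: real
  assumes f [measurable]: "\<And>i. f i \<in> borel_measurable borel" and \<tau>: "0 < \<tau>"
  shows "riesz_pos (CARD('n) * \<tau>) f x \<le> ennreal ((8 powr (CARD('n) * \<tau>)) ^ CARD('k)) * grid_op \<tau> f x"
proof -
  interpret A: product_sigma_finite "\<lambda>_::'k. count_space (UNIV :: (int \<times> ('n \<Rightarrow> int)) set)"
    by (rule product_sigma_finite_count_space)
  define \<beta> where "\<beta> = CARD('n) * \<tau>"
  define K where "K = ennreal ((8 powr \<beta>) ^ CARD('k))"
  define c where "c a = ennreal (\<Prod>j\<in>UNIV. measure lborel (grid (a j) :: (real^'n) set) powr (- \<tau>))"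
    for a :: "'k \<Rightarrow> int \<times> ('n \<Rightarrow> int)"
  have ker: "ennreal (1 / (\<Prod>s\<in>UNIV. (\<Sum>i\<in>UNIV. norm (x $ s - y $ i $ s)) powr \<beta>)) \<le>
      K * (\<Sum>\<^sup>+a. c a * indicator (rect a) x * (\<Prod>i\<in>UNIV. indicator (rect a) (y $ i)))"
    for y :: "real^'n^'k^'m"
  proof -
    define h :: "'k \<Rightarrow> int \<times> ('n \<Rightarrow> int) \<Rightarrow> ennreal" where "h s b = ennreal (measure lborel (grid b :: (real^'n) set) powr (- \<tau>)) *
      (indicator (grid b) (x $ s) * (\<Prod>i\<in>UNIV. indicator (grid b) (y $ i $ s)))" for s b
    have "ennreal (1 / (\<Prod>s\<in>UNIV. (\<Sum>i\<in>UNIV. norm (x $ s - y $ i $ s)) powr \<beta>)) =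
        (\<Prod>s\<in>UNIV. ennreal (1 / (\<Sum>i\<in>UNIV. norm (x $ s - y $ i $ s)) powr \<beta>))"
      by (simp add: prod_ennreal prod_dividef)
    also have "... \<le> (\<Prod>s\<in>UNIV. ennreal (8 powr \<beta>) * (\<Sum>\<^sup>+b. h s b))"
      unfolding \<beta>_def h_def by (intro prod_mono_ennreal kernel_le_grid_sum \<tau>)
    also have "... = K * (\<Prod>s\<in>UNIV. \<Sum>\<^sup>+b. h s b)"
      by (simp add: prod.distrib K_def ennreal_power)
    also have "(\<Prod>s\<in>UNIV. \<Sum>\<^sup>+b. h s b) = (\<integral>\<^sup>+a. (\<Prod>s\<in>UNIV. h s (a s)) \<partial>PiM UNIV (\<lambda>_. count_space UNIV))"
      by (rule A.product_nn_integral_prod[symmetric]) auto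
    also have "... = (\<Sum>\<^sup>+a. (\<Prod>s\<in>UNIV. h s (a s)))"
      by (simp only: PiM_count_space_eq)
    also have "... = (\<Sum>\<^sup>+a. c a * indicator (rect a) x * (\<Prod>i\<in>UNIV. indicator (rect a) (y $ i)))"
    proof (rule nn_integral_cong)
      fix a :: "'k \<Rightarrow> int \<times> ('n \<Rightarrow> int)"
      have "(\<Prod>s\<in>UNIV. \<Prod>i\<in>UNIV. indicator (grid (a s)) (y $ i $ s) :: ennreal) =
          (\<Prod>i\<in>UNIV. \<Prod>s\<in>UNIV. indicator (grid (a s)) (y $ i $ s))"
        by (rule prod.swap)
      then show "(\<Prod>s\<in>UNIV. h s (a s)) = c a * indicator (rect a) x * (\<Prod>i\<in>UNIV. indicator (rect a) (y $ i))"
        by (simp add: h_def prod.distrib c_def rect_def indicator_cube_prod prod_ennreal mult.assoc)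
    qed
    finally show ?thesis .
  qed
  have "riesz_pos \<beta> f x \<le> (\<integral>\<^sup>+y. (\<Prod>i\<in>UNIV. f i (y $ i)) *
      (K * (\<Sum>\<^sup>+a. c a * indicator (rect a) x * (\<Prod>i\<in>UNIV. indicator (rect a) (y $ i)))) \<partial>lborel)"
    unfolding riesz_pos_def by (intro nn_integral_mono mult_left_mono ker) simp
  also have "... = (\<integral>\<^sup>+y. (\<Sum>\<^sup>+a. K * (c a * indicator (rect a) x * (\<Prod>i\<in>UNIV. f i (y $ i) * indicator (rect a) (y $ i)))) \<partial>lborel)"
  proof (rule nn_integral_cong)
    fix y :: "real^'n^'k^'m"
    have "(\<Prod>i\<in>UNIV. f i (y $ i)) *
        (K * (\<Sum>\<^sup>+a. c a * indicator (rect a) x * (\<Prod>i\<in>UNIV. indicator (rect a) (y $ i)))) =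
      (\<Prod>i\<in>UNIV. f i (y $ i)) * K *
        (\<Sum>\<^sup>+a. c a * indicator (rect a) x * (\<Prod>i\<in>UNIV. indicator (rect a) (y $ i)))"
      by (simp add: mult.assoc)
    also have "... = (\<Sum>\<^sup>+a. (\<Prod>i\<in>UNIV. f i (y $ i)) * K * (c a * indicator (rect a) x *
        (\<Prod>i\<in>UNIV. indicator (rect a) (y $ i))))"
      by (rule nn_integral_cmult[symmetric]) simp
    also have "... = (\<Sum>\<^sup>+a. K * (c a * indicator (rect a) x * (\<Prod>i\<in>UNIV. f i (y $ i) * indicator (rect a) (y $ i))))"
      by (intro nn_integral_cong) (simp add: prod.distrib mult_ac)
    finally show "(\<Prod>i\<in>UNIV. f i (y $ i)) *
        (K * (\<Sum>\<^sup>+a. c a * indicator (rect a) x * (\<Prod>i\<in>UNIV. indicator (rect a) (y $ i)))) =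
      (\<Sum>\<^sup>+a. K * (c a * indicator (rect a) x * (\<Prod>i\<in>UNIV. f i (y $ i) * indicator (rect a) (y $ i))))" .
  qed
  also have "... = (\<Sum>\<^sup>+a. (\<integral>\<^sup>+y. K * (c a * indicator (rect a) x * (\<Prod>i\<in>UNIV. f i (y $ i) * indicator (rect a) (y $ i)))
      \<partial>(lborel :: (real^'n^'k^'m) measure)))"
    by (rule nn_integral_count_space_nn_integral) (auto intro: countableI_type)
  also have "... = (\<Sum>\<^sup>+a. K * (c a * indicator (rect a) x *
      (\<Prod>i\<in>UNIV. \<integral>\<^sup>+y\<in>rect a. f i y \<partial>lborel)))"
  proof (rule nn_integral_cong)
    fix a :: "'k \<Rightarrow> int \<times> ('n \<Rightarrow> int)"
    have "(\<integral>\<^sup>+y. (\<Prod>i\<in>UNIV. f i (y $ i) * indicator (rect a) (y $ i)) \<partial>(lborel :: (real^'n^'k^'m) measure)) =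
        (\<Prod>i\<in>UNIV. \<integral>\<^sup>+y\<in>rect a. f i y \<partial>lborel)"
      by (rule nn_integral_lborel_vec_prod) measurable
    then show "(\<integral>\<^sup>+y. K * (c a * indicator (rect a) x * (\<Prod>i\<in>UNIV. f i (y $ i) * indicator (rect a) (y $ i)))
        \<partial>(lborel :: (real^'n^'k^'m) measure)) =
      K * (c a * indicator (rect a) x * (\<Prod>i\<in>UNIV. \<integral>\<^sup>+y\<in>rect a. f i y \<partial>lborel))"
      by (simp add: nn_integral_cmult)
  qed
  also have "... = K * grid_op \<tau> f x"
    unfolding grid_op_def c_def by (rule nn_integral_cmult) simp
  finally show ?thesis by (simp add: K_def \<beta>_def)
qed

lemma AE_lborel_vec_ne: "AE y in (lborel :: (real^'n^'k::finite^'m::finite) measure). y $ i $ s \<noteq> x"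
proof -
  have "AE z in (lborel :: (real^'n) measure). z \<noteq> x" by (rule AE_lborel_singleton)
  from AE_lborel_vec_nth[OF this, of s] have "AE z in (lborel :: (real^'n^'k) measure). z $ s \<noteq> x" .
  from AE_lborel_vec_nth[OF this, of i] show ?thesis .
qed

lemma cubeE:
  fixes Q :: "(real^'n) set"
  assumes "Q \<in> cubes"
  obtains l where "0 < l" "measure lborel Q = l ^ CARD('n)" "emeasure lborel Q = ennreal (l ^ CARD('n))"
    "Q \<in> sets borel" "\<And>x y c. x \<in> Q \<Longrightarrow> y \<in> Q \<Longrightarrow> \<bar>x $ c - y $ c\<bar> \<le> l"
proof -
  from assms obtain a b l where l: "0 < l" "\<And>i. b $ i - a $ i = l" "Q = cbox a b"
    by (auto simp: cubes_def)
  have ne: "cbox a b \<noteq> {}" using l by (auto simp: interval_ne_empty_cart) (smt (verit))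
  have m: "measure lborel Q = l ^ CARD('n)" using ne by (simp add: l content_cbox_cart)
  moreover have "emeasure lborel Q = ennreal (l ^ CARD('n))"
    using emeasure_eq_ennreal_measure[of lborel Q] m by (simp add: l emeasure_lborel_cbox_eq)
  moreover have "\<bar>x $ c - y $ c\<bar> \<le> l" if "x \<in> Q" "y \<in> Q" for x y c
  proof -
    have "a $ c \<le> x $ c" "x $ c \<le> b $ c" "a $ c \<le> y $ c" "y $ c \<le> b $ c"
      using that by (auto simp: l(3) mem_box_cart)
    then show ?thesis using l(2)[of c] by linarith
  qed
  moreover have "Q \<in> sets borel" by (simp add: l)
  ultimately show thesis using that[OF l(1)] by blast
qed

text \<open>For points of a cube of side \<open>l\<close> the l1 norm bounds each distance by
  \<open>n * l\<close>, hence the sum of the m distances by \<open>m * n * l\<close>; this is the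
  constant \<open>M\<close>. The estimate serves twice: it places the maximal operator below the
  potential, and it is the lower bound for the potential in the proof of necessity.\<close>

theorem riesz_pos_ge:
  fixes f :: "'m::finite \<Rightarrow> real^'n^'k::finite \<Rightarrow> ennreal" and Q :: "'k \<Rightarrow> (real^'n) set" and \<tau> :: real
  assumes f [measurable]: "\<And>i. f i \<in> borel_measurable borel" and \<tau>: "0 < \<tau>"
    and Q: "\<And>j. Q j \<in> cubes" and x: "x \<in> cube_prod Q"
  shows "ennreal (\<Prod>j\<in>UNIV. measure lborel (Q j) powr (- \<tau>)) *
      (\<Prod>i\<in>UNIV. \<integral>\<^sup>+y\<in>cube_prod Q. f i y \<partial>lborel)
    \<le> ennreal ((real (CARD('m) * CARD('n)) powr (CARD('n) * \<tau>)) ^ CARD('k)) * riesz_pos (CARD('n) * \<tau>) f x"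
proof -
  define \<beta> where "\<beta> = CARD('n) * \<tau>"
  have \<beta>: "0 < \<beta>" using \<tau> by (simp add: \<beta>_def)
  define M where "M = real (CARD('m) * CARD('n))"
  have M: "0 < M" by (simp add: M_def)
  have [measurable]: "cube_prod Q \<in> sets borel"
    by (rule cube_prod_borel) (use Q in \<open>auto elim!: cubeE\<close>)
  define c where "c = (\<Prod>j\<in>UNIV. measure lborel (Q j) powr (- \<tau>))"
  have c: "0 \<le> c" by (simp add: c_def prod_nonneg)
  have ker: "c \<le> (M powr \<beta>) ^ CARD('k) * (1 / (\<Prod>s\<in>UNIV. (\<Sum>i\<in>UNIV. norm (x $ s - y $ i $ s)) powr \<beta>))"
    if y: "\<And>i. y $ i \<in> cube_prod Q" and ne: "\<And>i s. y $ i $ s \<noteq> x $ s" for y :: "real^'n^'k^'m"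
  proof -
    have "measure lborel (Q s) powr (- \<tau>) \<le> M powr \<beta> * (1 / (\<Sum>i\<in>UNIV. norm (x $ s - y $ i $ s)) powr \<beta>)" for s
    proof -
      obtain l where l: "0 < l" "measure lborel (Q s) = l ^ CARD('n)"
          "\<And>x y c. x \<in> Q s \<Longrightarrow> y \<in> Q s \<Longrightarrow> \<bar>x $ c - y $ c\<bar> \<le> l"
        using cubeE[OF Q[of s]] by metis
      define d where "d = (\<Sum>i\<in>UNIV. norm (x $ s - y $ i $ s))"
      have d: "0 < d" unfolding d_def
        using ne[of _ s] by (intro sum_pos) (auto simp: eq_commute[of "x $ s"])
      have "norm (x $ s - y $ i $ s) \<le> CARD('n) * l" for i
      proof -
        have "norm (x $ s - y $ i $ s) \<le> (\<Sum>c\<in>UNIV. \<bar>(x $ s - y $ i $ s) $ c\<bar>)" by (rule norm_le_l1_cart)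
        also have "... \<le> (\<Sum>c\<in>(UNIV :: 'n set). l)"
          using x y[of i] by (intro sum_mono) (auto simp: cube_prod_def intro: l(3))
        finally show ?thesis by simp
      qed
      then have "d \<le> (\<Sum>i\<in>(UNIV :: 'm set). CARD('n) * l)" unfolding d_def by (rule sum_mono)
      then have "d \<le> M * l" by (simp add: M_def mult.assoc)
      then have "(M * l) powr (- \<beta>) \<le> d powr (- \<beta>)" using d \<beta> by (intro powr_mono2') auto
      moreover have "measure lborel (Q s) powr (- \<tau>) = M powr \<beta> * (M * l) powr (- \<beta>)"
        using l(1,2) M by (simp add: powr_mult powr_minus_divide \<beta>_def powr_powr flip: powr_realpow)
      ultimately have "measure lborel (Q s) powr (- \<tau>) \<le> M powr \<beta> * d powr (- \<beta>)"
        by (simp add: mult_left_mono)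
      then show ?thesis by (simp add: d_def powr_minus_divide)
    qed
    then have "c \<le> (\<Prod>s\<in>UNIV. M powr \<beta> * (1 / (\<Sum>i\<in>UNIV. norm (x $ s - y $ i $ s)) powr \<beta>))"
      unfolding c_def by (intro prod_mono) auto
    then show ?thesis by (simp add: prod.distrib prod_dividef)
  qed
  \<comment> \<open>if all \<open>y $ i $ s\<close> equal \<open>x $ s\<close>, the kernel is \<open>1 / 0 = 0\<close>, so the bound holds only almost everywhere\<close>
  have ae: "AE y in (lborel :: (real^'n^'k^'m) measure). \<forall>i s. y $ i $ s \<noteq> x $ s"
    by (simp add: AE_all_countable AE_lborel_vec_ne)
  have "ennreal c * (\<Prod>i\<in>UNIV. \<integral>\<^sup>+y\<in>cube_prod Q. f i y \<partial>lborel) =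
      ennreal c * (\<integral>\<^sup>+y. (\<Prod>i\<in>UNIV. f i (y $ i) * indicator (cube_prod Q) (y $ i)) \<partial>(lborel :: (real^'n^'k^'m) measure))"
    by (subst nn_integral_lborel_vec_prod) auto
  also have "... = (\<integral>\<^sup>+y. ennreal c * (\<Prod>i\<in>UNIV. f i (y $ i) * indicator (cube_prod Q) (y $ i)) \<partial>(lborel :: (real^'n^'k^'m) measure))"
    by (rule nn_integral_cmult[symmetric]) measurable
  also have "... \<le> (\<integral>\<^sup>+y. ennreal ((M powr \<beta>) ^ CARD('k)) * ((\<Prod>i\<in>UNIV. f i (y $ i)) *
     ennreal (1 / (\<Prod>s\<in>UNIV. (\<Sum>i\<in>UNIV. norm (x $ s - y $ i $ s)) powr \<beta>))) \<partial>(lborel :: (real^'n^'k^'m) measure))"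
    using ae
  proof (intro nn_integral_mono_AE, eventually_elim)
    case (elim y)
    show ?case
    proof (cases "\<forall>i. y $ i \<in> cube_prod Q")
      case True
      then have "ennreal c \<le> ennreal ((M powr \<beta>) ^ CARD('k) * (1 / (\<Prod>s\<in>UNIV. (\<Sum>i\<in>UNIV. norm (x $ s - y $ i $ s)) powr \<beta>)))"
        using elim by (intro ennreal_leI ker) auto
      also have "... = ennreal ((M powr \<beta>) ^ CARD('k)) * ennreal (1 / (\<Prod>s\<in>UNIV. (\<Sum>i\<in>UNIV. norm (x $ s - y $ i $ s)) powr \<beta>))"
        by (intro ennreal_mult) (auto simp: prod_nonneg)
      finally have "ennreal c * (\<Prod>i\<in>UNIV. f i (y $ i)) \<le> ennreal ((M powr \<beta>) ^ CARD('k)) *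
          ennreal (1 / (\<Prod>s\<in>UNIV. (\<Sum>i\<in>UNIV. norm (x $ s - y $ i $ s)) powr \<beta>)) * (\<Prod>i\<in>UNIV. f i (y $ i))"
        by (rule mult_right_mono) simp
      then show ?thesis using True by (simp add: mult_ac)
    next
      case False
      then have "(\<Prod>i\<in>UNIV. f i (y $ i) * indicator (cube_prod Q) (y $ i)) = 0"
        by (auto simp: prod_zero_iff indicator_def)
      then show ?thesis by (simp only: mult_zero_right zero_le)
    qed
  qed
  also have "... = ennreal ((M powr \<beta>) ^ CARD('k)) * riesz_pos \<beta> f x"
    unfolding riesz_pos_def by (rule nn_integral_cmult) measurable
  finally show ?thesis by (simp add: c_def M_def \<beta>_def)
qed

section \<open>The operators of the theorem and Borel product weights\<close>

text \<open>Composition with a Borel map need not preserve Lebesgue measurability; here it does,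
  because the preimage of a null set under a coordinate projection is null.\<close>

lemma measurable_vec_nth_lebesgue:
  "(\<lambda>y::'a::euclidean_space^'m::finite. y $ i) \<in> lebesgue \<rightarrow>\<^sub>M lebesgue"
proof (rule completion.measurable_completion2)
  show meas: "(\<lambda>y::'a^'m. y $ i) \<in> lebesgue \<rightarrow>\<^sub>M lborel"
    by (intro measurable_completion) simp
  show "null_sets lborel \<subseteq> null_sets (distr lebesgue lborel (\<lambda>y::'a^'m. y $ i))"
  proof
    fix N :: "'a set" assume N: "N \<in> null_sets lborel"
    have "AE z in lborel. z \<notin> N" by (rule AE_not_in[OF N])
    from AE_lborel_vec_nth[OF this, of i] have ae: "AE y in (lborel :: ('a^'m) measure). y $ i \<notin> N" .
    have [measurable]: "N \<in> sets borel" using N by auto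
    have "emeasure (lborel :: ('a^'m) measure) {y. y $ i \<in> N} = 0"
      using ae by (subst (asm) AE_iff_measurable[OF _ refl]) auto
    then have "emeasure (distr lebesgue lborel (\<lambda>y::'a^'m. y $ i)) N = 0"
      using meas by (simp add: emeasure_distr vimage_def)
    then show "N \<in> null_sets (distr lebesgue lborel (\<lambda>y::'a^'m. y $ i))" by auto
  qed
qed

lemma riesz_integrand_measurable:
  fixes f :: "'m::finite \<Rightarrow> real^'n^'k::finite \<Rightarrow> complex"
  assumes f: "\<And>i. f i \<in> borel_measurable lebesgue"
  shows "riesz_integrand \<alpha> f x \<in> borel_measurable lebesgue"
proof -
  have [measurable]: "(\<lambda>y::real^'n^'k^'m. f i (y $ i)) \<in> borel_measurable lebesgue" for i
    using measurable_compose[OF measurable_vec_nth_lebesgue f] .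
  have [measurable]: "(\<lambda>y::real^'n^'k^'m. y $ i $ s) \<in> lebesgue \<rightarrow>\<^sub>M borel" for i s
    by (rule measurable_completion) simp
  show ?thesis unfolding riesz_integrand_def[abs_def] by measurable
qed

lemma nn_integral_norm_riesz_integrand:
  fixes f :: "'m::finite \<Rightarrow> real^'n^'k::finite \<Rightarrow> complex"
  assumes h: "\<And>i. AE x in lborel. ennreal (norm (f i x)) = h i x"
  shows "(\<integral>\<^sup>+y. ennreal (norm (riesz_integrand (\<lambda>_. \<alpha>) f x y)) \<partial>lebesgue) =
    riesz_pos (real CARD('m) * real CARD('n) - \<alpha>) h x"
proof -
  have ae: "AE y in (lborel :: (real^'n^'k^'m) measure). \<forall>i. ennreal (norm (f i (y $ i))) = h i (y $ i)"
    by (subst AE_all_countable) (intro allI AE_lborel_vec_nth h)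
  show ?thesis
    unfolding nn_integral_completion riesz_pos_def
  proof (rule nn_integral_cong_AE, use ae in eventually_elim)
    case (elim y)
    have "norm (riesz_integrand (\<lambda>_. \<alpha>) f x y) = (\<Prod>i\<in>UNIV. norm (f i (y $ i))) *
        (1 / (\<Prod>s\<in>UNIV. (\<Sum>i\<in>UNIV. norm (x $ s - y $ i $ s)) powr (real CARD('m) * real CARD('n) - \<alpha>)))"
      by (simp add: riesz_integrand_def norm_divide prod_norm[symmetric] abs_prod prod_nonneg)
    then have "ennreal (norm (riesz_integrand (\<lambda>_. \<alpha>) f x y)) = ennreal (\<Prod>i\<in>UNIV. norm (f i (y $ i))) *
        ennreal (1 / (\<Prod>s\<in>UNIV. (\<Sum>i\<in>UNIV. norm (x $ s - y $ i $ s)) powr (real CARD('m) * real CARD('n) - \<alpha>)))"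
      by (simp only: ennreal_mult prod_nonneg norm_ge_zero powr_ge_zero zero_le_divide_1_iff)
    then show ?case
      using elim by (simp only: prod_ennreal[symmetric] norm_ge_zero)
  qed
qed

text \<open>Where the integral does not converge absolutely both sides are infinite, since
  \<open>riesz_pos\<close> is the integral of the norm of the integrand.\<close>

lemma riesz_prod_abs_le:
  fixes f :: "'m::finite \<Rightarrow> real^'n^'k::finite \<Rightarrow> complex"
  assumes f: "\<And>i. f i \<in> borel_measurable lebesgue"
    and h: "\<And>i. AE x in lborel. ennreal (norm (f i x)) = h i x"
  shows "riesz_prod_abs (\<lambda>_. \<alpha>) f x \<le> riesz_pos (real CARD('m) * real CARD('n) - \<alpha>) h x"
proof (cases "integrable lebesgue (riesz_integrand (\<lambda>_. \<alpha>) f x)")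
  case True
  then show ?thesis
    unfolding riesz_prod_abs_def riesz_prod_def nn_integral_norm_riesz_integrand[OF h, symmetric]
    by (simp add: integral_norm_bound_ennreal)
next
  case False
  then have "(\<integral>\<^sup>+y. ennreal (norm (riesz_integrand (\<lambda>_. \<alpha>) f x y)) \<partial>lebesgue) = \<infinity>"
    using riesz_integrand_measurable[of f, OF f] less_top by (auto simp: integrable_iff_bounded)
  then show ?thesis by (simp add: nn_integral_norm_riesz_integrand[OF h])
qed

text \<open>For nonnegative functions the complex integrand equals its own norm, so nothing cancels
  in the integral.\<close>

lemma riesz_prod_abs_ge:
  fixes \<phi> :: "'m::finite \<Rightarrow> real^'n^'k::finite \<Rightarrow> real"
  assumes \<phi>: "\<And>i x. 0 \<le> \<phi> i x"
  shows "riesz_pos (real CARD('m) * real CARD('n) - \<alpha>) (\<lambda>i x. ennreal (\<phi> i x)) x \<le>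
    riesz_prod_abs (\<lambda>_. \<alpha>) (\<lambda>i x. complex_of_real (\<phi> i x)) x"
proof (cases "integrable lebesgue (riesz_integrand (\<lambda>_. \<alpha>) (\<lambda>i x. complex_of_real (\<phi> i x)) x)")
  case True
  let ?I = "riesz_integrand (\<lambda>_. \<alpha>) (\<lambda>i x. complex_of_real (\<phi> i x)) x"
  have I: "?I y = complex_of_real (norm (?I y))" for y
    using \<phi> by (simp add: riesz_integrand_def norm_divide prod_norm[symmetric] abs_prod prod_nonneg)
  have "riesz_pos (real CARD('m) * real CARD('n) - \<alpha>) (\<lambda>i x. ennreal (\<phi> i x)) x =
      (\<integral>\<^sup>+y. ennreal (norm (?I y)) \<partial>lebesgue)"
    by (rule nn_integral_norm_riesz_integrand[symmetric]) (use \<phi> in simp)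
  also have "... = ennreal (\<integral>y. norm (?I y) \<partial>lebesgue)"
    by (rule nn_integral_eq_integral) (use True in auto)
  also have "(\<integral>y. norm (?I y) \<partial>lebesgue) = norm (complex_of_real (\<integral>y. norm (?I y) \<partial>lebesgue))"
    by (simp add: integral_nonneg_AE)
  also have "complex_of_real (\<integral>y. norm (?I y) \<partial>lebesgue) = (\<integral>y. complex_of_real (norm (?I y)) \<partial>lebesgue)"
    by (rule integral_complex_of_real[symmetric])
  also have "... = (\<integral>y. ?I y \<partial>lebesgue)" using I by simp
  finally show ?thesis using True by (simp add: riesz_prod_abs_def riesz_prod_def)
qed (simp add: riesz_prod_abs_def)

section \<open>Bounds shared by both operators\<close>

lemma measure_lebesgue_cube: "Q \<in> cubes \<Longrightarrow> measure lebesgue Q = measure lborel Q"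
  by (elim cubeE) (simp add: measure_completion)

lemma prod_powr_measure_cubes:
  fixes Q :: "'k::finite \<Rightarrow> (real^'n) set"
  assumes "\<And>j. Q j \<in> cubes"
  shows "1 / (\<Prod>j\<in>UNIV. measure lebesgue (Q j) powr t) = (\<Prod>j\<in>UNIV. measure lborel (Q j) powr (- t))"
  using assms by (simp add: measure_lebesgue_cube powr_minus_divide prod_dividef)

lemma cube_prod_of_cubes_borel:
  fixes Q :: "'k::finite \<Rightarrow> (real^'n) set"
  assumes "\<And>j. Q j \<in> cubes"
  shows "cube_prod Q \<in> sets borel"
  by (rule cube_prod_borel) (use assms in \<open>auto elim!: cubeE\<close>)

lemma strong_frac_maximal_le:
  fixes f :: "'m::finite \<Rightarrow> real^'n^'k::finite \<Rightarrow> complex" and \<alpha> \<tau> :: real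
  assumes h: "\<And>i. AE x in lborel. ennreal (norm (f i x)) = h i x" "\<And>i. h i \<in> borel_measurable borel"
    and \<tau>: "\<tau> = real CARD('m) - \<alpha> / real CARD('n)" "0 < \<tau>"
  shows "strong_frac_maximal (\<lambda>_. \<alpha>) f x \<le>
    ennreal ((real (CARD('m) * CARD('n)) powr (CARD('n) * \<tau>)) ^ CARD('k)) * riesz_pos (CARD('n) * \<tau>) h x"
  unfolding strong_frac_maximal_def
proof (rule SUP_least, safe)
  fix Q :: "'k \<Rightarrow> (real^'n) set" assume Q: "\<forall>j. Q j \<in> cubes" and x: "x \<in> cube_prod Q"
  have "(\<integral>\<^sup>+y\<in>cube_prod Q. ennreal (norm (f i y)) \<partial>lebesgue) =
      (\<integral>\<^sup>+y\<in>cube_prod Q. h i y \<partial>lborel)" for i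
    unfolding nn_integral_completion
    by (rule nn_integral_cong_AE) (use h(1)[of i] in \<open>auto elim: eventually_mono\<close>)
  then show "ennreal (1 / (\<Prod>j\<in>UNIV. measure lebesgue (Q j) powr (real CARD('m) - \<alpha> / real CARD('n)))) *
        (\<Prod>i\<in>UNIV. \<integral>\<^sup>+y\<in>cube_prod Q. ennreal (norm (f i y)) \<partial>lebesgue) \<le>
    ennreal ((real (CARD('m) * CARD('n)) powr (CARD('n) * \<tau>)) ^ CARD('k)) * riesz_pos (CARD('n) * \<tau>) h x"
    unfolding \<tau>(1)[symmetric] using riesz_pos_ge[of h \<tau> Q x] h(2) \<tau>(2) Q x
    by (simp only: prod_powr_measure_cubes)
qed

text \<open>The maximal operator is bounded by the potential first, so that only the potential has
  to be compared with the grid.\<close>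

lemma potential_upper_bound:
  fixes S :: "('m::finite \<Rightarrow> real^'n^'k::finite \<Rightarrow> complex) \<Rightarrow> real^'n^'k \<Rightarrow> ennreal" and \<alpha> \<tau> :: real
  assumes S: "S = strong_frac_maximal (\<lambda>_. \<alpha>) \<or> S = riesz_prod_abs (\<lambda>_. \<alpha>)"
    and \<tau>: "\<tau> = real CARD('m) - \<alpha> / real CARD('n)" "0 < \<tau>"
  obtains K where "0 < K" "\<And>f h x. (\<And>i. f i \<in> borel_measurable lebesgue) \<Longrightarrow>
    (\<And>i. h i \<in> borel_measurable borel) \<Longrightarrow> (\<And>i. AE x in lborel. ennreal (norm (f i x)) = h i x) \<Longrightarrow>
    S f x \<le> ennreal K * grid_op \<tau> h x"
proof -
  define K1 where "K1 = (real (CARD('m) * CARD('n)) powr (CARD('n) * \<tau>)) ^ CARD('k)"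
  define K2 where "K2 = (8 powr (CARD('n) * \<tau>)) ^ CARD('k)"
  have n\<tau>: "real CARD('m) * real CARD('n) - \<alpha> = CARD('n) * \<tau>" by (simp add: \<tau> field_simps)
  show thesis
  proof (rule that[of "max K1 1 * K2"])
    show "0 < max K1 1 * K2" by (simp add: K2_def)
    fix f :: "'m \<Rightarrow> real^'n^'k \<Rightarrow> complex" and h x
    assume f: "\<And>i. f i \<in> borel_measurable lebesgue" and h: "\<And>i. h i \<in> borel_measurable borel"
      "\<And>i. AE x in lborel. ennreal (norm (f i x)) = h i x"
    from S have "S f x \<le> ennreal (max K1 1) * riesz_pos (CARD('n) * \<tau>) h x"
    proof
      assume S: "S = strong_frac_maximal (\<lambda>_. \<alpha>)"
      have "S f x \<le> ennreal K1 * riesz_pos (CARD('n) * \<tau>) h x"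
        unfolding S K1_def by (rule strong_frac_maximal_le) (use h \<tau> in auto)
      also have "... \<le> ennreal (max K1 1) * riesz_pos (CARD('n) * \<tau>) h x"
        by (intro mult_right_mono ennreal_leI) auto
      finally show ?thesis .
    next
      assume S: "S = riesz_prod_abs (\<lambda>_. \<alpha>)"
      have "S f x \<le> 1 * riesz_pos (CARD('n) * \<tau>) h x"
        unfolding S n\<tau>[symmetric] using riesz_prod_abs_le[OF f h(2)] by simp
      also have "... \<le> ennreal (max K1 1) * riesz_pos (CARD('n) * \<tau>) h x"
        by (intro mult_right_mono) (auto simp flip: ennreal_1 intro: ennreal_leI)
      finally show ?thesis .
    qed
    also have "... \<le> ennreal (max K1 1) * (ennreal K2 * grid_op \<tau> h x)"
      unfolding K2_def by (intro mult_left_mono riesz_pos_le_grid_op h \<tau>) auto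
    also have "... = ennreal (max K1 1 * K2) * grid_op \<tau> h x"
      by (simp add: K2_def ennreal_mult mult.assoc)
    finally show "S f x \<le> ennreal (max K1 1 * K2) * grid_op \<tau> h x" .
  qed
qed

text \<open>For the maximal operator the given product of cubes is one competitor in the supremum;
  for the potential the bound is \<open>riesz_pos_ge\<close>.\<close>

lemma potential_lower_bound:
  fixes S :: "('m::finite \<Rightarrow> real^'n^'k::finite \<Rightarrow> complex) \<Rightarrow> real^'n^'k \<Rightarrow> ennreal" and \<alpha> \<tau> :: real
  assumes S: "S = strong_frac_maximal (\<lambda>_. \<alpha>) \<or> S = riesz_prod_abs (\<lambda>_. \<alpha>)"
    and \<tau>: "\<tau> = real CARD('m) - \<alpha> / real CARD('n)" "0 < \<tau>"
  obtains K where "0 < K" "\<And>\<phi> Q x. (\<And>i. \<phi> i \<in> borel_measurable borel) \<Longrightarrow> (\<And>i x. 0 \<le> \<phi> i x) \<Longrightarrow>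
    (\<And>j. Q j \<in> cubes) \<Longrightarrow> x \<in> cube_prod Q \<Longrightarrow>
    ennreal (\<Prod>j\<in>UNIV. measure lborel (Q j) powr (- \<tau>)) *
      (\<Prod>i\<in>UNIV. \<integral>\<^sup>+y\<in>cube_prod Q. ennreal (\<phi> i y) \<partial>lborel)
    \<le> ennreal K * S (\<lambda>i x. complex_of_real (\<phi> i x)) x"
proof -
  define K where "K = (real (CARD('m) * CARD('n)) powr (CARD('n) * \<tau>)) ^ CARD('k)"
  have n\<tau>: "real CARD('m) * real CARD('n) - \<alpha> = CARD('n) * \<tau>" by (simp add: \<tau> field_simps)
  show thesis
  proof (rule that[of "max K 1"])
    show "0 < max K 1" by simp
    fix \<phi> :: "'m \<Rightarrow> real^'n^'k \<Rightarrow> real" and Q :: "'k \<Rightarrow> (real^'n) set" and x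
    assume \<phi> [measurable]: "\<And>i. \<phi> i \<in> borel_measurable borel" and \<phi>0: "\<And>i x. 0 \<le> \<phi> i x"
      and Q: "\<And>j. Q j \<in> cubes" and x: "x \<in> cube_prod Q"
    let ?L = "ennreal (\<Prod>j\<in>UNIV. measure lborel (Q j) powr (- \<tau>)) *
      (\<Prod>i\<in>UNIV. \<integral>\<^sup>+y\<in>cube_prod Q. ennreal (\<phi> i y) \<partial>lborel)"
    let ?f = "\<lambda>i x. complex_of_real (\<phi> i x)"
    from S show "?L \<le> ennreal (max K 1) * S ?f x"
    proof
      assume S: "S = strong_frac_maximal (\<lambda>_. \<alpha>)"
      have "?L = ennreal (1 / (\<Prod>j\<in>UNIV. measure lebesgue (Q j) powr (real CARD('m) - \<alpha> / real CARD('n)))) *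
        (\<Prod>i\<in>UNIV. \<integral>\<^sup>+y\<in>cube_prod Q. ennreal (norm (?f i y)) \<partial>lebesgue)"
        unfolding \<tau>(1)[symmetric] prod_powr_measure_cubes[OF Q] nn_integral_completion using \<phi>0 by simp
      also have "... \<le> 1 * S ?f x"
        unfolding S strong_frac_maximal_def mult_1 using Q x by (intro SUP_upper) auto
      also have "... \<le> ennreal (max K 1) * S ?f x"
        by (intro mult_right_mono) (auto simp flip: ennreal_1 intro: ennreal_leI)
      finally show ?thesis .
    next
      assume S: "S = riesz_prod_abs (\<lambda>_. \<alpha>)"
      have "?L \<le> ennreal K * riesz_pos (CARD('n) * \<tau>) (\<lambda>i x. ennreal (\<phi> i x)) x"
        unfolding K_def by (rule riesz_pos_ge) (use Q x \<tau> in auto)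
      also have "... \<le> ennreal (max K 1) * S ?f x"
        unfolding S n\<tau>[symmetric] by (intro mult_mono ennreal_leI riesz_prod_abs_ge \<phi>0) auto
      finally show ?thesis .
    qed
  qed
qed

text \<open>The functions \<open>wc j\<close> may change sign and come without measurability. Fixing
  the other coordinates at a generic point, where the section of the exceptional set is null, shows
  that \<open>wc j\<close> times a nonzero constant \<open>c\<close> agrees almost everywhere with a
  Borel function. Division by the absolute value of \<open>c\<close> yields a Borel version of the
  absolute value of \<open>wc j\<close>, and absolute values suffice since the full product is
  positive almost everywhere.\<close>

lemma product_function_Borel_version:
  fixes w w' :: "real^'n^'k::finite \<Rightarrow> real" and wc :: "'k \<Rightarrow> real^'n \<Rightarrow> real"
  assumes w' [measurable]: "w' \<in> borel_measurable borel" and ww': "AE x in lborel. w x = w' x"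
    and w_pos: "AE x in lborel. 0 < w x" and w: "\<And>x. w x = (\<Prod>j\<in>UNIV. wc j (x $ j))"
  obtains b where "\<And>j. b j \<in> borel_measurable borel" "\<And>j y. 0 < b j y"
    "AE x in lborel. w x = (\<Prod>j\<in>UNIV. b j (x $ j))"
proof -
  interpret L: product_sigma_finite "\<lambda>_::'k. lborel :: (real^'n) measure" ..
  have "AE x in lborel. w x = w' x \<and> 0 < w x" using ww' w_pos by eventually_elim simp
  then obtain N where N: "N \<in> null_sets lborel" "\<And>x. x \<notin> N \<Longrightarrow> w x = w' x \<and> 0 < w x"
    by (rule AE_E3) (auto simp: subset_eq)
  then have [measurable]: "N \<in> sets borel" by auto
  have "\<exists>b. b \<in> borel_measurable borel \<and> (\<forall>y. 0 < b y) \<and> (AE y in lborel. \<bar>wc j y\<bar> = b y)" for j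
  proof -
    define J where "J = UNIV - {j}"
    have J: "finite J" "j \<notin> J" "insert j J = UNIV" by (auto simp: J_def)
    interpret FJ: finite_product_sigma_finite "\<lambda>_::'k. lborel :: (real^'n) measure" J by standard (rule J)
    have ins: "(\<lambda>x. indicator N (vec_lambda x) :: ennreal) \<in> borel_measurable (PiM (insert j J) (\<lambda>_. lborel))"
      unfolding J(3) by measurable
    have upd [measurable]: "(\<lambda>(x, y). vec_lambda (x(j := y))) \<in> PiM J (\<lambda>_. lborel) \<Otimes>\<^sub>M (lborel :: (real^'n) measure) \<rightarrow>\<^sub>M borel"
    proof -
      have "(\<lambda>(x, y). x(j := y)) \<in> PiM J (\<lambda>_. lborel) \<Otimes>\<^sub>M (lborel :: (real^'n) measure) \<rightarrow>\<^sub>M PiM (insert j J) (\<lambda>_. lborel)"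
        by (rule measurable_add_dim)
      from measurable_compose[OF this, unfolded J(3), OF measurable_vec_lambda_lborel]
      show ?thesis by (simp add: case_prod_beta')
    qed
    have "0 = (\<integral>\<^sup>+x. indicator N x \<partial>lborel)" using N(1) by auto
    also have "... = (\<integral>\<^sup>+x. indicator N (vec_lambda x) \<partial>PiM (insert j J) (\<lambda>_. lborel))"
      unfolding J(3) by (rule nn_integral_lborel_vec) measurable
    also have "... = (\<integral>\<^sup>+x. \<integral>\<^sup>+y. indicator N (vec_lambda (x(j := y))) \<partial>lborel \<partial>PiM J (\<lambda>_. lborel))"
      by (rule L.product_nn_integral_insert[OF J(1,2) ins])
    finally have "AE x in PiM J (\<lambda>_. lborel). (\<integral>\<^sup>+y. indicator N (vec_lambda (x(j := y))) \<partial>lborel) = 0"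
      by (subst nn_integral_0_iff_AE[symmetric]) (auto intro!: lborel.borel_measurable_nn_integral)
    \<comment> \<open>A generic point exists only if the product measure is nonzero. Its total mass
      is a product of infinite masses, or the empty product 1.\<close>
    moreover have "ae_filter (PiM J (\<lambda>_. lborel :: (real^'n) measure)) \<noteq> bot"
    proof -
      have "emeasure (PiM J (\<lambda>_. lborel :: (real^'n) measure)) (PiE J (\<lambda>_. UNIV)) = (\<Prod>i\<in>J. emeasure lborel (UNIV :: (real^'n) set))"
        by (rule FJ.measure_times) auto
      then show ?thesis
        by (simp add: ae_filter_eq_bot_iff space_PiM J(1) emeasure_lborel_UNIV)
    qed
    ultimately obtain x where x: "x \<in> space (PiM J (\<lambda>_. lborel :: (real^'n) measure))"
        "(\<integral>\<^sup>+y. indicator N (vec_lambda (x(j := y))) \<partial>lborel) = 0"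
      using eventually_happens[OF eventually_conj[OF AE_space]] by blast
    have my [measurable]: "(\<lambda>y. vec_lambda (x(j := y))) \<in> (lborel :: (real^'n) measure) \<rightarrow>\<^sub>M borel"
      using measurable_compose[OF measurable_Pair1'[OF x(1)] upd] by simp
    have "AE y in lborel. indicator N (vec_lambda (x(j := y))) = (0::ennreal)"
      using x(2) by (subst nn_integral_0_iff_AE[symmetric]) measurable
    then have ae: "AE y in lborel. w (vec_lambda (x(j := y))) = w' (vec_lambda (x(j := y))) \<and> 0 < w (vec_lambda (x(j := y)))"
    proof (rule eventually_mono)
      fix y assume "indicator N (vec_lambda (x(j := y))) = (0::ennreal)"
      then show "w (vec_lambda (x(j := y))) = w' (vec_lambda (x(j := y))) \<and> 0 < w (vec_lambda (x(j := y)))"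
        by (intro N(2)) (simp add: indicator_eq_0_iff)
    qed
    define c where "c = (\<Prod>l\<in>J. wc l (x l))"
    have wx: "w (vec_lambda (x(j := y))) = wc j y * c" for y
    proof -
      have "w (vec_lambda (x(j := y))) = (\<Prod>l\<in>insert j J. wc l ((x(j := y)) l))" by (simp add: w J(3))
      also have "... = wc j y * (\<Prod>l\<in>J. wc l ((x(j := y)) l))" using J(1,2) by simp
      also have "(\<Prod>l\<in>J. wc l ((x(j := y)) l)) = c"
        unfolding c_def using J(2) by (intro prod.cong) auto
      finally show ?thesis .
    qed
    define v where "v y = w' (vec_lambda (x(j := y))) / \<bar>c\<bar>" for y
    have [measurable]: "v \<in> borel_measurable borel"
      unfolding v_def using my by (simp add: measurable_compose[OF _ w'])
    \<comment> \<open>The value 1 is taken on a null set only and makes \<open>b\<close> positive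
      everywhere.\<close>
    define b where "b y = (if 0 < v y then v y else 1)" for y
    have "b \<in> borel_measurable borel" unfolding b_def by measurable
    moreover have "\<forall>y. 0 < b y" by (simp add: b_def)
    moreover have "AE y in lborel. \<bar>wc j y\<bar> = b y"
      using ae
    proof eventually_elim
      case (elim y)
      then have pos: "0 < wc j y * c" "wc j y * c = w' (vec_lambda (x(j := y)))" by (auto simp: wx)
      then have "c \<noteq> 0" by auto
      moreover have "wc j y * c = \<bar>wc j y\<bar> * \<bar>c\<bar>" using pos(1) by (simp flip: abs_mult)
      ultimately have "v y = \<bar>wc j y\<bar>" unfolding v_def pos(2)[symmetric] by simp
      moreover have "wc j y \<noteq> 0" using pos(1) by auto
      ultimately show ?case by (simp add: b_def)
    qed
    ultimately show ?thesis by blast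
  qed
  then have "\<forall>j. \<exists>b. b \<in> borel_measurable borel \<and> (\<forall>y. 0 < b y) \<and> (AE y in lborel. \<bar>wc j y\<bar> = b y)" by blast
  from choice[OF this] obtain b where b: "\<And>j. b j \<in> borel_measurable borel" "\<And>j y. 0 < b j y"
      "\<And>j. AE y in lborel. \<bar>wc j y\<bar> = b j y" by blast
  have "AE x in (lborel :: (real^'n^'k) measure). \<forall>j. \<bar>wc j (x $ j)\<bar> = b j (x $ j)"
    by (subst AE_all_countable) (intro allI AE_lborel_vec_nth b)
  then have "AE x in lborel. w x = (\<Prod>j\<in>UNIV. b j (x $ j))"
    using w_pos
  proof eventually_elim
    case (elim x)
    have "w x = \<bar>w x\<bar>" using elim(2) by simp
    also have "... = (\<Prod>j\<in>UNIV. \<bar>wc j (x $ j)\<bar>)" by (simp add: w abs_prod)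
    finally show ?case using elim(1) by simp
  qed
  then show thesis using that b by blast
qed

text \<open>Local integrability makes the restriction to each ball measurable, and the function is
  the pointwise limit of these restrictions.\<close>

lemma weight_Borel_version:
  fixes \<rho> :: "'a::euclidean_space \<Rightarrow> real"
  assumes "weight \<rho>"
  obtains v where "v \<in> borel_measurable borel" "AE x in lborel. \<rho> x = v x"
proof -
  have "(\<lambda>x. indicator (cball 0 (real n)) x *\<^sub>R \<rho> x) \<in> borel_measurable lebesgue" for n
    using assms by (auto simp: weight_def set_integrable_def dest!: spec[of _ "cball 0 (real n)"])
  moreover have "(\<lambda>n. indicator (cball 0 (real n)) x *\<^sub>R \<rho> x) \<longlonglongrightarrow> \<rho> x" for x
  proof (rule tendsto_eventually)
    have "\<forall>\<^sub>F n in sequentially. norm x \<le> real n"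
      by (intro eventually_sequentiallyI[of "nat \<lceil>norm x\<rceil>"]) linarith
    then show "\<forall>\<^sub>F n in sequentially. indicator (cball 0 (real n)) x *\<^sub>R \<rho> x = \<rho> x"
      by (rule eventually_mono) simp
  qed
  ultimately have "\<rho> \<in> borel_measurable lebesgue"
    by (rule borel_measurable_LIMSEQ_real[rotated])
  from completion_ex_borel_measurable_real[OF this] obtain v
    where "v \<in> borel_measurable lborel" "AE x in lborel. \<rho> x = v x" by (rule bexE)
  then show thesis by (intro that) simp_all
qed

section \<open>Necessity and sufficiency\<close>

lemma SUP_mult_incseq_ennreal:
  fixes f g :: "nat \<Rightarrow> ennreal"
  assumes "incseq f" "incseq g"
  shows "(SUP n. f n * g n) = (SUP n. f n) * (SUP n. g n)"
proof (rule antisym)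
  show "(SUP n. f n * g n) \<le> (SUP n. f n) * (SUP n. g n)"
    by (intro SUP_least mult_mono SUP_upper) auto
  have "f n * g m \<le> (SUP n. f n * g n)" for n m
  proof -
    have "f n * g m \<le> f (max n m) * g (max n m)"
      by (intro mult_mono incseqD[OF assms(1)] incseqD[OF assms(2)]) auto
    also have "... \<le> (SUP n. f n * g n)" by (rule SUP_upper) simp
    finally show ?thesis .
  qed
  then show "(SUP n. f n) * (SUP n. g n) \<le> (SUP n. f n * g n)"
    unfolding SUP_mult_right_ennreal SUP_mult_left_ennreal by (intro SUP_least)
qed

lemma SUP_prod_incseq_ennreal:
  fixes f :: "'i \<Rightarrow> nat \<Rightarrow> ennreal"
  assumes "finite I" "\<And>i. i \<in> I \<Longrightarrow> incseq (f i)"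
  shows "(SUP n. \<Prod>i\<in>I. f i n) = (\<Prod>i\<in>I. SUP n. f i n)"
  using assms
proof (induction I)
  case (insert i I)
  have "incseq (\<lambda>n. \<Prod>i\<in>I. f i n)"
    using insert by (auto simp: incseq_def intro!: prod_mono_ennreal)
  with insert show ?case by (simp add: SUP_mult_incseq_ennreal)
qed simp

text \<open>The situation once the weights are products of Borel factors that are positive
  everywhere. The intermediate exponent of the theorem is eliminated by inserting its definition
  into the relation for \<open>q\<close>.\<close>

locale product_weights =
  fixes b :: "'m::finite \<Rightarrow> 'k::finite \<Rightarrow> real^'n \<Rightarrow> real" and p :: "'m \<Rightarrow> real" and q \<alpha> :: real
  assumes b_measurable [measurable]: "\<And>i j. b i j \<in> borel_measurable borel"
    and b_pos: "\<And>i j y. 0 < b i j y"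
    and p_gt_1: "\<And>i. 1 < p i" and q_pos: "0 < q"
    and \<alpha>: "0 < \<alpha>" "\<alpha> < real CARD('m) * real CARD('n)"
    and q_eq: "1 / q = (\<Sum>i\<in>UNIV. 1 / p i) - \<alpha> / real CARD('n)"
begin

definition \<tau> :: real where
  "\<tau> = real CARD('m) - \<alpha> / real CARD('n)"

definition B :: "'m \<Rightarrow> real^'n^'k \<Rightarrow> real" where
  "B i x = (\<Prod>j\<in>UNIV. b i j (x $ j))"

definition \<theta> :: "'m option \<Rightarrow> real" where
  "\<theta> s = (case s of None \<Rightarrow> 1 / q | Some i \<Rightarrow> 1 - 1 / p i)"

definition \<rho> :: "'m option \<Rightarrow> 'k \<Rightarrow> real^'n \<Rightarrow> real" where
  "\<rho> s j y = (case s of None \<Rightarrow> (\<Prod>i\<in>UNIV. b i j y) powr q | Some i \<Rightarrow> b i j y powr (- conj_exponent (p i)))"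

text \<open>The expression in the weight condition with all averaging factors collected: the
  exponents 1/q and 1/p_i' of the averages add up to \<open>\<tau>\<close>, so the volumes appear
  with the single power \<open>- \<tau>\<close>.\<close>

definition ratio :: "('k \<Rightarrow> (real^'n) set) \<Rightarrow> ennreal" where
  "ratio Q = ennreal (\<Prod>j\<in>UNIV. measure lborel (Q j) powr (- \<tau>)) *
    (\<Prod>s\<in>UNIV. (\<Prod>j\<in>UNIV. \<integral>\<^sup>+y\<in>Q j. ennreal (\<rho> s j y) \<partial>lborel) epowr \<theta> s)"

definition output_norm :: "(real^'n^'k \<Rightarrow> ennreal) \<Rightarrow> ennreal" where
  "output_norm F = (\<integral>\<^sup>+ x. (F x * ennreal (\<Prod>i\<in>UNIV. B i x)) epowr q \<partial>lebesgue) epowr (1 / q)"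

definition input_norm :: "('m \<Rightarrow> real^'n^'k \<Rightarrow> complex) \<Rightarrow> ennreal" where
  "input_norm f = (\<Prod>i\<in>UNIV. (\<integral>\<^sup>+ x. ennreal ((norm (f i x) * B i x) powr p i) \<partial>lebesgue) epowr (1 / p i))"

lemma \<theta>_simps [simp]: "\<theta> None = 1 / q" "\<theta> (Some i) = 1 - 1 / p i"
  by (simp_all add: \<theta>_def)

lemma \<theta>_pos: "0 < \<theta> s"
proof (cases s)
  case (Some i)
  then show ?thesis using p_gt_1[of i] by simp
qed (simp add: q_pos)

lemma conj_exponent_eq: "1 / conj_exponent (p i) = 1 - 1 / p i" "1 < conj_exponent (p i)"
  "(1 - conj_exponent (p i)) * p i = - conj_exponent (p i)"
  using p_gt_1[of i] by (simp_all add: conj_exponent_def field_simps)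

lemma \<tau>_pos: "0 < \<tau>"
  using \<alpha> by (simp add: \<tau>_def field_simps)

lemma sum_\<theta>: "(\<Sum>s\<in>UNIV. \<theta> s) = \<tau>"
  using q_eq by (simp add: sum_UNIV_option \<tau>_def sum_subtractf)

lemma B_measurable [measurable]: "B i \<in> borel_measurable borel"
  unfolding B_def by measurable

lemma B_pos: "0 < B i x"
  unfolding B_def by (intro prod_pos) (simp add: b_pos)

lemma \<rho>_measurable [measurable]: "\<rho> s j \<in> borel_measurable borel"
  unfolding \<rho>_def by (cases s) simp_all

lemma \<rho>_pos: "0 < \<rho> s j y"
proof -
  have "0 < (\<Prod>i\<in>UNIV. b i j y)" by (intro prod_pos) (simp add: b_pos)
  then show ?thesis by (cases s) (simp_all add: \<rho>_def b_pos less_imp_neq[symmetric])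
qed

lemma prod_\<rho>_None: "(\<Prod>j\<in>UNIV. \<rho> None j (x $ j)) = (\<Prod>i\<in>UNIV. B i x) powr q"
  unfolding \<rho>_def B_def option.case prod_powr_distrib[symmetric]
  by (rule arg_cong[where f = "\<lambda>t. t powr q"]) (rule prod.swap)

lemma prod_\<rho>_Some: "(\<Prod>j\<in>UNIV. \<rho> (Some i) j (x $ j)) = B i x powr (- conj_exponent (p i))"
  unfolding \<rho>_def B_def option.case prod_powr_distrib[symmetric] ..

lemma prod_\<rho>_\<theta>: "(\<Prod>s\<in>UNIV. \<rho> s j y powr \<theta> s) = 1"
proof -
  have "0 < (\<Prod>i\<in>UNIV. b i j y)" by (intro prod_pos) (simp add: b_pos)
  moreover have "\<rho> (Some i) j y powr (1 - 1 / p i) = 1 / b i j y" for i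
  proof -
    have "- conj_exponent (p i) * (1 - 1 / p i) = - 1"
      using conj_exponent_eq(1,2)[of i] by (simp flip: conj_exponent_eq(1))
    then have "\<rho> (Some i) j y powr (1 - 1 / p i) = b i j y powr (- 1)"
      by (simp only: \<rho>_def option.case powr_powr)
    then show ?thesis using b_pos[of i j y] by (simp add: powr_minus_divide)
  qed
  moreover have "b i j y \<noteq> 0" for i using b_pos[of i j y] by simp
  moreover have "\<rho> None j y powr (1 / q) = (\<Prod>i\<in>UNIV. b i j y)"
    using q_pos calculation(1) by (simp add: \<rho>_def powr_powr)
  ultimately show ?thesis
    by (simp add: prod_UNIV_option prod_dividef)
qed

lemma nn_integral_prod_\<rho>:
  assumes "\<And>j. Q j \<in> cubes"
  shows "(\<integral>\<^sup>+x\<in>cube_prod Q. ennreal (\<Prod>j\<in>UNIV. \<rho> s j (x $ j)) \<partial>lborel) =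
    (\<Prod>j\<in>UNIV. \<integral>\<^sup>+y\<in>Q j. ennreal (\<rho> s j y) \<partial>lborel)"
proof -
  have [measurable]: "Q j \<in> sets borel" for j using assms[of j] by (auto elim: cubeE)
  show ?thesis
    by (subst nn_integral_cube_prod[symmetric]) (auto simp: prod_ennreal \<rho>_pos less_imp_le)
qed

lemma ratio_eq:
  assumes Q: "\<And>j. Q j \<in> cubes"
  shows "(ennreal (1 / (\<Prod>j\<in>UNIV. measure lebesgue (Q j))) *
      (\<integral>\<^sup>+x\<in>cube_prod Q. ennreal ((\<Prod>i\<in>UNIV. B i x) powr q) \<partial>lebesgue)) epowr (1 / q) *
    (\<Prod>i\<in>UNIV. (ennreal (1 / (\<Prod>j\<in>UNIV. measure lebesgue (Q j))) *
      (\<integral>\<^sup>+x\<in>cube_prod Q. ennreal (B i x powr (- conj_exponent (p i))) \<partial>lebesgue))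
      epowr (1 / conj_exponent (p i))) = ratio Q"
proof -
  define D where "D = (\<Prod>j\<in>UNIV. measure lborel (Q j))"
  have "0 < measure lborel (Q j)" for j using Q[of j] by (auto elim: cubeE)
  then have D: "0 < D" unfolding D_def by (intro prod_pos) auto
  define X where "X s = (\<Prod>j\<in>UNIV. \<integral>\<^sup>+y\<in>Q j. ennreal (\<rho> s j y) \<partial>lborel)" for s
  have "(\<Prod>s\<in>UNIV. (ennreal (1 / D) * X s) epowr \<theta> s) = (\<Prod>s\<in>UNIV. ennreal (D powr (- \<theta> s)) * X s epowr \<theta> s)"
    using D by (simp add: epowr_mult epowr_ennreal powr_divide powr_minus_divide)
  also have "... = ennreal (D powr (- \<tau>)) * (\<Prod>s\<in>UNIV. X s epowr \<theta> s)"
    using D by (simp add: prod.distrib prod_ennreal sum_\<theta>[symmetric] powr_sum sum_negf[symmetric] less_imp_neq[symmetric])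
  also have "D powr (- \<tau>) = (\<Prod>j\<in>UNIV. measure lborel (Q j) powr (- \<tau>))"
    unfolding D_def by (rule prod_powr_distrib)
  finally show ?thesis
    unfolding ratio_def prod_UNIV_option \<theta>_simps nn_integral_completion conj_exponent_eq(1)
      prod_\<rho>_None[symmetric] prod_\<rho>_Some[symmetric] nn_integral_prod_\<rho>[OF Q] X_def D_def
    by (simp add: measure_lebesgue_cube Q)
qed

text \<open>The bound for the grid operator speaks of Borel functions, so each
  \<open>norm (f i)\<close> is replaced by a Borel function \<open>h i\<close> equal to it almost
  everywhere, which affects neither the integrals nor the bound for \<open>S f\<close>.\<close>

lemma weighted_bound_if_ratio_bounded:
  assumes ratio: "\<And>Q. (\<And>j. Q j \<in> cubes) \<Longrightarrow> ratio Q \<le> ennreal A"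
    and S: "S = strong_frac_maximal (\<lambda>_. \<alpha>) \<or> S = riesz_prod_abs (\<lambda>_. \<alpha>)"
  shows "\<exists>C>0. \<forall>f. (\<forall>i. f i \<in> borel_measurable lebesgue) \<longrightarrow>
    output_norm (S f) \<le> ennreal C * input_norm f"
proof -
  have q2: "1 / q < (\<Sum>i\<in>UNIV. 1 / p i)" using q_eq \<alpha> by simp
  have A: "(\<Prod>s\<in>UNIV. (\<Prod>j\<in>UNIV. \<integral>\<^sup>+x\<in>Q j. ennreal (\<rho> s j x) \<partial>lborel) epowr \<theta> s)
        \<le> ennreal A * (\<Prod>j\<in>UNIV. emeasure lborel (Q j)) epowr (\<Sum>s\<in>UNIV. \<theta> s)"
    if Q: "\<And>j. Q j \<in> cubes" for Q
  proof -
    define D where "D = (\<Prod>j\<in>UNIV. measure lborel (Q j))"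
    have m: "0 < measure lborel (Q j)" "emeasure lborel (Q j) = ennreal (measure lborel (Q j))" for j
      using Q[of j] by (auto elim: cubeE)
    then have D: "0 < D" "(\<Prod>j\<in>UNIV. emeasure lborel (Q j)) = ennreal D"
      unfolding D_def by (auto simp: prod_ennreal less_imp_le intro!: prod_pos)
    let ?X = "\<Prod>s\<in>UNIV. (\<Prod>j\<in>UNIV. \<integral>\<^sup>+x\<in>Q j. ennreal (\<rho> s j x) \<partial>lborel) epowr \<theta> s"
    have "ennreal (D powr \<tau>) * (ennreal (D powr (- \<tau>)) * ?X) \<le> ennreal (D powr \<tau>) * ennreal A"
      using ratio[OF Q] unfolding ratio_def D_def prod_powr_distrib by (intro mult_left_mono) auto
    moreover have "ennreal (D powr \<tau>) * (ennreal (D powr (- \<tau>)) * ?X) = ?X"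
      using D by (simp add: mult.assoc[symmetric] flip: ennreal_mult powr_add)
    ultimately show ?thesis using D by (simp add: sum_\<theta> epowr_ennreal mult.commute)
  qed
  obtain C where C: "0 < C" "\<And>f. (\<And>i. f i \<in> borel_measurable borel) \<Longrightarrow>
    (\<integral>\<^sup>+x. grid_op (\<Sum>s\<in>UNIV. \<theta> s) f x epowr q * ennreal (\<Prod>j\<in>UNIV. \<rho> None j (x $ j)) \<partial>lborel) epowr (1 / q) \<le>
      ennreal C * (\<Prod>i\<in>UNIV. (\<integral>\<^sup>+x. (f i x * ennreal (1 / (\<Prod>j\<in>UNIV. \<rho> (Some i) j (x $ j)))) epowr p i *
        ennreal (\<Prod>j\<in>UNIV. \<rho> (Some i) j (x $ j)) \<partial>lborel) epowr (1 / p i))"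
    by (rule grid_op_bound[of \<rho> p q \<theta> A]) (use \<rho>_pos p_gt_1 q_pos q2 prod_\<rho>_\<theta> A in simp_all)
  obtain K where K: "0 < K" "\<And>f h x. (\<And>i. f i \<in> borel_measurable lebesgue) \<Longrightarrow>
    (\<And>i. h i \<in> borel_measurable borel) \<Longrightarrow> (\<And>i. AE x in lborel. ennreal (norm (f i x)) = h i x) \<Longrightarrow>
    S f x \<le> ennreal K * grid_op \<tau> h x"
    using potential_upper_bound[OF S \<tau>_def \<tau>_pos] by blast
  show ?thesis
  proof (intro exI[of _ "K * C"] conjI allI impI)
    show "0 < K * C" using K C by simp
    fix f :: "'m \<Rightarrow> real^'n^'k \<Rightarrow> complex" assume f: "\<forall>i. f i \<in> borel_measurable lebesgue"
    have "\<forall>i. \<exists>h. h \<in> borel_measurable borel \<and> (AE x in lborel. ennreal (norm (f i x)) = h x)"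
    proof
      fix i
      have [measurable]: "f i \<in> borel_measurable lebesgue" using f by blast
      have "(\<lambda>x. ennreal (norm (f i x))) \<in> borel_measurable lebesgue" by measurable
      from completion_ex_borel_measurable[OF this]
      show "\<exists>h. h \<in> borel_measurable borel \<and> (AE x in lborel. ennreal (norm (f i x)) = h x)" by auto
    qed
    from choice[OF this] obtain h where h: "\<And>i. h i \<in> borel_measurable borel"
      "\<And>i. AE x in lborel. ennreal (norm (f i x)) = h i x" by blast
    note [measurable] = h(1)
    \<comment> \<open>The norm of f/\<sigma> in L^p(\<sigma>) is the norm of f w in L^p, because
      \<open>p' * p - p' = p\<close> for conjugate exponents.\<close>
    have norm_eq: "(\<integral>\<^sup>+x. (h i x * ennreal (1 / (\<Prod>j\<in>UNIV. \<rho> (Some i) j (x $ j)))) epowr p i *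
        ennreal (\<Prod>j\<in>UNIV. \<rho> (Some i) j (x $ j)) \<partial>lborel) =
      (\<integral>\<^sup>+ x. ennreal ((norm (f i x) * B i x) powr p i) \<partial>lebesgue)" for i
      unfolding nn_integral_completion prod_\<rho>_Some
    proof (rule nn_integral_cong_AE, use h(2)[of i] in eventually_elim)
      case (elim x)
      let ?p' = "conj_exponent (p i)"
      have "(h i x * ennreal (1 / B i x powr (- ?p'))) epowr p i * ennreal (B i x powr (- ?p')) =
          ennreal (norm (f i x) powr p i * ((B i x powr ?p') powr p i * B i x powr (- ?p')))"
      proof -
        have "1 / B i x powr (- ?p') = B i x powr ?p'" by (simp add: powr_minus_divide)
        then show ?thesis
          unfolding elim[symmetric] by (simp add: epowr_mult epowr_ennreal ennreal_mult mult.assoc)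
      qed
      also have "(B i x powr ?p') powr p i * B i x powr (- ?p') = B i x powr (?p' * p i - ?p')"
        by (simp add: powr_powr flip: powr_add)
      also have "?p' * p i - ?p' = p i" using conj_exponent_eq(3)[of i] by (simp add: algebra_simps)
      also have "norm (f i x) powr p i * B i x powr p i = (norm (f i x) * B i x) powr p i"
        using B_pos[of i x] by (simp add: powr_mult)
      finally show ?case .
    qed
    have "(\<integral>\<^sup>+ x. (S f x * ennreal (\<Prod>i\<in>UNIV. B i x)) epowr q \<partial>lebesgue) \<le>
        (\<integral>\<^sup>+x. ennreal (K powr q) * (grid_op \<tau> h x epowr q * ennreal (\<Prod>j\<in>UNIV. \<rho> None j (x $ j))) \<partial>lborel)"
      unfolding nn_integral_completion
    proof (rule nn_integral_mono)
      fix x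
      have "(S f x * ennreal (\<Prod>i\<in>UNIV. B i x)) epowr q \<le> (ennreal K * grid_op \<tau> h x * ennreal (\<Prod>i\<in>UNIV. B i x)) epowr q"
        using q_pos f h by (intro epowr_mono mult_right_mono K(2)) auto
      also have "... = ennreal (K powr q) * (grid_op \<tau> h x epowr q * ennreal (\<Prod>j\<in>UNIV. \<rho> None j (x $ j)))"
        using K(1) B_pos by (simp add: epowr_mult epowr_ennreal prod_\<rho>_None prod_nonneg less_imp_le mult.assoc)
      finally show "(S f x * ennreal (\<Prod>i\<in>UNIV. B i x)) epowr q \<le>
          ennreal (K powr q) * (grid_op \<tau> h x epowr q * ennreal (\<Prod>j\<in>UNIV. \<rho> None j (x $ j)))" .
    qed
    also have "... = ennreal (K powr q) * (\<integral>\<^sup>+x. grid_op \<tau> h x epowr q * ennreal (\<Prod>j\<in>UNIV. \<rho> None j (x $ j)) \<partial>lborel)"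
      by (rule nn_integral_cmult) measurable
    finally have "output_norm (S f) \<le>
        (ennreal (K powr q) * (\<integral>\<^sup>+x. grid_op \<tau> h x epowr q * ennreal (\<Prod>j\<in>UNIV. \<rho> None j (x $ j)) \<partial>lborel)) epowr (1 / q)"
      unfolding output_norm_def using q_pos by (intro epowr_mono) auto
    also have "... = ennreal K * (\<integral>\<^sup>+x. grid_op \<tau> h x epowr q * ennreal (\<Prod>j\<in>UNIV. \<rho> None j (x $ j)) \<partial>lborel) epowr (1 / q)"
      using q_pos K(1) by (simp add: epowr_mult epowr_ennreal powr_powr)
    also have "... \<le> ennreal K * (ennreal C *
        (\<Prod>i\<in>UNIV. (\<integral>\<^sup>+x. (h i x * ennreal (1 / (\<Prod>j\<in>UNIV. \<rho> (Some i) j (x $ j)))) epowr p i *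
        ennreal (\<Prod>j\<in>UNIV. \<rho> (Some i) j (x $ j)) \<partial>lborel) epowr (1 / p i)))"
      using C(2)[of h] h(1) by (intro mult_left_mono) (auto simp: sum_\<theta>)
    also have "... = ennreal K * (ennreal C * input_norm f)"
      by (simp only: norm_eq input_norm_def)
    finally show "output_norm (S f) \<le> ennreal (K * C) * input_norm f"
      using K(1) C(1) by (simp add: ennreal_mult mult.assoc)
  qed
qed

text \<open>Finiteness of the integrals of \<open>\<sigma> i\<close> over rectangles is part of the
  conclusion. Truncation at height \<open>N\<close> makes them finite, so that the test functions
  are admissible and their norms can be cancelled. The resulting bound is independent of
  \<open>N\<close>, and since all truncated integrals increase with \<open>N\<close>, the supremum
  passes through the product.\<close>

lemma ratio_bounded_if_weighted_bound:
  assumes C: "0 < C" "\<And>f. (\<And>i. f i \<in> weighted_Lp (p i) (\<lambda>x. B i x powr p i)) \<Longrightarrow>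
    output_norm (S f) \<le> ennreal C * input_norm f"
    and S: "S = strong_frac_maximal (\<lambda>_. \<alpha>) \<or> S = riesz_prod_abs (\<lambda>_. \<alpha>)"
  shows "\<exists>A. \<forall>Q. (\<forall>j. Q j \<in> cubes) \<longrightarrow> ratio Q \<le> ennreal A"
proof -
  obtain K where K: "0 < K" "\<And>\<phi> Q x. (\<And>i. \<phi> i \<in> borel_measurable borel) \<Longrightarrow> (\<And>i x. 0 \<le> \<phi> i x) \<Longrightarrow>
    (\<And>j. Q j \<in> cubes) \<Longrightarrow> x \<in> cube_prod Q \<Longrightarrow>
    ennreal (\<Prod>j\<in>UNIV. measure lborel (Q j) powr (- \<tau>)) *
      (\<Prod>i\<in>UNIV. \<integral>\<^sup>+y\<in>cube_prod Q. ennreal (\<phi> i y) \<partial>lborel)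
    \<le> ennreal K * S (\<lambda>i x. complex_of_real (\<phi> i x)) x"
    using potential_lower_bound[OF S \<tau>_def \<tau>_pos] by blast
  have "ratio Q \<le> ennreal (K * C)" if Q: "\<And>j. Q j \<in> cubes" for Q
  proof -
    define P where "P = cube_prod Q"
    have [measurable]: "P \<in> sets borel" unfolding P_def by (rule cube_prod_of_cubes_borel[OF Q])
    define \<sigma> where "\<sigma> i x = B i x powr (- conj_exponent (p i))" for i x
    have [measurable]: "\<sigma> i \<in> borel_measurable borel" for i unfolding \<sigma>_def by measurable
    have \<sigma>0: "0 < \<sigma> i x" for i x using B_pos[of i x] by (simp add: \<sigma>_def)
    define \<phi> where "\<phi> N i x = (if x \<in> P \<and> \<sigma> i x \<le> real N then \<sigma> i x else 0)" for N i x
    have [measurable]: "\<phi> N i \<in> borel_measurable borel" for N i unfolding \<phi>_def by measurable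
    have \<phi>0: "0 \<le> \<phi> N i x" for N i x using \<sigma>0[of i x] by (simp add: \<phi>_def)
    define I where "I N i = (\<integral>\<^sup>+x. ennreal (\<phi> N i x) \<partial>lborel)" for N i
    define c where "c = (\<Prod>j\<in>UNIV. measure lborel (Q j) powr (- \<tau>))"
    define U where "U = (\<integral>\<^sup>+x\<in>P. ennreal ((\<Prod>i\<in>UNIV. B i x) powr q) \<partial>lborel)"
    have P_fin: "emeasure lborel P < top"
    proof -
      have [measurable]: "Q j \<in> sets borel" for j using Q[of j] by (auto elim: cubeE)
      have "emeasure lborel P = (\<integral>\<^sup>+x\<in>cube_prod Q. (\<Prod>j\<in>(UNIV :: 'k set). 1) \<partial>lborel)"
        by (simp add: P_def[symmetric])
      also have "... = (\<Prod>j\<in>UNIV. \<integral>\<^sup>+x\<in>Q j. 1 \<partial>lborel)"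
        by (rule nn_integral_cube_prod[of "\<lambda>_ _. 1"]) auto
      also have "... = (\<Prod>j\<in>UNIV. emeasure lborel (Q j))" by simp
      also have "... < top"
      proof -
        have "emeasure lborel (Q j) \<noteq> top" for j using Q[of j] by (auto elim: cubeE)
        then show ?thesis by (simp add: less_top[symmetric] ennreal_prod_eq_top)
      qed
      finally show ?thesis .
    qed
    have step: "ennreal c * U epowr (1 / q) * (\<Prod>i\<in>UNIV. I N i epowr (1 - 1 / p i)) \<le> ennreal (K * C)" for N
    \<comment> \<open>A vanishing integral makes the left side 0; otherwise the product of the
      \<open>I N i epowr (1 / p i)\<close> is positive and finite and may be cancelled.\<close>
    proof (cases "\<exists>i. I N i = 0")
      case True
      then have "(\<Prod>i\<in>UNIV. I N i epowr (1 - 1 / p i)) = 0" by (auto simp: prod_zero_iff)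
      then show ?thesis by (simp only: mult_zero_right zero_le)
    next
      case False
      let ?f = "\<lambda>i x. complex_of_real (\<phi> N i x)"
      have I_fin: "I N i < top" for i
      proof -
        have "I N i \<le> (\<integral>\<^sup>+x\<in>P. ennreal (real N) \<partial>lborel)"
          unfolding I_def by (intro nn_integral_mono) (auto simp: \<phi>_def indicator_def intro: ennreal_leI)
        also have "... = ennreal (real N) * emeasure lborel P" by (simp add: nn_integral_cmult)
        also have "... < top" using P_fin by (simp add: ennreal_mult_less_top)
        finally show ?thesis .
      qed
      \<comment> \<open>The property that singles out this test function: by
        \<open>(1 - p') * p = - p'\<close> its integral is at the same time the p-th power of its
        weighted norm.\<close>
      have \<phi>p: "(\<phi> N i x * B i x) powr p i = \<phi> N i x" for i x
      proof (cases "x \<in> P \<and> \<sigma> i x \<le> real N")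
        case True
        have "\<sigma> i x * B i x = B i x powr (1 - conj_exponent (p i))"
          using B_pos[of i x] by (simp add: \<sigma>_def powr_diff powr_minus_divide)
        then have "(\<sigma> i x * B i x) powr p i = \<sigma> i x"
          by (simp only: powr_powr conj_exponent_eq(3) \<sigma>_def)
        then show ?thesis using True by (simp add: \<phi>_def)
      qed (auto simp: \<phi>_def)
      have norm: "(\<integral>\<^sup>+ x. ennreal ((norm (?f i x) * B i x) powr p i) \<partial>lebesgue) = I N i" for i
        using \<phi>0[of N i] by (simp add: nn_integral_completion \<phi>p I_def)
      have mem: "?f i \<in> weighted_Lp (p i) (\<lambda>x. B i x powr p i)" for i
      proof -
        have "norm (?f i x) powr p i * B i x powr p i = (norm (?f i x) * B i x) powr p i" for x
          using B_pos[of i x] by (simp add: powr_mult)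
        then have "(\<integral>\<^sup>+ x. ennreal (norm (?f i x) powr p i * B i x powr p i) \<partial>lebesgue) < \<infinity>"
          using norm[of i] I_fin[of i] by simp
        moreover have "?f i \<in> borel_measurable lebesgue"
          by (rule measurable_completion) measurable
        ultimately show ?thesis by (simp add: weighted_Lp_def)
      qed
      define X where "X = ennreal (1 / K) * (ennreal c * (\<Prod>i\<in>UNIV. I N i))"
      have low: "X \<le> S ?f x" if "x \<in> P" for x
      proof -
        have "(\<integral>\<^sup>+y\<in>cube_prod Q. ennreal (\<phi> N i y) \<partial>lborel) = I N i" for i
          unfolding I_def by (rule nn_integral_cong) (simp add: \<phi>_def P_def indicator_def)
        then have "ennreal c * (\<Prod>i\<in>UNIV. I N i) \<le> ennreal K * S ?f x"
          using K(2)[of "\<phi> N" Q x] \<phi>0 Q that by (simp add: c_def P_def)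
        then have "X \<le> ennreal (1 / K) * (ennreal K * S ?f x)"
          unfolding X_def by (rule mult_left_mono) simp
        also have "... = S ?f x" using K(1) by (simp add: mult.assoc[symmetric] flip: ennreal_mult)
        finally show ?thesis .
      qed
      have "X epowr q * U = (\<integral>\<^sup>+x. X epowr q * (ennreal ((\<Prod>i\<in>UNIV. B i x) powr q) * indicator P x) \<partial>lborel)"
        unfolding U_def by (rule nn_integral_cmult[symmetric]) measurable
      also have "... \<le> (\<integral>\<^sup>+ x. (S ?f x * ennreal (\<Prod>i\<in>UNIV. B i x)) epowr q \<partial>lborel)"
      proof (rule nn_integral_mono)
        fix x
        show "X epowr q * (ennreal ((\<Prod>i\<in>UNIV. B i x) powr q) * indicator P x) \<le>
            (S ?f x * ennreal (\<Prod>i\<in>UNIV. B i x)) epowr q"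
        proof (cases "x \<in> P")
          case True
          have "X epowr q * ennreal (\<Prod>i\<in>UNIV. B i x) epowr q \<le> S ?f x epowr q * ennreal (\<Prod>i\<in>UNIV. B i x) epowr q"
            using q_pos low[OF True] by (intro mult_right_mono epowr_mono) auto
          then show ?thesis
            using True B_pos by (simp add: epowr_mult epowr_ennreal prod_nonneg less_imp_le)
        qed simp
      qed
      finally have "(X epowr q * U) epowr (1 / q) \<le> output_norm (S ?f)"
        unfolding output_norm_def nn_integral_completion using q_pos by (intro epowr_mono) auto
      also have "... \<le> ennreal C * (\<Prod>i\<in>UNIV. I N i epowr (1 / p i))"
        using C(2)[OF mem] unfolding norm input_norm_def .
      also have "(X epowr q * U) epowr (1 / q) = X * U epowr (1 / q)"
        using q_pos by (simp add: epowr_mult epowr_epowr)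
      \<comment> \<open>Each integral is split into the input norm, which cancels, and the power
        1/p_i' that occurs in the weight condition.\<close>
      also have "X = ennreal (1 / K) * ennreal c * ((\<Prod>i\<in>UNIV. I N i epowr (1 / p i)) * (\<Prod>i\<in>UNIV. I N i epowr (1 - 1 / p i)))"
      proof -
        have "I N i = I N i epowr (1 / p i) * I N i epowr (1 - 1 / p i)" for i
          using epowr_add[of "I N i" "1 / p i" "1 - 1 / p i"] by simp
        then have "(\<Prod>i\<in>UNIV. I N i) = (\<Prod>i\<in>UNIV. I N i epowr (1 / p i) * I N i epowr (1 - 1 / p i))"
          by (rule prod.cong[OF refl])
        then show ?thesis by (simp add: X_def prod.distrib mult.assoc)
      qed
      finally have "(\<Prod>i\<in>UNIV. I N i epowr (1 / p i)) *
          (ennreal (1 / K) * (ennreal c * U epowr (1 / q) * (\<Prod>i\<in>UNIV. I N i epowr (1 - 1 / p i)))) \<le>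
          (\<Prod>i\<in>UNIV. I N i epowr (1 / p i)) * ennreal C"
        by (simp only: mult_ac)
      moreover have "(\<Prod>i\<in>UNIV. I N i epowr (1 / p i)) \<noteq> 0" "(\<Prod>i\<in>UNIV. I N i epowr (1 / p i)) \<noteq> top"
        using False I_fin by (auto simp: prod_zero_iff ennreal_prod_eq_top less_top)
      ultimately have "ennreal (1 / K) * (ennreal c * U epowr (1 / q) * (\<Prod>i\<in>UNIV. I N i epowr (1 - 1 / p i))) \<le> ennreal C"
        by (simp add: ennreal_mult_le_mult_iff)
      then have "ennreal K * (ennreal (1 / K) * (ennreal c * U epowr (1 / q) * (\<Prod>i\<in>UNIV. I N i epowr (1 - 1 / p i)))) \<le>
          ennreal K * ennreal C"
        by (rule mult_left_mono) simp
      moreover have "ennreal K * (ennreal (1 / K) * Y) = Y" for Y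
        using K(1) by (simp add: mult.assoc[symmetric] flip: ennreal_mult)
      ultimately show ?thesis using K(1) C(1) by (simp add: ennreal_mult)
    qed
    have inc: "incseq (\<lambda>N. I N i)" for i
      unfolding I_def incseq_def
      using \<sigma>0[of i] by (auto intro!: nn_integral_mono ennreal_leI simp: \<phi>_def less_imp_le)
    have SUP_I: "(SUP N. I N i) = (\<integral>\<^sup>+x\<in>P. ennreal (\<sigma> i x) \<partial>lborel)" for i
    proof -
      have "(\<integral>\<^sup>+x\<in>P. ennreal (\<sigma> i x) \<partial>lborel) = (\<integral>\<^sup>+x. (SUP N. ennreal (\<phi> N i x)) \<partial>lborel)"
      proof (rule nn_integral_cong)
        fix x
        show "ennreal (\<sigma> i x) * indicator P x = (SUP N. ennreal (\<phi> N i x))"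
        proof (rule antisym)
          obtain N where "\<sigma> i x \<le> real N" using real_arch_simple by blast
          then have "ennreal (\<sigma> i x) * indicator P x = ennreal (\<phi> N i x)"
            by (simp add: \<phi>_def indicator_def)
          also have "... \<le> (SUP N. ennreal (\<phi> N i x))" by (rule SUP_upper) simp
          finally show "ennreal (\<sigma> i x) * indicator P x \<le> (SUP N. ennreal (\<phi> N i x))" .
        qed (auto intro!: SUP_least simp: \<phi>_def indicator_def)
      qed
      also have "... = (SUP N. I N i)"
        unfolding I_def
      proof (rule nn_integral_monotone_convergence_SUP)
        show "incseq (\<lambda>N x. ennreal (\<phi> N i x))"
          using \<sigma>0[of i] by (auto simp: incseq_def le_fun_def \<phi>_def less_imp_le intro!: ennreal_leI)
      qed measurable
      finally show ?thesis by simp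
    qed
    have "ratio Q = ennreal c * U epowr (1 / q) *
        (\<Prod>i\<in>UNIV. (\<integral>\<^sup>+x\<in>P. ennreal (\<sigma> i x) \<partial>lborel) epowr (1 - 1 / p i))"
      unfolding ratio_def prod_UNIV_option \<theta>_simps nn_integral_prod_\<rho>[OF Q, symmetric]
        prod_\<rho>_None prod_\<rho>_Some c_def U_def \<sigma>_def P_def by (simp only: mult.assoc)
    also have "... = ennreal c * U epowr (1 / q) * (\<Prod>i\<in>UNIV. SUP N. I N i epowr (1 - 1 / p i))"
    proof -
      have "(SUP N. I N i) epowr (1 - 1 / p i) = (SUP N. I N i epowr (1 - 1 / p i))" for i
        using p_gt_1[of i] by (intro epowr_SUP) simp
      then show ?thesis by (simp flip: SUP_I)
    qed
    also have "(\<Prod>i\<in>UNIV. SUP N. I N i epowr (1 - 1 / p i)) = (SUP N. \<Prod>i\<in>UNIV. I N i epowr (1 - 1 / p i))"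
    proof (rule SUP_prod_incseq_ennreal[symmetric])
      show "incseq (\<lambda>N. I N i epowr (1 - 1 / p i))" for i
        using incseqD[OF inc] p_gt_1[of i] by (auto simp: incseq_def intro!: epowr_mono)
    qed simp
    also have "ennreal c * U epowr (1 / q) * ... \<le> ennreal (K * C)"
      unfolding SUP_mult_left_ennreal by (intro SUP_least step)
    finally show ?thesis .
  qed
  then show ?thesis by blast
qed

theorem weighted_bound_iff_ratio:
  assumes S: "S = strong_frac_maximal (\<lambda>_. \<alpha>) \<or> S = riesz_prod_abs (\<lambda>_. \<alpha>)"
  shows "(\<exists>C::real. C > 0 \<and> (\<forall>f. (\<forall>i. f i \<in> weighted_Lp (p i) (\<lambda>x. B i x powr p i)) \<longrightarrow>
    output_norm (S f) \<le> ennreal C * input_norm f))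
    \<longleftrightarrow> (SUP Q \<in> {Q. \<forall>j. Q j \<in> cubes}. ratio Q) < \<infinity>"
    (is "?bounded \<longleftrightarrow> ?finite")
proof
  assume ?bounded
  then obtain C where C0: "0 < C" and C: "\<forall>f. (\<forall>i. f i \<in> weighted_Lp (p i) (\<lambda>x. B i x powr p i)) \<longrightarrow>
    output_norm (S f) \<le> ennreal C * input_norm f"
    by (elim exE conjE)
  from ratio_bounded_if_weighted_bound[OF C0 C[rule_format] S] obtain A
    where A: "\<forall>Q. (\<forall>j. Q j \<in> cubes) \<longrightarrow> ratio Q \<le> ennreal A" by (rule exE)
  have "(SUP Q \<in> {Q. \<forall>j. Q j \<in> cubes}. ratio Q) \<le> ennreal A"
    by (rule SUP_least) (use A in blast)
  then show ?finite by (simp add: le_less_trans)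
next
  assume fin: ?finite
  define A where "A = enn2real (SUP Q \<in> {Q. \<forall>j. Q j \<in> cubes}. ratio Q)"
  have A: "ratio Q \<le> ennreal A" if "\<And>j. Q j \<in> cubes" for Q
  proof -
    have "ratio Q \<le> (SUP Q \<in> {Q. \<forall>j. Q j \<in> cubes}. ratio Q)"
      by (rule SUP_upper) (use that in blast)
    then show ?thesis using fin by (simp add: A_def)
  qed
  have "f i \<in> borel_measurable lebesgue" if "\<forall>i. f i \<in> weighted_Lp (p i) (\<lambda>x. B i x powr p i)"
    for f :: "'m \<Rightarrow> real^'n^'k \<Rightarrow> complex" and i
    using that by (simp add: weighted_Lp_def)
  with weighted_bound_if_ratio_bounded[OF A S] show ?bounded by blast
qed

end

theorem corollary3p8:
  fixes p :: "'m::finite \<Rightarrow> real" and p0 q \<alpha> :: real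
    and w :: "'m \<Rightarrow> real ^ 'n::finite ^ 'k::finite \<Rightarrow> real"
    and wc :: "'m \<Rightarrow> 'k \<Rightarrow> real ^ 'n \<Rightarrow> real"
    and S :: "('m \<Rightarrow> real ^ 'n ^ 'k \<Rightarrow> complex) \<Rightarrow> real ^ 'n ^ 'k \<Rightarrow> ennreal"
  assumes k: "CARD('k) \<ge> 2"
    and p_gt_1: "\<And>i. 1 < p i"
    and p0: "1 / p0 = (\<Sum>i\<in>UNIV. 1 / p i)"
    and p0_less_q: "p0 < q"
    and \<alpha>: "0 < \<alpha>" "\<alpha> < real CARD('m) * real CARD('n)"
    and q: "1 / q = 1 / p0 - \<alpha> / real CARD('n)"
    and w_pos: "\<And>i. AE x in lebesgue. 0 < w i x"
    and w_weight: "\<And>i. weight (\<lambda>x. w i x powr p i)"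
    and w_prod: "\<And>i x. w i x = (\<Prod>j\<in>UNIV. wc i j (x $ j))"
    and S: "S = strong_frac_maximal (\<lambda>_. \<alpha>) \<or> S = riesz_prod_abs (\<lambda>_. \<alpha>)"
  shows
    "(\<exists>C::real. C > 0 \<and>
        (\<forall>f. (\<forall>i. f i \<in> weighted_Lp (p i) (\<lambda>x. w i x powr p i)) \<longrightarrow>
          (\<integral>\<^sup>+ x. (S f x * ennreal (\<Prod>i\<in>UNIV. w i x)) epowr q \<partial>lebesgue) epowr (1 / q)
            \<le> ennreal C *
               (\<Prod>i\<in>UNIV. (\<integral>\<^sup>+ x. ennreal ((norm (f i x) * w i x) powr p i) \<partial>lebesgue) epowr (1 / p i))))
     \<longleftrightarrow>
     (SUP Q \<in> {Q :: 'k \<Rightarrow> (real ^ 'n) set. \<forall>j. Q j \<in> cubes}.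
        (ennreal (1 / (\<Prod>j\<in>UNIV. measure lebesgue (Q j))) *
           (\<integral>\<^sup>+ x. ennreal ((\<Prod>i\<in>UNIV. w i x) powr q) * indicator (cube_prod Q) x \<partial>lebesgue)) epowr (1 / q) *
        (\<Prod>i\<in>UNIV.
          (ennreal (1 / (\<Prod>j\<in>UNIV. measure lebesgue (Q j))) *
             (\<integral>\<^sup>+ x. ennreal (w i x powr (- conj_exponent (p i))) * indicator (cube_prod Q) x \<partial>lebesgue))
             epowr (1 / conj_exponent (p i)))) < \<infinity>"
proof -
  have w_pos': "AE x in lborel. 0 < w i x" for i
    using w_pos[of i] by (simp add: AE_completion_iff)
  \<comment> \<open>The type \<open>'m\<close> has at least one element, so the sum of the
    \<open>1 / p i\<close> is positive; with \<open>p0 < q\<close> this makes \<open>q\<close>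
    positive.\<close>
  have "0 < p0"
  proof -
    have "0 < (\<Sum>i\<in>UNIV. 1 / p i)"
      using p_gt_1 by (intro sum_pos) (auto intro: less_trans[OF zero_less_one])
    then show ?thesis by (simp flip: p0)
  qed
  then have q_pos: "0 < q" using p0_less_q by simp
  have "\<exists>b. (\<forall>j. b j \<in> borel_measurable borel) \<and> (\<forall>j y. 0 < b j y) \<and>
      (AE x in lborel. w i x = (\<Prod>j\<in>UNIV. b j (x $ j)))" for i
  proof -
    obtain v where v: "v \<in> borel_measurable borel" "AE x in lborel. w i x powr p i = v x"
      using weight_Borel_version[OF w_weight[of i]] .
    have "(\<lambda>x. v x powr (1 / p i)) \<in> borel_measurable borel" using v(1) by measurable
    \<comment> \<open>Measurability is given for the power \<open>w i x powr p i\<close>; the root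
      recovers \<open>w i\<close> where it is positive.\<close>
    moreover have "AE x in lborel. w i x = v x powr (1 / p i)"
      using v(2) w_pos'[of i]
    proof eventually_elim
      case (elim x)
      then show ?case using p_gt_1[of i] by (simp add: powr_powr flip: elim(1))
    qed
    ultimately obtain b where "\<And>j. b j \<in> borel_measurable borel" "\<And>j y. 0 < b j y"
        "AE x in lborel. w i x = (\<Prod>j\<in>UNIV. b j (x $ j))"
      using product_function_Borel_version[OF _ _ w_pos'[of i] w_prod[of i]] by blast
    then show ?thesis by blast
  qed
  then have "\<forall>i. \<exists>b. (\<forall>j. b j \<in> borel_measurable borel) \<and> (\<forall>j y. 0 < b j y) \<and>
      (AE x in lborel. w i x = (\<Prod>j\<in>UNIV. b j (x $ j)))" by blast
  from choice[OF this] obtain b where b: "\<And>i j. b i j \<in> borel_measurable borel" "\<And>i j y. 0 < b i j y"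
      "\<And>i. AE x in lborel. w i x = (\<Prod>j\<in>UNIV. b i j (x $ j))" by blast
  interpret product_weights b p q \<alpha>
    by standard (use b p_gt_1 q_pos \<alpha> q p0 in auto)
  have wB: "AE x in lborel. w i x = B i x" for i unfolding B_def by (rule b(3))
  have wB_all: "AE x in lborel. \<forall>i. w i x = B i x"
    by (subst AE_all_countable) (intro allI wB)
  have Lp: "weighted_Lp (p i) (\<lambda>x. w i x powr p i) = weighted_Lp (p i) (\<lambda>x. B i x powr p i)" for i
  proof -
    have "(\<integral>\<^sup>+ x. ennreal (norm (f x) powr p i * w i x powr p i) \<partial>lebesgue) =
        (\<integral>\<^sup>+ x. ennreal (norm (f x) powr p i * B i x powr p i) \<partial>lebesgue)" for f :: "real^'n^'k \<Rightarrow> complex"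
      unfolding nn_integral_completion
      by (rule nn_integral_cong_AE) (use wB[of i] in \<open>eventually_elim, simp\<close>)
    then show ?thesis by (simp add: weighted_Lp_def)
  qed
  have lhs: "(\<integral>\<^sup>+ x. (S f x * ennreal (\<Prod>i\<in>UNIV. w i x)) epowr q \<partial>lebesgue) =
      (\<integral>\<^sup>+ x. (S f x * ennreal (\<Prod>i\<in>UNIV. B i x)) epowr q \<partial>lebesgue)" for f
    unfolding nn_integral_completion
    by (rule nn_integral_cong_AE) (use wB_all in \<open>eventually_elim, simp\<close>)
  have rhs: "(\<integral>\<^sup>+ x. ennreal ((norm (f i x) * w i x) powr p i) \<partial>lebesgue) =
      (\<integral>\<^sup>+ x. ennreal ((norm (f i x) * B i x) powr p i) \<partial>lebesgue)" for f :: "'m \<Rightarrow> real^'n^'k \<Rightarrow> complex" and i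
    unfolding nn_integral_completion
    by (rule nn_integral_cong_AE) (use wB[of i] in \<open>eventually_elim, simp\<close>)
  have prodw: "(\<integral>\<^sup>+x\<in>cube_prod Q. ennreal ((\<Prod>i\<in>UNIV. w i x) powr q) \<partial>lebesgue) =
      (\<integral>\<^sup>+x\<in>cube_prod Q. ennreal ((\<Prod>i\<in>UNIV. B i x) powr q) \<partial>lebesgue)" for Q
    unfolding nn_integral_completion
    by (rule nn_integral_cong_AE) (use wB_all in \<open>eventually_elim, simp\<close>)
  have dualw: "(\<integral>\<^sup>+x\<in>cube_prod Q. ennreal (w i x powr (- conj_exponent (p i))) \<partial>lebesgue) =
      (\<integral>\<^sup>+x\<in>cube_prod Q. ennreal (B i x powr (- conj_exponent (p i))) \<partial>lebesgue)" for i Q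
    unfolding nn_integral_completion
    by (rule nn_integral_cong_AE) (use wB[of i] in \<open>eventually_elim, simp\<close>)
  have sup: "(SUP Q \<in> {Q. \<forall>j. Q j \<in> cubes}. ratio Q) =
    (SUP Q \<in> {Q :: 'k \<Rightarrow> (real ^ 'n) set. \<forall>j. Q j \<in> cubes}.
        (ennreal (1 / (\<Prod>j\<in>UNIV. measure lebesgue (Q j))) *
           (\<integral>\<^sup>+x\<in>cube_prod Q. ennreal ((\<Prod>i\<in>UNIV. w i x) powr q) \<partial>lebesgue)) epowr (1 / q) *
        (\<Prod>i\<in>UNIV.
          (ennreal (1 / (\<Prod>j\<in>UNIV. measure lebesgue (Q j))) *
             (\<integral>\<^sup>+x\<in>cube_prod Q. ennreal (w i x powr (- conj_exponent (p i))) \<partial>lebesgue))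
             epowr (1 / conj_exponent (p i))))"
    unfolding prodw dualw by (rule SUP_cong[OF refl]) (rule ratio_eq[symmetric], blast)
  show ?thesis
    unfolding Lp lhs rhs sup[symmetric] 
    by (rule weighted_bound_iff_ratio[OF S, unfolded output_norm_def input_norm_def])
qed

end
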